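(* Let $\mathcal{A}\subset\mathbb{P}^n$ be an arrangement of $d$ hyperplanes. Denote by $S_0(\mathcal{A})=\{P\in S(\mathcal{A})\mid t_P\ge3\}$ the set of codimension two subspaces of $\mathbb{P}^n$ in $S(\mathcal{A})$ that are contained in at least three distinct hyperplanes of $\mathcal{A}$. Assume that no hyperplane in $\mathcal{A}$ contains two or more elements of $S_0(\mathcal{A})$. Denote by $s$ the number of hyperplanes of $\mathcal{A}$ that do not contain any $P\in S_0(\mathcal{A})$. Then the general residual of $\mathcal{A}$ has a minimal free resolution of the form $$0\to S^{2|S_0(\mathcal{A})|+s-1}(-d)\to S^{|S_0(\mathcal{A})|+s}(-d+1)\oplus\bigoplus_{P\in S_0(\mathcal{A})}S(-d+t_P-1)\to r_{\mathcal{A}}\to0.$$ In particular, $S/r_{\mathcal{A}}$ is Cohen–Macaulay and even the graded Betti numbers are combinatorially determined.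
   Context: $K$ is a field of characteristic zero, $n\ge2$, $S=K[x_0,\dots,x_n]$ with the standard grading. A hyperplane arrangement $\mathcal{A}\subset\mathbb{P}^n$ is a finite nonempty set of distinct hyperplanes, and $f_{\mathcal{A}}$ is the product of linear forms defining them; $\mathrm{Jac}(f_{\mathcal{A}})$ is the ideal generated by its first partial derivatives. $S(\mathcal{A})=\{H\cap H':H\neq H'\in\mathcal{A}\}$, and for $P\in S(\mathcal{A})$, $t_P$ is the number of hyperplanes of $\mathcal{A}$ containing $P$. For a linear form $\ell=\sum a_ix_i$, put $\frac{\partial f}{\partial\ell}=\sum_i a_i\frac{\partial f}{\partial x_i}$; for a general $\ell$ (in a suitable nonempty Zariski-open subset of $[S]_1$ depending on $\mathcal{A}$), the general residual is $r_{\mathcal{A}}=(f_{\mathcal{A}},\frac{\partial f_{\mathcal{A}}}{\partial\ell}):\mathrm{Jac}(f_{\mathcal{A}})$. "Combinatorially determined" means determined by the intersection lattice of $\mathcal{A}$. *)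

theory Defs
  imports
    "HOL-Library.Poly_Mapping"
    "HOL-Library.Extended_Nat"
    "HOL-Library.Cardinality"
    "Jordan_Normal_Form.Matrix"
begin

section \<open>The standard graded polynomial ring\<close>

text \<open>The variables are indexed by a finite type \<open>'v\<close>; for $S = K[x_0,\dots,x_n]$ one has
  \<open>CARD('v) = n + 1\<close>. The ring operations are those of \<^theory>\<open>HOL-Library.Poly_Mapping\<close>.\<close>

type_synonym ('v, 'k) mpoly = "('v \<Rightarrow>\<^sub>0 nat) \<Rightarrow>\<^sub>0 'k"

definition Const :: "'k \<Rightarrow> ('v::finite, 'k::field) mpoly" where
  "Const c = Poly_Mapping.single 0 c"

definition Var :: "'v \<Rightarrow> ('v::finite, 'k::field) mpoly" where
  "Var v = Poly_Mapping.single (Poly_Mapping.single v 1) 1"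

definition mon_degree :: "('v::finite \<Rightarrow>\<^sub>0 nat) \<Rightarrow> nat" where
  "mon_degree m = (\<Sum>v\<in>UNIV. Poly_Mapping.lookup m v)"

text \<open>The zero polynomial is homogeneous of every degree, and it is the only
  homogeneous polynomial of negative degree.\<close>

definition homogeneous :: "int \<Rightarrow> ('v::finite, 'k::field) mpoly \<Rightarrow> bool" where
  "homogeneous k p \<longleftrightarrow> (\<forall>m\<in>Poly_Mapping.keys p. int (mon_degree m) = k)"

definition irrelevant_ideal :: "('v::finite, 'k::field) mpoly set" where
  "irrelevant_ideal = {p. Poly_Mapping.lookup p 0 = 0}"

definition poly_eval :: "('v::finite, 'k::field) mpoly \<Rightarrow> ('v \<Rightarrow> 'k) \<Rightarrow> 'k" where
  "poly_eval p a =
     (\<Sum>m\<in>Poly_Mapping.keys p. Poly_Mapping.lookup p m * (\<Prod>v\<in>UNIV. a v ^ Poly_Mapping.lookup m v))"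

text \<open>The subtraction of exponents truncates only when the exponent of \<open>v\<close> is zero, and
  then the coefficient vanishes.\<close>

definition partial_deriv ::
  "'v \<Rightarrow> ('v::finite, 'k::field) mpoly \<Rightarrow> ('v, 'k) mpoly" where
  "partial_deriv v p = (\<Sum>m\<in>Poly_Mapping.keys p.
     Poly_Mapping.single (m - Poly_Mapping.single v 1)
       (of_nat (Poly_Mapping.lookup m v) * Poly_Mapping.lookup p m))"

text \<open>Linear forms are given by their coefficient vectors, so that $[S]_1$ is identified
  with \<open>'v \<Rightarrow> 'k\<close>; \<open>directional_deriv a f\<close> is $\partial f/\partial \ell$ for
  $\ell = \sum_v a_v x_v$.\<close>

definition linear_form :: "('v::finite \<Rightarrow> 'k::field) \<Rightarrow> ('v, 'k) mpoly" where
  "linear_form a = (\<Sum>v\<in>UNIV. Const (a v) * Var v)"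

definition directional_deriv ::
  "('v::finite \<Rightarrow> 'k::field) \<Rightarrow> ('v, 'k) mpoly \<Rightarrow> ('v, 'k) mpoly" where
  "directional_deriv a f = (\<Sum>v\<in>UNIV. Const (a v) * partial_deriv v f)"

definition zariski_open :: "('v::finite \<Rightarrow> 'k::field) set \<Rightarrow> bool" where
  "zariski_open U \<longleftrightarrow> (\<exists>T :: ('v, 'k) mpoly set. U = {a. \<exists>p\<in>T. poly_eval p a \<noteq> 0})"


section \<open>Ideals, Krull dimension, depth\<close>

abbreviation is_ideal :: "'r::comm_ring_1 set \<Rightarrow> bool" where
  "is_ideal \<equiv> Modules.module.subspace (*)"

abbreviation ideal_generated :: "'r::comm_ring_1 set \<Rightarrow> 'r set" where
  "ideal_generated \<equiv> Modules.module.span (*)"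

definition ideal_quotient :: "'r::comm_ring_1 set \<Rightarrow> 'r set \<Rightarrow> 'r set" where
  "ideal_quotient I J = {h. \<forall>g\<in>J. h * g \<in> I}"

definition is_prime_ideal :: "'r::comm_ring_1 set \<Rightarrow> bool" where
  "is_prime_ideal P \<longleftrightarrow> is_ideal P \<and> P \<noteq> UNIV \<and> (\<forall>a b. a * b \<in> P \<longrightarrow> a \<in> P \<or> b \<in> P)"

text \<open>In the following, \<open>I\<close> stands for the quotient ring $R/I$, whose prime ideals are
  the prime ideals of $R$ containing \<open>I\<close>.\<close>

definition krull_dim_quot :: "'r::comm_ring_1 set \<Rightarrow> enat" where
  "krull_dim_quot I = Sup {enat k | k. \<exists>P :: nat \<Rightarrow> 'r set.
     (\<forall>i\<le>k. is_prime_ideal (P i) \<and> I \<subseteq> P i) \<and> (\<forall>i<k. P i \<subset> P (Suc i))}"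

definition regular_sequence_quot :: "'r::comm_ring_1 set \<Rightarrow> 'r list \<Rightarrow> bool" where
  "regular_sequence_quot I xs \<longleftrightarrow>
     ideal_generated (I \<union> set xs) \<noteq> UNIV \<and>
     (\<forall>i<length xs. \<forall>g.
        xs ! i * g \<in> ideal_generated (I \<union> set (take i xs)) \<longrightarrow>
        g \<in> ideal_generated (I \<union> set (take i xs)))"

text \<open>The depth of the graded module $S/I$ is taken with respect to the irrelevant ideal.\<close>

definition depth_quot :: "('v::finite, 'k::field) mpoly set \<Rightarrow> enat" where
  "depth_quot I = Sup {enat (length xs) | xs.
     set xs \<subseteq> irrelevant_ideal \<and> regular_sequence_quot I xs}"

text \<open>By convention the zero module is Cohen--Macaulay.\<close>

definition cohen_macaulay_quot :: "('v::finite, 'k::field) mpoly set \<Rightarrow> bool" where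
  "cohen_macaulay_quot I \<longleftrightarrow> I = UNIV \<or> depth_quot I = krull_dim_quot I"


section \<open>Minimal graded free resolutions\<close>

text \<open>The graded modules considered are subquotients $J/I$ of $S$, for homogeneous ideals
  $I \subseteq J$; this covers an ideal $J$ (take $I = 0$) and a quotient ring $S/I$
  (take $J = S$).

  The list \<open>b i\<close> contains the degrees of a homogeneous basis of the \<open>i\<close>-th free module
  $F_i = \bigoplus_p S(-b_{i,p})$, whose elements are vectors of length \<open>length (b i)\<close>.
  The matrix \<open>\<phi> i\<close> represents the map $F_{i+1} \to F_i$, and the augmentation
  $F_0 \to J/I$ sends the \<open>p\<close>-th basis element to the class of \<open>g $ p\<close>. The conditions on
  homogeneity say that these maps have degree zero. A finite resolution is one with
  \<open>b i = []\<close> for large \<open>i\<close>. The last condition is minimality: the image of $F_{i+1}$ lies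
  in $\mathfrak{m} F_i$ for the irrelevant ideal $\mathfrak{m}$.\<close>

definition minimal_graded_free_resolution ::
  "('v::finite, 'k::field) mpoly set \<Rightarrow> ('v, 'k) mpoly set \<Rightarrow>
   (nat \<Rightarrow> int list) \<Rightarrow> ('v, 'k) mpoly vec \<Rightarrow> (nat \<Rightarrow> ('v, 'k) mpoly mat) \<Rightarrow> bool" where
  "minimal_graded_free_resolution J I b g \<phi> \<longleftrightarrow>
     g \<in> carrier_vec (length (b 0)) \<and>
     (\<forall>i. \<phi> i \<in> carrier_mat (length (b i)) (length (b (Suc i)))) \<and>
     (\<forall>p<length (b 0). g $ p \<in> J \<and> homogeneous (b 0 ! p) (g $ p)) \<and>
     (\<forall>i. \<forall>p<length (b i). \<forall>q<length (b (Suc i)).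
        homogeneous (b (Suc i) ! q - b i ! p) (\<phi> i $$ (p, q))) \<and>
     (\<forall>h\<in>J. \<exists>v\<in>carrier_vec (length (b 0)). h - g \<bullet> v \<in> I) \<and>
     {v \<in> carrier_vec (length (b 0)). g \<bullet> v \<in> I} =
       (\<lambda>w. \<phi> 0 *\<^sub>v w) ` carrier_vec (length (b 1)) \<and>
     (\<forall>i. {v \<in> carrier_vec (length (b (Suc i))). \<phi> i *\<^sub>v v = 0\<^sub>v (length (b i))} =
       (\<lambda>w. \<phi> (Suc i) *\<^sub>v w) ` carrier_vec (length (b (Suc (Suc i))))) \<and>
     (\<forall>i. \<forall>p<length (b i). \<forall>q<length (b (Suc i)). \<phi> i $$ (p, q) \<in> irrelevant_ideal)"

text \<open>\<open>\<beta> i\<close> is the multiset of degrees of the basis of $F_i$, so $S(-j)$ occurs in $F_i$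
  with multiplicity \<open>count (\<beta> i) j\<close>.\<close>

definition has_minimal_resolution ::
  "('v::finite, 'k::field) mpoly set \<Rightarrow> ('v, 'k) mpoly set \<Rightarrow> (nat \<Rightarrow> int multiset) \<Rightarrow> bool" where
  "has_minimal_resolution J I \<beta> \<longleftrightarrow>
     (\<exists>b g \<phi>. minimal_graded_free_resolution J I b g \<phi> \<and> (\<forall>i. mset (b i) = \<beta> i))"

definition graded_betti ::
  "('v::finite, 'k::field) mpoly set \<Rightarrow> ('v, 'k) mpoly set \<Rightarrow> nat \<Rightarrow> int \<Rightarrow> nat" where
  "graded_betti J I i j = (THE c. \<exists>\<beta>. has_minimal_resolution J I \<beta> \<and> c = count (\<beta> i) j)"


section \<open>Hyperplane arrangements\<close>

text \<open>A linear subspace of $\mathbb{P}^n$ is represented by its affine cone, a linear subspace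
  of $K^{n+1}$; in particular the empty subspace of $\mathbb{P}^n$ is represented by \<open>{0}\<close>.\<close>

definition hyperplane :: "('v::finite \<Rightarrow> 'k::field) \<Rightarrow> ('v \<Rightarrow> 'k) set" where
  "hyperplane a = {x. (\<Sum>v\<in>UNIV. a v * x v) = 0}"

definition hyperplane_arrangement :: "('v::finite \<Rightarrow> 'k::field) set set \<Rightarrow> bool" where
  "hyperplane_arrangement A \<longleftrightarrow>
     finite A \<and> A \<noteq> {} \<and> (\<forall>H\<in>A. \<exists>a. a \<noteq> (\<lambda>_. 0) \<and> H = hyperplane a)"

text \<open>\<open>f\<close> is a product of linear forms defining the hyperplanes; it is unique up to a
  nonzero scalar.\<close>

definition defining_polynomial ::
  "('v::finite \<Rightarrow> 'k::field) set set \<Rightarrow> ('v, 'k) mpoly \<Rightarrow> bool" where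
  "defining_polynomial A f \<longleftrightarrow>
     (\<exists>c. (\<forall>H\<in>A. c H \<noteq> (\<lambda>_. 0) \<and> H = hyperplane (c H)) \<and> f = (\<Prod>H\<in>A. linear_form (c H)))"

definition jacobian_ideal :: "('v::finite, 'k::field) mpoly \<Rightarrow> ('v, 'k) mpoly set" where
  "jacobian_ideal f = ideal_generated (range (\<lambda>v. partial_deriv v f))"

definition residual ::
  "('v::finite, 'k::field) mpoly \<Rightarrow> ('v \<Rightarrow> 'k) \<Rightarrow> ('v, 'k) mpoly set" where
  "residual f a =
     ideal_quotient (ideal_generated {f, directional_deriv a f}) (jacobian_ideal f)"

definition codim2_flats :: "('v::finite \<Rightarrow> 'k::field) set set \<Rightarrow> ('v \<Rightarrow> 'k) set set" where
  "codim2_flats A = {H \<inter> H' | H H'. H \<in> A \<and> H' \<in> A \<and> H \<noteq> H'}"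

definition hyperplanes_through ::
  "('v::finite \<Rightarrow> 'k::field) set set \<Rightarrow> ('v \<Rightarrow> 'k) set \<Rightarrow> nat" where
  "hyperplanes_through A P = card {H \<in> A. P \<subseteq> H}"

definition multiple_flats :: "('v::finite \<Rightarrow> 'k::field) set set \<Rightarrow> ('v \<Rightarrow> 'k) set set" where
  "multiple_flats A = {P \<in> codim2_flats A. hyperplanes_through A P \<ge> 3}"

text \<open>The lattice contains the ambient space as the empty intersection.\<close>

definition intersection_lattice ::
  "('v::finite \<Rightarrow> 'k::field) set set \<Rightarrow> ('v \<Rightarrow> 'k) set set" where
  "intersection_lattice A = {\<Inter>X | X. X \<subseteq> A}"

definition same_combinatorics ::
  "('v::finite \<Rightarrow> 'k::field) set set \<Rightarrow> ('v \<Rightarrow> 'k) set set \<Rightarrow> bool" where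
  "same_combinatorics A B \<longleftrightarrow>
     (\<exists>\<psi>. bij_betw \<psi> (intersection_lattice A) (intersection_lattice B) \<and>
        (\<forall>X\<in>intersection_lattice A. \<forall>Y\<in>intersection_lattice A. X \<subseteq> Y \<longleftrightarrow> \<psi> X \<subseteq> \<psi> Y))"

end

theory Submission
  imports Defs "HOL-Computational_Algebra.Polynomial"
begin

text \<open>Scale the linear forms so that \<open>l\<^sub>H(a) = 1\<close> for all \<open>H\<close>. Modulo \<open>l\<^sub>H\<close>, the derivative of \<open>f\<close> in
  direction \<open>v\<close> is \<open>l\<^sub>H(v) f/l\<^sub>H\<close>; hence \<open>h\<close> lies in the residual iff for every \<open>v\<close> some polynomial
  is congruent to \<open>l\<^sub>H(v) h\<close> modulo each \<open>l\<^sub>H\<close>. The assumption partitions the arrangement into pencils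
  (the hyperplanes through one multiple flat) and single hyperplanes, and the interpolation condition
  shows that the residual is the sum of the ideals \<open>F\<^sub>i (z\<^sub>i, y\<^sub>i)\<close>: here \<open>F\<^sub>i\<close> is the product of the forms
  outside the \<open>i\<close>-th group, \<open>z\<^sub>i\<close> that of all but one form of the group, and \<open>y\<^sub>i\<close> the form of the pencil that
  vanishes at \<open>a\<close>. Its syzygies are read off by reducing modulo each \<open>l\<^sub>H\<close>. The same computation works
  over every sufficiently general linear subspace; there the syzygies lift, so general linear forms are
  regular on the quotient, and the depth reaches the dimension.\<close>

text \<open>General position of the linear form means only that \<open>f\<close> is nonzero at its
  coefficient vector, read as a point. Characteristic zero enters through the infinite field:
  polynomial identities may be tested at points, congruences modulo ideals of linear subspaces
  become statements about values, and restriction to lines shows these ideals to be prime. Depth and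
  Krull dimension are both compared with \<open>CARD('v) - 2\<close>, that is with n - 1. A
  nonzerodivisor lies in no minimal prime, so depth never exceeds dimension; a prime over the
  residual contains two independent linear forms, and counting monomials then bounds the dimension.
  Betti numbers are given by a definite description, so they acquire values only once any two
  minimal resolutions are known to have the same degrees; this is the comparison theorem with chain
  homotopies, read off on constant terms. A single hyperplane is exceptional: its residual is the
  whole ring, and the quotient is the zero module.\<close>

lemma module_mult: "Modules.module ((*) :: 'r::comm_ring_1 \<Rightarrow> 'r \<Rightarrow> 'r)"
  by unfold_locales (simp_all add: distrib_left distrib_right mult.assoc)

lemmas
  ideal_subspace_0 = Modules.module.subspace_0[OF module_mult] and
  ideal_subspace_add = Modules.module.subspace_add[OF module_mult] and
  ideal_subspace_diff = Modules.module.subspace_diff[OF module_mult] and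
  ideal_subspace_scale = Modules.module.subspace_scale[OF module_mult] and
  ideal_subspace_sum = Modules.module.subspace_sum[OF module_mult] and
  ideal_subspace_span = Modules.module.subspace_span[OF module_mult] and
  ideal_span_add = Modules.module.span_add[OF module_mult] and
  ideal_span_diff = Modules.module.span_diff[OF module_mult] and
  ideal_span_scale = Modules.module.span_scale[OF module_mult] and
  ideal_span_base = Modules.module.span_base[OF module_mult] and
  ideal_span_mono = Modules.module.span_mono[OF module_mult] and
  ideal_span_minimal = Modules.module.span_minimal[OF module_mult] and
  ideal_span_superset = Modules.module.span_superset[OF module_mult] and
  ideal_span_breakdown_eq = Modules.module.span_breakdown_eq[OF module_mult] and
  ideal_span_induct_alt = Modules.module.span_induct_alt[OF module_mult] and
  ideal_span_zero = Modules.module.span_zero[OF module_mult]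

section \<open>Monomials and induction on polynomials\<close>

abbreviation "coeff_of \<equiv> Poly_Mapping.lookup"
abbreviation "mterm \<equiv> Poly_Mapping.single"

lemma mpoly_sum_monomials:
  fixes p :: "'a \<Rightarrow>\<^sub>0 'b::comm_monoid_add"
  shows "(\<Sum>m\<in>Poly_Mapping.keys p. mterm m (coeff_of p m)) = p"
proof (rule poly_mapping_eqI)
  fix k
  show "coeff_of (\<Sum>m\<in>Poly_Mapping.keys p. mterm m (coeff_of p m)) k = coeff_of p k"
  proof (cases "k \<in> Poly_Mapping.keys p")
    case True
    then have "(\<Sum>m\<in>Poly_Mapping.keys p. coeff_of (mterm m (coeff_of p m)) k)
        = (\<Sum>m\<in>Poly_Mapping.keys p. if m = k then coeff_of p k else 0)"
      by (intro sum.cong) (auto simp: lookup_single)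
    then show ?thesis using True by (simp add: lookup_sum)
  next
    case False
    then have "(\<Sum>m\<in>Poly_Mapping.keys p. coeff_of (mterm m (coeff_of p m)) k) = 0"
      by (intro sum.neutral) (auto simp: lookup_single when_def)
    then show ?thesis using False by (simp add: lookup_sum in_keys_iff)
  qed
qed

lemma mpoly_induct_monomials [case_names mterm add]:
  fixes p :: "'a \<Rightarrow>\<^sub>0 'b::comm_monoid_add"
  assumes "\<And>m c. P (mterm m c)" and "\<And>p q. P p \<Longrightarrow> P q \<Longrightarrow> P (p + q)"
  shows "P p"
proof -
  have "finite M \<Longrightarrow> P (\<Sum>m\<in>M. mterm m (coeff_of p m))" for M
  proof (induction M rule: finite_induct)
    case empty
    show ?case using assms(1)[of undefined 0] by simp
  next
    case (insert x F)
    then show ?case using assms by simp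
  qed
  from this[OF finite_keys[of p]] show ?thesis using mpoly_sum_monomials[of p] by simp
qed

lemma Const_0 [simp]: "Const 0 = 0" by (simp add: Const_def)
lemma Const_1 [simp]: "Const 1 = 1" by (simp add: Const_def)
lemma Const_add: "Const (a + b) = Const a + Const b" by (simp add: Const_def single_add)
lemma Const_mult: "Const (a * b) = Const a * Const b" by (simp add: Const_def mult_single)
lemma Const_inverse: "c \<noteq> 0 \<Longrightarrow> Const c * Const (inverse c) = 1"
  by (simp flip: Const_mult)

lemma monomial_eq_Const_prod:
  fixes m :: "'v::finite \<Rightarrow>\<^sub>0 nat" and c :: "'k::field"
  shows "mterm m c = Const c * (\<Prod>v\<in>UNIV. Var v ^ coeff_of m v)"
proof -
  have pow: "(Var v :: ('v,'k) mpoly) ^ n = mterm (mterm v n) 1" for v n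
    by (induction n) (simp_all add: Var_def mult_single flip: single_add)
  have "(\<Prod>v\<in>T. (Var v :: ('v,'k) mpoly) ^ coeff_of m v) = mterm (\<Sum>v\<in>T. mterm v (coeff_of m v)) 1" for T
    by (induction T rule: infinite_finite_induct) (simp_all add: pow mult_single)
  moreover have "(\<Sum>v\<in>UNIV. mterm v (coeff_of m v)) = m"
  proof -
    have "(\<Sum>v\<in>UNIV. mterm v (coeff_of m v)) = (\<Sum>v\<in>Poly_Mapping.keys m. mterm v (coeff_of m v))"
      by (rule sum.mono_neutral_right) (auto simp: in_keys_iff)
    then show ?thesis using mpoly_sum_monomials[of m] by simp
  qed
  ultimately show ?thesis by (simp add: Const_def mult_single)
qed

lemma mpoly_induct [case_names Const Var add mult]:
  fixes p :: "('v::finite, 'k::field) mpoly"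
  assumes C: "\<And>c. P (Const c)" and V: "\<And>v. P (Var v)"
    and A: "\<And>p q. P p \<Longrightarrow> P q \<Longrightarrow> P (p + q)" and M: "\<And>p q. P p \<Longrightarrow> P q \<Longrightarrow> P (p * q)"
  shows "P p"
proof (induction p rule: mpoly_induct_monomials)
  case (mterm m c)
  have 1: "P 1" using C[of 1] by simp
  have pow: "P (Var v ^ n)" for v n by (induction n) (simp_all add: 1 M V)
  have "P (\<Prod>v\<in>T. Var v ^ coeff_of m v)" for T
    by (induction T rule: infinite_finite_induct) (simp_all add: 1 pow M)
  then show ?case by (simp add: monomial_eq_Const_prod M C)
qed (rule A)

section \<open>Evaluation homomorphisms\<close>

text \<open>One evaluation serves three targets that differ only in the embedding \<open>c\<close>
  of the coefficients: values at a point, one-variable polynomials along a parametrised curve, and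
  substitution into a polynomial ring.\<close>

locale coeff_hom =
  fixes c :: "'k::field \<Rightarrow> 'r::comm_ring_1"
  assumes c_1 [simp]: "c 1 = 1" and c_add: "c (a + b) = c a + c b" and c_mult: "c (a * b) = c a * c b"
begin

lemma c_0 [simp]: "c 0 = 0" using c_add[of 0 0] by simp

definition ev :: "('v::finite \<Rightarrow> 'r) \<Rightarrow> ('v, 'k) mpoly \<Rightarrow> 'r" where
  "ev x p = (\<Sum>m\<in>Poly_Mapping.keys p. c (coeff_of p m) * (\<Prod>v\<in>UNIV. x v ^ coeff_of m v))"

lemma ev_superset:
  assumes "finite M" "Poly_Mapping.keys p \<subseteq> M"
  shows "ev x p = (\<Sum>m\<in>M. c (coeff_of p m) * (\<Prod>v\<in>UNIV. x v ^ coeff_of m v))"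
  unfolding ev_def by (rule sum.mono_neutral_left) (use assms in \<open>auto simp: in_keys_iff\<close>)

lemma ev_mterm: "ev x (mterm m a) = c a * (\<Prod>v\<in>UNIV. x v ^ coeff_of m v)"
  by (subst ev_superset[of "{m}"]) auto

lemma ev_add: "ev x (p + q) = ev x p + ev x q"
proof -
  let ?M = "Poly_Mapping.keys p \<union> Poly_Mapping.keys q"
  have "Poly_Mapping.keys (p + q) \<subseteq> ?M" by (rule keys_add)
  then show ?thesis
    by (simp add: ev_superset[of ?M] lookup_add c_add algebra_simps sum.distrib)
qed

lemma ev_mult: "ev x (p * q) = ev x p * ev x q"
proof (induction p arbitrary: q rule: mpoly_induct_monomials)
  case (mterm m a)
  show ?case
  proof (induction q rule: mpoly_induct_monomials)
    case (mterm n b)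
    show ?case
      by (simp only: mult_single ev_mterm c_mult lookup_add power_add prod.distrib ac_simps)
  qed (simp only: distrib_left ev_add)
qed (simp only: distrib_right ev_add)

lemma ev_Const [simp]: "ev x (Const a) = c a"
  by (simp add: Const_def ev_mterm)

lemma ev_0 [simp]: "ev x 0 = 0" and ev_1 [simp]: "ev x 1 = 1"
  using ev_Const[of x 0] ev_Const[of x 1] by simp_all

lemma ev_Var [simp]: "ev x (Var v) = x v"
proof -
  have "(\<Prod>w\<in>UNIV. x w ^ coeff_of (mterm v 1) w) = (\<Prod>w\<in>UNIV. if w = v then x v else 1)"
    by (intro prod.cong) (auto simp: lookup_single)
  then show ?thesis by (simp add: Var_def ev_mterm)
qed

lemma ev_uminus: "ev x (- p) = - ev x p"
proof -
  have "ev x p + ev x (- p) = 0" using ev_add[of x p "- p"] by simp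
  then show ?thesis by (rule minus_unique[symmetric])
qed

lemma ev_diff: "ev x (p - q) = ev x p - ev x q"
  by (simp only: diff_conv_add_uminus ev_add ev_uminus)

lemma ev_sum: "ev x (sum g T) = (\<Sum>i\<in>T. ev x (g i))"
  by (induction T rule: infinite_finite_induct) (simp_all add: ev_add)

lemma ev_prod: "ev x (prod g T) = (\<Prod>i\<in>T. ev x (g i))"
  by (induction T rule: infinite_finite_induct) (simp_all add: ev_mult)

lemma ev_power: "ev x (p ^ n) = ev x p ^ n"
  by (induction n) (simp_all add: ev_mult)

end

lemma coeff_hom_id: "coeff_hom (\<lambda>a::'k::field. a)"
  by unfold_locales simp_all

lemma poly_eval_ev: "poly_eval p x = coeff_hom.ev (\<lambda>a. a) x p"
  unfolding coeff_hom.ev_def[OF coeff_hom_id] poly_eval_def by (rule refl)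

lemma eval_simps [simp]:
  shows "poly_eval (Const a) x = a" "poly_eval (Var v) x = x v"
    and "poly_eval 0 x = 0" "poly_eval 1 x = 1"
    and "poly_eval (p + q) x = poly_eval p x + poly_eval q x"
    and "poly_eval (p - q) x = poly_eval p x - poly_eval q x"
    and "poly_eval (- p) x = - poly_eval p x"
    and "poly_eval (p * q) x = poly_eval p x * poly_eval q x"
    and "poly_eval (p ^ n) x = poly_eval p x ^ n"
    and "poly_eval (sum g T) x = (\<Sum>i\<in>T. poly_eval (g i) x)"
    and "poly_eval (prod g T) x = (\<Prod>i\<in>T. poly_eval (g i) x)"
  unfolding poly_eval_ev
  by (rule coeff_hom.ev_Const[OF coeff_hom_id] coeff_hom.ev_Var[OF coeff_hom_id]
      coeff_hom.ev_0[OF coeff_hom_id] coeff_hom.ev_1[OF coeff_hom_id]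
      coeff_hom.ev_add[OF coeff_hom_id] coeff_hom.ev_diff[OF coeff_hom_id]
      coeff_hom.ev_uminus[OF coeff_hom_id] coeff_hom.ev_mult[OF coeff_hom_id]
      coeff_hom.ev_power[OF coeff_hom_id] coeff_hom.ev_sum[OF coeff_hom_id]
      coeff_hom.ev_prod[OF coeff_hom_id])+

interpretation univ: coeff_hom "\<lambda>a::'k::field. [:a:]"
  by unfold_locales (simp_all add: one_pCons)

interpretation subst: coeff_hom "Const :: 'k::field \<Rightarrow> ('w::finite, 'k) mpoly"
  by unfold_locales (simp_all add: Const_add Const_mult)

lemma poly_univ_ev: "poly (univ.ev x p) t = poly_eval p (\<lambda>v. poly (x v) t)"
  by (induction p rule: mpoly_induct) (simp_all add: univ.ev_add univ.ev_mult)

lemma eval_subst: "poly_eval (subst.ev \<pi> p) x = poly_eval p (\<lambda>v. poly_eval (\<pi> v) x)"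
  by (induction p rule: mpoly_induct) (simp_all add: subst.ev_add subst.ev_mult)

text \<open>Assignments of the variables that agree modulo an ideal give congruent values; for
  products, \<open>p * q - p' * q' = q * (p - p') + p' * (q - q')\<close> with a prime marking the
  substituted polynomial.\<close>

lemma diff_subst_in_ideal:
  assumes I: "is_ideal I" and "\<And>v. Var v - \<pi> v \<in> I"
  shows "p - subst.ev \<pi> p \<in> I"
proof (induction p rule: mpoly_induct)
  case (Const c)
  show ?case using I by (simp add: ideal_subspace_0)
next
  case (Var v)
  show ?case using assms by simp
next
  case (add p q)
  then have "(p - subst.ev \<pi> p) + (q - subst.ev \<pi> q) \<in> I" by (rule ideal_subspace_add[OF I])
  then show ?case by (simp add: subst.ev_add algebra_simps)
next
  case (mult p q)
  have "q * (p - subst.ev \<pi> p) + subst.ev \<pi> p * (q - subst.ev \<pi> q) \<in> I"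
    by (intro ideal_subspace_add[OF I] ideal_subspace_scale[OF I] mult)
  then show ?case by (simp add: subst.ev_mult algebra_simps)
qed

text \<open>The lowest digit is the remainder modulo \<open>N\<close>, and the induction continues
  with the quotient. The digits will be the exponents of a monomial.\<close>

lemma digits_unique:
  fixes a b :: "nat \<Rightarrow> nat"
  assumes "\<And>i. i < n \<Longrightarrow> a i < N" "\<And>i. i < n \<Longrightarrow> b i < N"
    and "(\<Sum>i<n. a i * N ^ i) = (\<Sum>i<n. b i * N ^ i)" and "i < n"
  shows "a i = b i"
  using assms
proof (induction n arbitrary: a b i)
  case (Suc n)
  have expand: "(\<Sum>i<Suc n. c i * N ^ i) = c 0 + N * (\<Sum>i<n. c (Suc i) * N ^ i)" for c :: "nat \<Rightarrow> nat"
    by (subst sum.lessThan_Suc_shift) (simp add: sum_distrib_left mult_ac)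
  have lt: "a 0 < N" "b 0 < N" using Suc.prems by auto
  then have eq: "a 0 + N * (\<Sum>i<n. a (Suc i) * N ^ i) = b 0 + N * (\<Sum>i<n. b (Suc i) * N ^ i)"
    using Suc.prems(3) unfolding expand by simp
  have "a 0 = (a 0 + N * (\<Sum>i<n. a (Suc i) * N ^ i)) mod N" using lt by simp
  also have "\<dots> = b 0" unfolding eq using lt by simp
  finally have 0: "a 0 = b 0" .
  with eq lt have "(\<Sum>i<n. a (Suc i) * N ^ i) = (\<Sum>i<n. b (Suc i) * N ^ i)" by simp
  then have "i' < n \<Longrightarrow> a (Suc i') = b (Suc i')" for i'
    using Suc.IH[of "\<lambda>i. a (Suc i)" "\<lambda>i. b (Suc i)" i'] Suc.prems by simp
  with 0 Suc.prems(4) show ?case by (cases i) auto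
qed simp

text \<open>The Kronecker substitution \<open>x\<^sub>v \<mapsto> X ^ N ^ e v\<close> keeps the monomials of \<open>p\<close> apart.\<close>

lemma eval_faithful:
  fixes p :: "('v::finite, 'k::field_char_0) mpoly"
  assumes "\<And>x. poly_eval p x = 0"
  shows "p = 0"
proof (rule ccontr)
  assume "p \<noteq> 0"
  then obtain m where m: "m \<in> Poly_Mapping.keys p"
    by (meson ex_in_conv keys_eq_empty)
  define M where "M = (\<lambda>(m, v). coeff_of m v) ` (Poly_Mapping.keys p \<times> (UNIV :: 'v set))"
  have "finite M" by (simp add: M_def)
  then obtain N where N: "\<forall>i\<in>M. i < N" using finite_nat_set_iff_bounded by blast
  obtain e :: "'v \<Rightarrow> nat" where e: "bij_betw e UNIV {..<CARD('v)}"
    using ex_bij_betw_finite_nat[of "UNIV :: 'v set"] by (auto simp: atLeast0LessThan)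
  define wt where "wt m = (\<Sum>v\<in>UNIV. coeff_of m v * N ^ e v)" for m :: "'v \<Rightarrow>\<^sub>0 nat"
  define X where "X v = monom (1::'k) (N ^ e v)" for v :: 'v
  have X: "(\<Prod>v\<in>UNIV. X v ^ coeff_of m v) = monom 1 (wt m)" for m
  proof -
    have "(\<Prod>v\<in>T. X v ^ coeff_of m v) = monom 1 (\<Sum>v\<in>T. coeff_of m v * N ^ e v)" for T
      by (induction T rule: infinite_finite_induct)
        (simp_all add: X_def monom_power mult_monom mult.commute)
    then show ?thesis by (simp add: wt_def)
  qed
  have inj: "m = m'" if mm: "m \<in> Poly_Mapping.keys p" "m' \<in> Poly_Mapping.keys p" "wt m = wt m'" for m m'
  proof (rule poly_mapping_eqI)
    fix v
    define d where "d = inv_into UNIV e"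
    have ed: "i < CARD('v) \<Longrightarrow> e (d i) = i" for i
      using e by (simp add: d_def bij_betw_inv_into_right)
    have de: "d (e v) = v" for v using e by (simp add: d_def bij_betw_inv_into_left)
    have wt: "wt m = (\<Sum>i<CARD('v). coeff_of m (d i) * N ^ i)" for m
    proof -
      have "(\<Sum>v\<in>UNIV. coeff_of m (d (e v)) * N ^ e v) = (\<Sum>i<CARD('v). coeff_of m (d i) * N ^ i)"
        by (rule sum.reindex_bij_betw[OF e])
      then show ?thesis by (simp add: wt_def de)
    qed
    have b: "coeff_of m v < N" if "m \<in> Poly_Mapping.keys p" for m v
      using N that by (auto simp: M_def image_iff)
    have "e v < CARD('v)" using e by (auto simp: bij_betw_def)
    moreover have "(\<Sum>i<CARD('v). coeff_of m (d i) * N ^ i) = (\<Sum>i<CARD('v). coeff_of m' (d i) * N ^ i)"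
      using mm(3) unfolding wt .
    ultimately have "coeff_of m (d (e v)) = coeff_of m' (d (e v))"
      using digits_unique[of "CARD('v)" "\<lambda>i. coeff_of m (d i)" N "\<lambda>i. coeff_of m' (d i)" "e v"]
        b[OF mm(1)] b[OF mm(2)] by blast
    then show "coeff_of m v = coeff_of m' v" by (simp add: de)
  qed
  have "coeff (univ.ev X p) (wt m) = (\<Sum>m'\<in>Poly_Mapping.keys p. if m' = m then coeff_of p m else 0)"
    unfolding univ.ev_def X coeff_sum
    by (intro sum.cong) (use m inj in auto)
  also have "\<dots> \<noteq> 0" using m by (auto simp: in_keys_iff)
  finally have "univ.ev X p \<noteq> 0" by auto
  moreover have "poly (univ.ev X p) t = 0" for t by (simp add: poly_univ_ev assms)
  ultimately show False using poly_all_0_iff_0 by blast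
qed

lemma eval_eqI:
  fixes p q :: "('v::finite, 'k::field_char_0) mpoly"
  assumes "\<And>x. poly_eval p x = poly_eval q x"
  shows "p = q"
  using eval_faithful[of "p - q"] assms by simp

section \<open>Derivatives of products of linear forms\<close>

lemma partial_deriv_superset:
  assumes "finite M" "Poly_Mapping.keys p \<subseteq> M"
  shows "partial_deriv v p = (\<Sum>m\<in>M. mterm (m - mterm v 1) (of_nat (coeff_of m v) * coeff_of p m))"
  unfolding partial_deriv_def
  by (rule sum.mono_neutral_left) (use assms in \<open>auto simp: in_keys_iff\<close>)

lemma partial_deriv_mterm:
  "partial_deriv v (mterm m a) = mterm (m - mterm v 1) (of_nat (coeff_of m v) * a)"
  by (subst partial_deriv_superset[of "{m}"]) auto

lemma partial_deriv_add: "partial_deriv v (p + q) = partial_deriv v p + partial_deriv v q"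
proof -
  let ?M = "Poly_Mapping.keys p \<union> Poly_Mapping.keys q"
  have "Poly_Mapping.keys (p + q) \<subseteq> ?M" by (rule keys_add)
  then show ?thesis
    by (simp add: partial_deriv_superset[of ?M] lookup_add distrib_left sum.distrib single_add)
qed

lemma partial_deriv_mult:
  fixes p q :: "('v::finite, 'k::field) mpoly"
  shows "partial_deriv v (p * q) = partial_deriv v p * q + p * partial_deriv v q"
proof (induction p arbitrary: q rule: mpoly_induct_monomials)
  case (mterm m a)
  show ?case
  proof (induction q rule: mpoly_induct_monomials)
    case (mterm n b)
    let ?e = "mterm v (1::nat)"
    \<comment> \<open>Subtraction of exponents truncates, so it commutes with addition only where
      the exponent of \<open>v\<close> is positive; otherwise the factor \<open>of_nat 0\<close>
      removes the term.\<close>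
    have sub: "i - ?e + j = i + j - ?e" if "coeff_of i v \<noteq> 0" for i j :: "'v \<Rightarrow>\<^sub>0 nat"
      using that by (intro poly_mapping_eqI) (auto simp: lookup_add lookup_minus lookup_single when_def)
    have l: "mterm (m - ?e) (of_nat (coeff_of m v) * a) * mterm n b
        = mterm (m + n - ?e) (of_nat (coeff_of m v) * (a * b))"
    proof (cases "coeff_of m v = 0")
      case False
      show ?thesis by (simp only: mult_single sub[OF False] mult.assoc)
    qed simp
    have r: "mterm m a * mterm (n - ?e) (of_nat (coeff_of n v) * b)
        = mterm (m + n - ?e) (of_nat (coeff_of n v) * (a * b))"
    proof (cases "coeff_of n v = 0")
      case False
      have "m + (n - ?e) = m + n - ?e" using sub[OF False, of m] by (simp only: add.commute)
      then show ?thesis by (simp only: mult_single mult.left_commute)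
    qed simp
    have lhs: "partial_deriv v (mterm m a * mterm n b) = mterm (m + n - ?e) (of_nat (coeff_of (m + n) v) * (a * b))"
      by (simp only: mult_single partial_deriv_mterm)
    have "of_nat (coeff_of (m + n) v) * (a * b)
        = of_nat (coeff_of m v) * (a * b) + of_nat (coeff_of n v) * (a * b)"
      by (simp add: lookup_add distrib_right)
    then show ?case
      unfolding lhs unfolding partial_deriv_mterm unfolding l r by (simp only: single_add)
  next
    case (add p q)
    then show ?case by (simp only: distrib_left partial_deriv_add add.assoc add.left_commute)
  qed
next
  case (add p q)
  show ?case unfolding distrib_right partial_deriv_add add by (simp only: ac_simps)
qed

lemma partial_deriv_Const [simp]: "partial_deriv v (Const c) = 0"
  by (simp add: Const_def partial_deriv_mterm)

lemma partial_deriv_0 [simp]: "partial_deriv v 0 = 0" and partial_deriv_1 [simp]: "partial_deriv v 1 = 0"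
  using partial_deriv_Const[of v 0] partial_deriv_Const[of v 1] by simp_all

lemma partial_deriv_sum: "partial_deriv v (sum g T) = (\<Sum>i\<in>T. partial_deriv v (g i))"
  by (induction T rule: infinite_finite_induct) (simp_all add: partial_deriv_add)

lemma partial_deriv_Var: "partial_deriv v (Var w) = (if v = w then 1 else 0)"
  by (auto simp: Var_def partial_deriv_mterm lookup_single when_def)

lemma partial_deriv_linear_form: "partial_deriv v (linear_form a) = Const (a v)"
proof -
  have "partial_deriv v (linear_form a) = (\<Sum>w\<in>UNIV. if w = v then Const (a v) else 0)"
    unfolding linear_form_def partial_deriv_sum
    by (intro sum.cong) (auto simp: partial_deriv_mult partial_deriv_Var)
  then show ?thesis by simp
qed

lemma partial_deriv_prod:
  assumes "finite T"
  shows "partial_deriv v (prod g T) = (\<Sum>i\<in>T. partial_deriv v (g i) * prod g (T - {i}))"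
  using assms
proof (induction T rule: finite_induct)
  case (insert x F)
  have "(\<Sum>i\<in>F. partial_deriv v (g i) * prod g (insert x F - {i}))
      = (\<Sum>i\<in>F. g x * (partial_deriv v (g i) * prod g (F - {i})))"
  proof (intro sum.cong refl)
    fix i assume "i \<in> F"
    then have "insert x F - {i} = insert x (F - {i})" using insert by auto
    then have "prod g (insert x F - {i}) = g x * prod g (F - {i})" using insert by simp
    then show "partial_deriv v (g i) * prod g (insert x F - {i})
        = g x * (partial_deriv v (g i) * prod g (F - {i}))" by (simp only: ac_simps)
  qed
  then show ?case using insert
    by (simp add: partial_deriv_mult sum_distrib_left)
qed simp

section \<open>Polynomials vanishing on linear subspaces\<close>

definition dot :: "('v::finite \<Rightarrow> 'k::field) \<Rightarrow> ('v \<Rightarrow> 'k) \<Rightarrow> 'k" where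
  "dot a x = (\<Sum>v\<in>UNIV. a v * x v)"

lemma hyperplane_iff: "x \<in> hyperplane a \<longleftrightarrow> dot a x = 0"
  by (simp add: hyperplane_def dot_def)

lemma eval_linear_form [simp]: "poly_eval (linear_form a) x = dot a x"
  by (simp add: linear_form_def dot_def)

lemma dot_linear_right: "dot a (\<lambda>v. s * x v + t * y v) = s * dot a x + t * dot a y"
  unfolding dot_def sum_distrib_left sum.distrib[symmetric]
  by (intro sum.cong refl) (simp add: algebra_simps)

lemma dot_linear_left: "dot (\<lambda>v. s * a v + t * b v) x = s * dot a x + t * dot b x"
  unfolding dot_def sum_distrib_left sum.distrib[symmetric]
  by (intro sum.cong refl) (simp add: algebra_simps)

lemma dot_0 [simp]: "dot a (\<lambda>_. 0) = 0" "dot (\<lambda>_. 0) x = 0"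
  by (simp_all add: dot_def)

definition vec_unit :: "'v \<Rightarrow> 'v \<Rightarrow> 'k::field" where
  "vec_unit v = (\<lambda>w. if w = v then 1 else 0)"

lemma dot_unit [simp]: "dot a (vec_unit v) = a v" "dot (vec_unit v) x = x v"
  by (simp_all add: dot_def vec_unit_def if_distrib[of "\<lambda>c. _ * c"] if_distrib[of "\<lambda>c. c * _"] cong: if_cong)

lemma linear_form_combination:
  fixes a b :: "'v::finite \<Rightarrow> 'k::field_char_0"
  shows "linear_form (\<lambda>v. s * a v + t * b v) = Const s * linear_form a + Const t * linear_form b"
  by (rule eval_eqI) (simp add: dot_linear_left)

definition lin_closed :: "('v \<Rightarrow> 'k::field) set \<Rightarrow> bool" where
  "lin_closed W \<longleftrightarrow> (\<forall>x\<in>W. \<forall>y\<in>W. \<forall>s t. (\<lambda>v. s * x v + t * y v) \<in> W)"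

text \<open>Congruence modulo the ideal of a linear subspace is expressed by values at its points;
  \<open>van_zeros_iff\<close> identifies the two notions.\<close>

definition van :: "('v::finite \<Rightarrow> 'k::field) set \<Rightarrow> ('v, 'k) mpoly \<Rightarrow> bool" where
  "van W p \<longleftrightarrow> (\<forall>x\<in>W. poly_eval p x = 0)"

lemma van_0 [simp]: "van W 0" by (simp add: van_def)
lemma van_add: "van W p \<Longrightarrow> van W q \<Longrightarrow> van W (p + q)" by (simp add: van_def)
lemma van_diff: "van W p \<Longrightarrow> van W q \<Longrightarrow> van W (p - q)" by (simp add: van_def)
lemma van_mult_left: "van W q \<Longrightarrow> van W (p * q)" by (simp add: van_def)
lemma van_mult_right: "van W p \<Longrightarrow> van W (p * q)" by (simp add: van_def)
lemma van_sum: "(\<And>i. i \<in> T \<Longrightarrow> van W (g i)) \<Longrightarrow> van W (sum g T)" by (simp add: van_def)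
lemma van_mono: "van W p \<Longrightarrow> W' \<subseteq> W \<Longrightarrow> van W' p" by (auto simp: van_def)
lemma van_UNIV_iff [simp]: "van UNIV (p :: ('v::finite, 'k::field_char_0) mpoly) \<longleftrightarrow> p = 0"
  using eval_faithful[of p] by (auto simp: van_def)
lemma van_linear_form_iff: "van W (linear_form a) \<longleftrightarrow> W \<subseteq> hyperplane a"
  by (auto simp: van_def hyperplane_iff)

text \<open>Along the line through a point of \<open>W\<close> where \<open>p\<close> is nonzero and
  one where \<open>q\<close> is nonzero, both restrict to nonzero one-variable polynomials, whose
  product cannot vanish at every parameter of an infinite field.\<close>

lemma van_prime:
  fixes p q :: "('v::finite, 'k::field_char_0) mpoly"
  assumes W: "lin_closed W" and pq: "van W (p * q)"
  shows "van W p \<or> van W q"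
proof (rule ccontr)
  assume "\<not> ?thesis"
  then obtain x y where x: "x \<in> W" "poly_eval p x \<noteq> 0" and y: "y \<in> W" "poly_eval q y \<noteq> 0"
    by (auto simp: van_def)
  define l where "l v = [: x v, y v - x v :]" for v
  have l: "(\<lambda>v. poly (l v) t) = (\<lambda>v. (1 - t) * x v + t * y v)" for t
    by (rule ext) (simp add: l_def algebra_simps)
  have p: "poly (univ.ev l p) t = poly_eval p (\<lambda>v. (1 - t) * x v + t * y v)" for t
    by (simp only: poly_univ_ev l)
  have q: "poly (univ.ev l q) t = poly_eval q (\<lambda>v. (1 - t) * x v + t * y v)" for t
    by (simp only: poly_univ_ev l)
  have "poly (univ.ev l p * univ.ev l q) t = 0" for t
  proof -
    have "(\<lambda>v. (1 - t) * x v + t * y v) \<in> W" using W x y unfolding lin_closed_def by blast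
    then show ?thesis using pq by (simp add: p q van_def)
  qed
  then have "univ.ev l p * univ.ev l q = 0" using poly_all_0_iff_0 by blast
  then have "univ.ev l p = 0 \<or> univ.ev l q = 0" by simp
  moreover have "univ.ev l p \<noteq> 0" using p[of 0] x by auto
  moreover have "univ.ev l q \<noteq> 0" using q[of 1] y by auto
  ultimately show False by blast
qed

lemma van_prime_prod:
  fixes g :: "'i \<Rightarrow> ('v::finite, 'k::field_char_0) mpoly"
  assumes "lin_closed W" "W \<noteq> {}" "van W (prod g T)"
  shows "\<exists>i\<in>T. van W (g i)"
  using assms(3)
proof (induction T rule: infinite_finite_induct)
  case (insert x F)
  then show ?case using van_prime[OF assms(1), of "g x" "prod g F"] by auto
qed (use assms(2) in \<open>auto simp: van_def\<close>)

lemma mpoly_no_zero_divisors: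
  fixes p q :: "('v::finite, 'k::field_char_0) mpoly"
  assumes "p * q = 0"
  shows "p = 0 \<or> q = 0"
  using van_prime[of UNIV p q] assms by (simp add: lin_closed_def)

section \<open>Linear subspaces cut out by equations, and their ideals\<close>

definition flat :: "('v::finite \<Rightarrow> 'k::field) set \<Rightarrow> bool" where
  "flat W \<longleftrightarrow> (\<exists>\<Lambda>. finite \<Lambda> \<and> W = {x. \<forall>a\<in>\<Lambda>. dot a x = 0})"

lemma flat_UNIV: "flat UNIV" unfolding flat_def by (rule exI[of _ "{}"]) simp

lemma flat_Int_hyperplane: 
  assumes "flat W" shows "flat (W \<inter> hyperplane a)"
proof -
  obtain \<Lambda> where "finite \<Lambda>" "W = {x. \<forall>a\<in>\<Lambda>. dot a x = 0}" using assms by (auto simp: flat_def)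
  then show ?thesis unfolding flat_def
    by (intro exI[of _ "insert a \<Lambda>"]) (auto simp: hyperplane_iff)
qed

lemma flat_hyperplane: "flat (hyperplane a)"
  using flat_Int_hyperplane[OF flat_UNIV] by simp

lemma flat_lin_closed: "flat W \<Longrightarrow> lin_closed W"
  by (auto simp: flat_def lin_closed_def dot_linear_right)

lemma flat_0: "flat W \<Longrightarrow> (\<lambda>_. 0) \<in> W"
  by (auto simp: flat_def)

lemma flat_nonempty: "flat W \<Longrightarrow> W \<noteq> {}"
  using flat_0 by blast

lemma flat_prime:
  fixes p q :: "('v::finite, 'k::field_char_0) mpoly"
  shows "flat W \<Longrightarrow> van W (p * q) \<Longrightarrow> \<not> van W p \<Longrightarrow> van W q"
  using van_prime[OF flat_lin_closed] by blast

lemma flat_prime_prod: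
  fixes g :: "'i \<Rightarrow> ('v::finite, 'k::field_char_0) mpoly"
  assumes "flat W" "\<And>i. i \<in> T \<Longrightarrow> \<not> van W (g i)"
  shows "\<not> van W (prod g T)"
  using van_prime_prod[OF flat_lin_closed flat_nonempty] assms by blast

text \<open>Gaussian elimination, phrased as a projection onto the common zeros that is the identity
  modulo the equations. An equation \<open>b\<close> not vanishing on the zeros so far is absorbed
  by subtracting its value times a vector \<open>w\<close> of them with
  \<open>dot b w = 1\<close>.\<close>

lemma zeros_projection:
  fixes \<Lambda> :: "('v::finite \<Rightarrow> 'k::field_char_0) set"
  assumes "finite \<Lambda>"
  shows "\<exists>\<pi> :: 'v \<Rightarrow> ('v, 'k) mpoly. (\<forall>v. Var v - \<pi> v \<in> ideal_generated (linear_form ` \<Lambda>)) \<and>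
    (\<forall>x. (\<lambda>v. poly_eval (\<pi> v) x) \<in> {x. \<forall>a\<in>\<Lambda>. dot a x = 0})"
  using assms
proof (induction \<Lambda> rule: finite_induct)
  case empty
  show ?case by (intro exI[of _ Var]) (simp add: ideal_span_zero)
next
  case (insert b \<Lambda>)
  let ?I = "ideal_generated (linear_form ` \<Lambda>)" and ?J = "ideal_generated (linear_form ` insert b \<Lambda>)"
  have sub: "?I \<subseteq> ?J" by (rule ideal_span_mono) auto
  have J: "is_ideal ?J" by (rule ideal_subspace_span)
  obtain \<pi> where \<pi>: "\<And>v. Var v - \<pi> v \<in> ?I" and \<pi>0: "\<And>x a. a \<in> \<Lambda> \<Longrightarrow> dot a (\<lambda>v. poly_eval (\<pi> v) x) = 0"
    using insert.IH by auto
  define \<mu> where "\<mu> = subst.ev \<pi> (linear_form b)"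
  have \<mu>: "poly_eval \<mu> x = dot b (\<lambda>v. poly_eval (\<pi> v) x)" for x
    by (simp add: \<mu>_def eval_subst)
  show ?case
  proof (cases "\<mu> = 0")
    case True
    then have "dot b (\<lambda>v. poly_eval (\<pi> v) x) = 0" for x using \<mu>[of x] by simp
    then show ?thesis using \<pi> \<pi>0 sub by (intro exI[of _ \<pi>]) auto
  next
    case False
    then obtain e where e: "poly_eval \<mu> e \<noteq> 0" using eval_faithful by blast
    define w where "w v = poly_eval (\<pi> v) e / poly_eval \<mu> e" for v
    have bw: "dot b w = 1"
    proof -
      have "dot b w = dot b (\<lambda>v. poly_eval (\<pi> v) e) / poly_eval \<mu> e"
        by (simp add: dot_def w_def sum_divide_distrib)
      then show ?thesis using e by (simp add: \<mu>)
    qed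
    have aw: "dot a w = 0" if "a \<in> \<Lambda>" for a
    proof -
      have "dot a w = dot a (\<lambda>v. poly_eval (\<pi> v) e) / poly_eval \<mu> e"
        by (simp add: dot_def w_def sum_divide_distrib)
      then show ?thesis using \<pi>0[OF that] by simp
    qed
    define \<pi>' where "\<pi>' v = \<pi> v - Const (w v) * \<mu>" for v
    have ev: "(\<lambda>v. poly_eval (\<pi>' v) x) = (\<lambda>v. 1 * poly_eval (\<pi> v) x + (- poly_eval \<mu> x) * w v)" for x
      by (rule ext) (simp add: \<pi>'_def)
    have dots: "dot a (\<lambda>v. poly_eval (\<pi>' v) x) = dot a (\<lambda>v. poly_eval (\<pi> v) x) - poly_eval \<mu> x * dot a w" for a x
      unfolding ev dot_linear_right by simp
    have z: "dot a (\<lambda>v. poly_eval (\<pi>' v) x) = 0" if "a \<in> insert b \<Lambda>" for a x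
      using that by (auto simp: dots aw bw \<pi>0 \<mu>)
    have lb: "linear_form b \<in> ?J" by (rule ideal_span_base) simp
    have "linear_form b - \<mu> \<in> ?J"
      unfolding \<mu>_def by (rule diff_subst_in_ideal[OF J]) (use \<pi> sub in blast)
    then have "linear_form b - (linear_form b - \<mu>) \<in> ?J" by (rule ideal_span_diff[OF lb])
    then have "\<mu> \<in> ?J" by simp
    then have "(Var v - \<pi> v) + Const (w v) * \<mu> \<in> ?J" for v
      using \<pi>[of v] sub by (intro ideal_span_add ideal_span_scale) auto
    then have "Var v - \<pi>' v \<in> ?J" for v by (simp add: \<pi>'_def algebra_simps)
    then show ?thesis using z by (intro exI[of _ \<pi>']) auto
  qed
qed

text \<open>Composed with the projection, a polynomial vanishing on the subspace has value zero
  everywhere, so it is zero; but the composition changes it only modulo the equations.\<close>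

lemma van_zeros_iff:
  fixes \<Lambda> :: "('v::finite \<Rightarrow> 'k::field_char_0) set"
  assumes "finite \<Lambda>"
  shows "van {x. \<forall>a\<in>\<Lambda>. dot a x = 0} p \<longleftrightarrow> p \<in> ideal_generated (linear_form ` \<Lambda>)"
proof
  assume p: "van {x. \<forall>a\<in>\<Lambda>. dot a x = 0} p"
  obtain \<pi> where \<pi>: "\<And>v. Var v - \<pi> v \<in> ideal_generated (linear_form ` \<Lambda>)"
    "\<And>x. (\<lambda>v. poly_eval (\<pi> v) x) \<in> {x. \<forall>a\<in>\<Lambda>. dot a x = 0}"
    using zeros_projection[OF assms] by blast
  have "poly_eval (subst.ev \<pi> p) x = 0" for x using p \<pi>(2)[of x] by (simp only: eval_subst van_def)
  then have "subst.ev \<pi> p = 0" by (rule eval_faithful)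
  then show "p \<in> ideal_generated (linear_form ` \<Lambda>)"
    using diff_subst_in_ideal[OF ideal_subspace_span \<pi>(1), of p] by simp
next
  assume "p \<in> ideal_generated (linear_form ` \<Lambda>)"
  then show "van {x. \<forall>a\<in>\<Lambda>. dot a x = 0} p"
  proof (induction p rule: ideal_span_induct_alt[consumes 1, case_names base step])
    case base
    show ?case by simp
  next
    case (step c x y)
    then have "van {x. \<forall>a\<in>\<Lambda>. dot a x = 0} x" by (auto simp: van_def)
    then show ?case using step by (intro van_add van_mult_left)
  qed
qed

lemma flat_div:
  fixes p :: "('v::finite, 'k::field_char_0) mpoly"
  assumes "flat W" "van (W \<inter> hyperplane a) p"
  shows "\<exists>u. van W (p - linear_form a * u)"
proof -
  obtain \<Lambda> where \<Lambda>: "finite \<Lambda>" "W = {x. \<forall>a\<in>\<Lambda>. dot a x = 0}" using assms(1) by (auto simp: flat_def)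
  have "W \<inter> hyperplane a = {x. \<forall>a\<in>insert a \<Lambda>. dot a x = 0}" by (auto simp: \<Lambda> hyperplane_iff)
  with assms(2) have "p \<in> ideal_generated (linear_form ` insert a \<Lambda>)"
    using van_zeros_iff[of "insert a \<Lambda>" p] \<Lambda>(1) by simp
  then obtain k where "p - k * linear_form a \<in> ideal_generated (linear_form ` \<Lambda>)"
    by (auto simp: ideal_span_breakdown_eq)
  then have "van W (p - k * linear_form a)" unfolding \<Lambda>(2) van_zeros_iff[OF \<Lambda>(1)] .
  then show ?thesis by (metis mult.commute)
qed

text \<open>The forms are divided out one at a time. No trace on \<open>W\<close> lies in another of
  the hyperplanes, so the product divided out so far does not vanish on the next trace, and
  primality passes the vanishing on to the quotient.\<close>

lemma flat_div_prod:
  fixes p :: "('v::finite, 'k::field_char_0) mpoly"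
  assumes W: "flat W" and "finite T" and "\<And>H. H \<in> T \<Longrightarrow> van (W \<inter> hyperplane (c H)) p"
    and "\<And>H H'. H \<in> T \<Longrightarrow> H' \<in> T \<Longrightarrow> H \<noteq> H' \<Longrightarrow> \<not> W \<inter> hyperplane (c H) \<subseteq> hyperplane (c H')"
  shows "\<exists>u. van W (p - (\<Prod>H\<in>T. linear_form (c H)) * u)"
  using assms(2-)
proof (induction T rule: finite_induct)
  case empty
  show ?case by (intro exI[of _ p]) simp
next
  case (insert H T)
  let ?P = "\<Prod>H\<in>T. linear_form (c H)"
  from insert obtain u where u: "van W (p - ?P * u)" by auto
  let ?W = "W \<inter> hyperplane (c H)"
  have "van ?W p" using insert.prems(1) by simp
  moreover have "van ?W (p - ?P * u)" by (rule van_mono[OF u]) simp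
  ultimately have "van ?W (p - (p - ?P * u))" by (rule van_diff)
  then have "van ?W (?P * u)" by (simp only: diff_diff_eq2 add_diff_cancel_left')
  moreover have "\<not> van ?W ?P"
    using insert by (intro flat_prime_prod flat_Int_hyperplane W) (auto simp: van_linear_form_iff)
  ultimately have "van ?W u" using flat_prime[OF flat_Int_hyperplane[OF W]] by blast
  then obtain u' where u': "van W (u - linear_form (c H) * u')" using flat_div[OF W] by blast
  have "van W ((p - ?P * u) + ?P * (u - linear_form (c H) * u'))"
    by (intro van_add van_mult_left u u')
  also have "(p - ?P * u) + ?P * (u - linear_form (c H) * u') = p - (\<Prod>H\<in>insert H T. linear_form (c H)) * u'"
    using insert.hyps by (simp add: right_diff_distrib ac_simps)
  finally show ?case by blast
qed

section \<open>The residual ideal in terms of pencils\<close>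

lemma Const_eq_0_iff [simp]: "(Const c :: ('v::finite, 'k::field) mpoly) = 0 \<longleftrightarrow> c = 0"
  unfolding Const_def by (metis lookup_single_eq lookup_zero single_zero)

text \<open>The groups \<open>G i\<close> with \<open>i < m\<close> are the pencils of hyperplanes through a multiple flat, those with
  \<open>m \<le> i < k\<close> are single hyperplanes. For the latter \<open>y i = 0\<close>, so that \<open>z i = 1\<close> and
  \<open>Y i = 0\<close> below and both kinds can be treated alike.\<close>

locale pencil_partition =
  fixes A :: "'h set" and l :: "'h \<Rightarrow> 'v::finite \<Rightarrow> 'k::field_char_0"
    and G :: "nat \<Rightarrow> 'h set" and B :: "nat \<Rightarrow> 'h" and y :: "nat \<Rightarrow> 'v \<Rightarrow> 'k"
    and m k :: nat and pt :: "'v \<Rightarrow> 'k"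
  assumes finite_A: "finite A" and m_le_k: "m \<le> k" and k_pos: "0 < k"
    and A_eq: "A = (\<Union>i<k. G i)"
    and G_disj: "\<And>i j. i < k \<Longrightarrow> j < k \<Longrightarrow> i \<noteq> j \<Longrightarrow> G i \<inter> G j = {}"
    and B_in: "\<And>i. i < k \<Longrightarrow> B i \<in> G i"
    and l_pt: "\<And>H. H \<in> A \<Longrightarrow> dot (l H) pt = 1"
    and l_dist: "\<And>H H'. H \<in> A \<Longrightarrow> H' \<in> A \<Longrightarrow> H \<noteq> H' \<Longrightarrow> \<not> hyperplane (l H) \<subseteq> hyperplane (l H')"
    and G_card: "\<And>i. i < m \<Longrightarrow> 3 \<le> card (G i)"
    and G_single: "\<And>i. m \<le> i \<Longrightarrow> i < k \<Longrightarrow> G i = {B i}"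
    and y_single: "\<And>i. m \<le> i \<Longrightarrow> i < k \<Longrightarrow> y i = (\<lambda>_. 0)"
    and y_nonzero: "\<And>i. i < m \<Longrightarrow> y i \<noteq> (\<lambda>_. 0)"
    and y_pt: "\<And>i. i < m \<Longrightarrow> dot (y i) pt = 0"
    and pencil: "\<And>i H. i < m \<Longrightarrow> H \<in> G i \<Longrightarrow> \<exists>c. \<forall>v. l H v = l (B i) v + c * y i v"
    and triple: "\<And>H H' H''. H \<in> A \<Longrightarrow> H' \<in> A \<Longrightarrow> H'' \<in> A \<Longrightarrow> H \<noteq> H' \<Longrightarrow> H \<noteq> H'' \<Longrightarrow> H' \<noteq> H'' \<Longrightarrow>
      hyperplane (l H) \<inter> hyperplane (l H') \<subseteq> hyperplane (l H'') \<Longrightarrow>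
      \<exists>i<m. H \<in> G i \<and> H' \<in> G i \<and> H'' \<in> G i"
begin

abbreviation "Hp H \<equiv> hyperplane (l H)"
abbreviation "Yp i \<equiv> hyperplane (y i)"
definition L :: "'h \<Rightarrow> ('v, 'k) mpoly" where "L H = linear_form (l H)"
definition Y :: "nat \<Rightarrow> ('v, 'k) mpoly" where "Y i = linear_form (y i)"
definition F :: "nat \<Rightarrow> ('v, 'k) mpoly" where "F i = (\<Prod>H\<in>A - G i. L H)"
definition z :: "nat \<Rightarrow> ('v, 'k) mpoly" where "z i = (\<Prod>H\<in>G i - {B i}. L H)"
definition f :: "('v, 'k) mpoly" where "f = (\<Prod>H\<in>A. L H)"

lemma G_sub: "i < k \<Longrightarrow> G i \<subseteq> A" by (auto simp: A_eq)
lemma finite_G: "i < k \<Longrightarrow> finite (G i)" using G_sub finite_A finite_subset by blast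
lemma B_A: "i < k \<Longrightarrow> B i \<in> A" using G_sub B_in by blast

lemma same_group: "i < k \<Longrightarrow> j < k \<Longrightarrow> H \<in> G i \<Longrightarrow> H \<in> G j \<Longrightarrow> i = j"
  using G_disj by blast

lemma van_L_iff: "van W (L H) \<longleftrightarrow> W \<subseteq> Hp H" by (simp add: L_def van_linear_form_iff)
lemma van_Y_iff: "van W (Y i) \<longleftrightarrow> W \<subseteq> Yp i" by (simp add: Y_def van_linear_form_iff)

lemma L_eval: "poly_eval (L H) x = dot (l H) x" by (simp add: L_def)
lemma Y_eval: "poly_eval (Y i) x = dot (y i) x" by (simp add: Y_def)

lemma Y_single: "m \<le> i \<Longrightarrow> i < k \<Longrightarrow> Y i = 0"
  by (rule eval_eqI) (simp add: Y_eval y_single)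

lemma z_single: "m \<le> i \<Longrightarrow> i < k \<Longrightarrow> z i = 1"
  by (simp add: z_def G_single)

lemma group_prod: "i < k \<Longrightarrow> (\<Prod>H\<in>G i. L H) = L (B i) * z i"
  unfolding z_def using prod.remove[OF finite_G B_in] by blast

lemma f_eq: "i < k \<Longrightarrow> f = F i * (L (B i) * z i)"
  unfolding f_def F_def group_prod[symmetric]
  by (rule prod.subset_diff) (simp_all add: G_sub finite_A)

lemma van_F: "H \<in> A \<Longrightarrow> H \<notin> G i \<Longrightarrow> van (Hp H) (F i)"
  using finite_A by (auto simp: van_def F_def hyperplane_iff L_eval intro!: prod_zero)

lemma van_f: "H \<in> A \<Longrightarrow> van (Hp H) f"
  using finite_A by (auto simp: van_def f_def hyperplane_iff L_eval intro!: prod_zero)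

lemma F_not_van:
  assumes "flat W" "\<And>H'. H' \<in> A \<Longrightarrow> H' \<notin> G i \<Longrightarrow> \<not> W \<subseteq> Hp H'"
  shows "\<not> van W (F i)"
  unfolding F_def by (intro flat_prime_prod assms) (use assms in \<open>auto simp: van_L_iff\<close>)

lemma z_not_van:
  assumes "flat W" "\<And>H'. H' \<in> G i \<Longrightarrow> H' \<noteq> B i \<Longrightarrow> \<not> W \<subseteq> Hp H'"
  shows "\<not> van W (z i)"
  unfolding z_def by (intro flat_prime_prod assms) (use assms in \<open>auto simp: van_L_iff\<close>)

text \<open>Every vector is a vector of \<open>Hp H\<close> plus a multiple of \<open>pt\<close>,
  where \<open>y i\<close> vanishes; were \<open>y i\<close> zero on \<open>Hp H\<close> as well, it
  would be zero.\<close>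

lemma Hp_not_sub_Yp:
  assumes "i < m" "H \<in> G i"
  shows "\<not> Hp H \<subseteq> Yp i"
proof
  assume sub: "Hp H \<subseteq> Yp i"
  have H: "H \<in> A" using assms G_sub[of i] m_le_k by auto
  have "dot (y i) x = 0" for x
  proof -
    let ?x = "\<lambda>v. 1 * x v + (- dot (l H) x) * pt v"
    have "dot (l H) ?x = 0" unfolding dot_linear_right using l_pt[OF H] by simp
    then have "dot (y i) ?x = 0" using sub by (auto simp: hyperplane_iff)
    then show ?thesis unfolding dot_linear_right using y_pt[OF assms(1)] by simp
  qed
  then have "y i v = 0" for v using dot_unit(1)[of "y i" v] by metis
  then show False using y_nonzero[OF assms(1)] by blast
qed

lemma pencil_eq:
  assumes "i < m" "H \<in> G i"
  obtains c where "\<And>x. dot (l H) x = dot (l (B i)) x + c * dot (y i) x"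
proof -
  obtain c where c: "\<And>v. l H v = l (B i) v + c * y i v" using pencil[OF assms] by blast
  have "l H = (\<lambda>v. 1 * l (B i) v + c * y i v)" using c by auto
  then have "dot (l H) x = dot (l (B i)) x + c * dot (y i) x" for x
    using dot_linear_left[of 1 "l (B i)" c "y i" x] by simp
  then show ?thesis using that by blast
qed

text \<open>A second member \<open>K\<close> of the pencil has a form differing from that of
  \<open>H\<close> by a nonzero multiple of \<open>y i\<close>, so \<open>Hp H \<inter> Hp K\<close>
  lies in \<open>Yp i\<close>. A hyperplane through \<open>Yp i \<inter> Hp H\<close> then contains
  \<open>Hp H \<inter> Hp K\<close>, and \<open>triple\<close> places it in the same group.\<close>

lemma Yp_Hp_not_sub:
  assumes i: "i < m" and H: "H \<in> G i" and H': "H' \<in> A" "H' \<notin> G i"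
  shows "\<not> Yp i \<inter> Hp H \<subseteq> Hp H'"
proof
  assume sub: "Yp i \<inter> Hp H \<subseteq> Hp H'"
  have ik: "i < k" using i m_le_k by simp
  have "\<not> G i \<subseteq> {H}"
  proof
    assume "G i \<subseteq> {H}"
    then have "card (G i) \<le> card {H}" by (intro card_mono) auto
    then show False using G_card[OF i] by simp
  qed
  then obtain K where K: "K \<in> G i" "K \<noteq> H" by blast
  obtain c where c: "\<And>x. dot (l H) x = dot (l (B i)) x + c * dot (y i) x"
    using pencil_eq[OF i H] by blast
  obtain d where d: "\<And>x. dot (l K) x = dot (l (B i)) x + d * dot (y i) x"
    using pencil_eq[OF i K(1)] by blast
  have KA: "K \<in> A" "H \<in> A" using K H G_sub[OF ik] by auto
  have "c \<noteq> d"
    using l_dist[OF KA] K(2) c d by (auto simp: hyperplane_iff)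
  then have "Hp H \<inter> Hp K \<subseteq> Yp i"
    by (auto simp: hyperplane_iff c d add_eq_0_iff)
      (metis (no_types, opaque_lifting) c d diff_self eq_iff_diff_eq_0 left_diff_distrib mult_eq_0_iff add_diff_cancel_left)
  then have "Hp H \<inter> Hp K \<subseteq> Hp H'" using sub by blast
  moreover have "H \<noteq> H'" "K \<noteq> H'" using H H' K by auto
  ultimately obtain j where "j < m" "H \<in> G j" "H' \<in> G j"
    using triple[of H K H'] KA H' K by blast
  then have "j = i" using same_group[of j i H] ik m_le_k H by simp
  then show False using \<open>H' \<in> G j\<close> H' by simp
qed

lemma Hp_Hp_not_sub:
  assumes "i < k" "H \<in> G i" "H' \<in> A" "H'' \<in> A" "H \<noteq> H'" "H \<noteq> H''" "H' \<noteq> H''"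
    and "H' \<notin> G i \<or> H'' \<notin> G i"
  shows "\<not> Hp H \<inter> Hp H' \<subseteq> Hp H''"
proof
  assume "Hp H \<inter> Hp H' \<subseteq> Hp H''"
  then obtain j where j: "j < m" "H \<in> G j" "H' \<in> G j" "H'' \<in> G j"
    using triple[of H H' H''] assms G_sub by blast
  then have "j = i" using same_group[of j i H] m_le_k assms by simp
  then show False using j assms by simp
qed

definition interp :: "('v, 'k) mpoly \<Rightarrow> bool" where
  "interp h \<longleftrightarrow> (\<forall>v. \<exists>\<beta>. \<forall>H\<in>A. van (Hp H) (\<beta> - h * Const (l H v)))"

definition comb :: "(nat \<Rightarrow> ('v, 'k) mpoly) \<Rightarrow> (nat \<Rightarrow> ('v, 'k) mpoly) \<Rightarrow> ('v, 'k) mpoly" where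
  "comb \<alpha> \<beta> = (\<Sum>i<k. F i * (\<alpha> i * z i + \<beta> i * Y i))"

definition R :: "('v, 'k) mpoly set" where "R = {comb \<alpha> \<beta> | \<alpha> \<beta>. True}"

lemma comb_add: "comb \<alpha> \<beta> + comb \<alpha>' \<beta>' = comb (\<lambda>i. \<alpha> i + \<alpha>' i) (\<lambda>i. \<beta> i + \<beta>' i)"
  unfolding comb_def sum.distrib[symmetric] by (intro sum.cong refl) (simp add: algebra_simps)

lemma comb_mult: "p * comb \<alpha> \<beta> = comb (\<lambda>i. p * \<alpha> i) (\<lambda>i. p * \<beta> i)"
  unfolding comb_def sum_distrib_left by (intro sum.cong refl) (simp add: algebra_simps)

lemma R_ideal: "is_ideal R"
proof (rule Modules.module.subspaceI[OF module_mult])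
  have "comb (\<lambda>_. 0) (\<lambda>_. 0) = 0" by (simp add: comb_def)
  then show "0 \<in> R" unfolding R_def by (metis (mono_tags, lifting) mem_Collect_eq)
qed (auto simp: R_def comb_add comb_mult, blast+)

lemma comb_in_R: "comb \<alpha> \<beta> \<in> R" by (auto simp: R_def)

lemma z_gen_in_R: assumes "i < k" shows "F i * z i \<in> R"
proof -
  have "comb (\<lambda>j. if j = i then 1 else 0) (\<lambda>_. 0) = (\<Sum>j<k. if j = i then F i * z i else 0)"
    unfolding comb_def by (intro sum.cong) auto
  also have "\<dots> = F i * z i" using assms by simp
  finally show ?thesis using comb_in_R by metis
qed

lemma Y_gen_in_R: assumes "i < k" shows "F i * Y i \<in> R"
proof -
  have "comb (\<lambda>_. 0) (\<lambda>j. if j = i then 1 else 0) = (\<Sum>j<k. if j = i then F i * Y i else 0)"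
    unfolding comb_def by (intro sum.cong) auto
  also have "\<dots> = F i * Y i" using assms by simp
  finally show ?thesis using comb_in_R by metis
qed

lemma f_in_R: "f \<in> R"
proof -
  have "f = L (B 0) * (F 0 * z 0)" by (simp only: f_eq[OF k_pos] ac_simps)
  then show ?thesis using ideal_subspace_scale[OF R_ideal z_gen_in_R[OF k_pos]] by metis
qed

subsection \<open>Syzygies\<close>

text \<open>On a hyperplane of group \<open>i\<close> only the \<open>i\<close>-th summand of a
  relation survives, since the other \<open>F j\<close> vanish there and \<open>F i\<close> does
  not. So \<open>\<alpha> i * z i + \<beta> i * Y i\<close> is divisible by the product of the
  group, with quotient \<open>\<gamma> i\<close>; on members other than \<open>B i\<close>, where
  \<open>z i\<close> vanishes too, it follows that \<open>\<beta> i\<close> is a multiple of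
  \<open>z i\<close>. The flat \<open>W\<close> is a parameter because regularity of linear forms
  needs the same statement on linear sections.\<close>

lemma syzygies:
  assumes W: "flat W" 
    and dist: "\<And>H H'. H \<in> A \<Longrightarrow> H' \<in> A \<Longrightarrow> H \<noteq> H' \<Longrightarrow> \<not> W \<inter> Hp H \<subseteq> Hp H'"
    and ynot: "\<And>i H. i < m \<Longrightarrow> H \<in> G i \<Longrightarrow> \<not> W \<inter> Hp H \<subseteq> Yp i"
    and not_sub: "\<And>H. H \<in> A \<Longrightarrow> \<not> W \<subseteq> Hp H"
    and van: "van W (comb \<alpha> \<beta>)"
  shows "\<exists>\<gamma> \<delta>. (\<forall>i<k. van W (\<alpha> i - (\<gamma> i * L (B i) - \<delta> i * Y i)) \<and> van W (\<beta> i - \<delta> i * z i)) \<and>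
    van W (\<Sum>i<k. \<gamma> i)"
proof -
  have z_W: "\<not> van W (z i)" if "i < k" for i
    using z_not_van[OF W] not_sub G_sub[OF that] by blast
  have flatH: "flat (W \<inter> Hp H)" for H using W by (rule flat_Int_hyperplane)
  have "\<exists>c d. van W (\<alpha> i * z i + \<beta> i * Y i - c * (L (B i) * z i)) \<and>
      van W (\<alpha> i - (c * L (B i) - d * Y i)) \<and> van W (\<beta> i - d * z i)" if i: "i < k" for i
  proof -
    let ?h = "\<lambda>i. \<alpha> i * z i + \<beta> i * Y i"
    have hH: "van (W \<inter> Hp H) (?h i)" if H: "H \<in> G i" for H
    proof -
      have "van (W \<inter> Hp H) (F j * ?h j)" if "j < k" "j \<noteq> i" for j
        by (rule van_mult_right, rule van_mono[OF van_F[of H j]])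
          (use H that i same_group G_sub in blast)+
      then have "van (W \<inter> Hp H) (\<Sum>j\<in>{..<k} - {i}. F j * ?h j)"
        by (intro van_sum) auto
      moreover have "comb \<alpha> \<beta> = F i * ?h i + (\<Sum>j\<in>{..<k} - {i}. F j * ?h j)"
        unfolding comb_def using i by (intro sum.remove) auto
      moreover have "van (W \<inter> Hp H) (comb \<alpha> \<beta>)" by (rule van_mono[OF van]) simp
      ultimately have "van (W \<inter> Hp H) (F i * ?h i)"
        using van_diff[of "W \<inter> Hp H" "comb \<alpha> \<beta>" "\<Sum>j\<in>{..<k} - {i}. F j * ?h j"]
        by (simp only: add_diff_cancel_right')
      moreover have "\<not> van (W \<inter> Hp H) (F i)"
        using H G_sub[OF i] dist by (intro F_not_van flatH) blast
      ultimately show ?thesis using flat_prime[OF flatH] by blast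
    qed
    have "\<exists>u. van W (?h i - (\<Prod>H\<in>G i. linear_form (l H)) * u)"
      using W finite_G[OF i] hH dist[OF subsetD[OF G_sub[OF i]] subsetD[OF G_sub[OF i]]]
      by (rule flat_div_prod)
    then obtain c where c: "van W (?h i - c * (L (B i) * z i))"
      using group_prod[OF i] by (auto simp: L_def mult.commute)
    show ?thesis
    proof (cases "i < m")
      case True
      have b: "van (W \<inter> Hp H) (\<beta> i)" if H: "H \<in> G i" "H \<noteq> B i" for H
      proof -
        have zH: "van (W \<inter> Hp H) (z i)"
          using H finite_G[OF i] by (auto simp: van_def z_def hyperplane_iff L_eval intro!: prod_zero)
        have "van (W \<inter> Hp H) (?h i - \<alpha> i * z i)"
          by (intro van_diff hH H van_mult_left zH)
        then have "van (W \<inter> Hp H) (Y i * \<beta> i)" by (simp add: mult.commute)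
        moreover have "\<not> van (W \<inter> Hp H) (Y i)" using ynot[OF True H(1)] by (simp add: van_Y_iff)
        ultimately show ?thesis using flat_prime[OF flatH] by blast
      qed
      have "\<exists>u. van W (\<beta> i - (\<Prod>H\<in>G i - {B i}. linear_form (l H)) * u)"
        by (rule flat_div_prod[OF W]) (use finite_G[OF i] b dist G_sub[OF i] in blast)+
      then obtain d where d: "van W (\<beta> i - d * z i)" by (auto simp: z_def L_def mult.commute)
      have "van W ((?h i - c * (L (B i) * z i)) - Y i * (\<beta> i - d * z i))"
        by (intro van_diff c van_mult_left d)
      also have "(?h i - c * (L (B i) * z i)) - Y i * (\<beta> i - d * z i)
          = z i * (\<alpha> i - (c * L (B i) - d * Y i))"
        by (simp add: algebra_simps)
      finally have "van W (\<alpha> i - (c * L (B i) - d * Y i))"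
        using flat_prime[OF W _ z_W[OF i]] by blast
      then show ?thesis using c d by blast
    next
      case False
      \<comment> \<open>For a single hyperplane \<open>z i = 1\<close> and \<open>Y i = 0\<close>,
        so \<open>\<beta> i\<close> itself serves as \<open>\<delta> i\<close>.\<close>
      then show ?thesis using c i Y_single[of i] z_single[of i]
        by (intro exI[of _ c] exI[of _ "\<beta> i"]) simp
    qed
  qed
  then obtain \<gamma> \<delta> where gd: "\<And>i. i < k \<Longrightarrow> van W (\<alpha> i * z i + \<beta> i * Y i - \<gamma> i * (L (B i) * z i)) \<and>
      van W (\<alpha> i - (\<gamma> i * L (B i) - \<delta> i * Y i)) \<and> van W (\<beta> i - \<delta> i * z i)" by metis
  \<comment> \<open>Replacing each bracket by \<open>\<gamma> i * (L (B i) * z i)\<close> turns the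
    relation into \<open>f\<close> times the sum of the \<open>\<gamma> i\<close>, and
    \<open>f\<close> does not vanish on \<open>W\<close>.\<close>
  have "van W (comb \<alpha> \<beta> - (\<Sum>i<k. F i * (\<alpha> i * z i + \<beta> i * Y i - \<gamma> i * (L (B i) * z i))))"
    by (rule van_diff[OF van van_sum[OF van_mult_left]]) (use gd in simp)
  also have "comb \<alpha> \<beta> - (\<Sum>i<k. F i * (\<alpha> i * z i + \<beta> i * Y i - \<gamma> i * (L (B i) * z i)))
      = (\<Sum>i<k. \<gamma> i * (F i * (L (B i) * z i)))"
    unfolding comb_def sum_subtractf[symmetric] by (intro sum.cong refl) (simp add: algebra_simps)
  also have "\<dots> = f * (\<Sum>i<k. \<gamma> i)"
    unfolding sum_distrib_left by (intro sum.cong refl) (simp add: f_eq[symmetric] mult.commute)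
  finally have "van W (\<Sum>i<k. \<gamma> i)"
    using flat_prime[OF W] flat_prime_prod[OF W, of A L] not_sub by (auto simp: f_def van_L_iff)
  then show ?thesis using gd by blast
qed

subsection \<open>The residual as an interpolation problem\<close>

lemma van_eq: "van W (p - q) \<longleftrightarrow> (\<forall>x\<in>W. poly_eval p x = poly_eval q x)"
  by (simp add: van_def)

text \<open>Up to the constant \<open>C\<close>, the derivative in direction \<open>v\<close> is the
  sum of \<open>l H v * Q H\<close>, where \<open>Q H\<close> omits the form of \<open>H\<close>; in
  direction \<open>pt\<close> it is the sum of the \<open>Q H\<close>. Since only \<open>Q H\<close>
  is nonzero on \<open>H\<close>, the coefficient \<open>b\<close> of the second derivative in a
  membership relation is exactly the interpolating polynomial.\<close>

lemma residual_iff: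
  assumes C: "C \<noteq> 0"
  shows "h \<in> residual (Const C * f) pt \<longleftrightarrow> interp h"
proof -
  define Q where "Q H = prod L (A - {H})" for H
  have fQ: "H \<in> A \<Longrightarrow> f = L H * Q H" for H
    unfolding f_def Q_def using finite_A by (rule prod.remove)
  have Q_other: "van (Hp H) (Q H')" if "H \<in> A" "H \<noteq> H'" for H H'
    using that finite_A by (auto simp: van_def Q_def hyperplane_iff L_eval intro!: prod_zero)
  have Q_not: "\<not> van (Hp H) (Q H)" if "H \<in> A" for H
    unfolding Q_def using that l_dist
    by (intro flat_prime_prod flat_hyperplane) (auto simp: van_L_iff)
  let ?f = "Const C * f"
  have pd: "partial_deriv v ?f = Const C * (\<Sum>H\<in>A. Const (l H v) * Q H)" for v
    unfolding partial_deriv_mult f_def partial_deriv_prod[OF finite_A]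
    by (simp add: Q_def L_def partial_deriv_linear_form)
  have "directional_deriv pt ?f = (\<Sum>v\<in>UNIV. \<Sum>H\<in>A. Const C * (Const (pt v * l H v) * Q H))"
    unfolding directional_deriv_def pd sum_distrib_left
    by (intro sum.cong refl) (simp add: Const_mult ac_simps)
  also have "\<dots> = (\<Sum>H\<in>A. \<Sum>v\<in>UNIV. Const C * (Const (pt v * l H v) * Q H))"
    by (rule sum.swap)
  also have "\<dots> = (\<Sum>H\<in>A. Const C * Q H)"
  proof (intro sum.cong refl)
    fix H assume H: "H \<in> A"
    have "(\<Sum>v\<in>UNIV. Const (pt v * l H v)) = (1 :: ('v, 'k) mpoly)"
      by (rule eval_eqI) (use l_pt[OF H] in \<open>simp add: dot_def mult.commute\<close>)
    then show "(\<Sum>v\<in>UNIV. Const C * (Const (pt v * l H v) * Q H)) = Const C * Q H"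
      by (simp flip: sum_distrib_left sum_distrib_right)
  qed
  finally have dd: "directional_deriv pt ?f = Const C * (\<Sum>H\<in>A. Q H)" by (simp add: sum_distrib_left)
  let ?I = "ideal_generated {?f, directional_deriv pt ?f}"
  have I: "x \<in> ?I \<longleftrightarrow> (\<exists>a b. x = a * ?f + b * directional_deriv pt ?f)" for x
    by (auto simp: ideal_span_breakdown_eq Modules.module.span_empty[OF module_mult] algebra_simps)
  have "h \<in> residual ?f pt \<longleftrightarrow> (\<forall>v. h * partial_deriv v ?f \<in> ?I)"
  proof
    assume "h \<in> residual ?f pt"
    then show "\<forall>v. h * partial_deriv v ?f \<in> ?I"
      unfolding residual_def ideal_quotient_def jacobian_ideal_def by (auto intro: ideal_span_base)
  next
    assume *: "\<forall>v. h * partial_deriv v ?f \<in> ?I"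
    have "h * g \<in> ?I" if "g \<in> jacobian_ideal ?f" for g
      using that unfolding jacobian_ideal_def
    proof (induction g rule: ideal_span_induct_alt[consumes 1, case_names base step])
      case base
      show ?case by (simp add: ideal_span_zero)
    next
      case (step c x y)
      then have "h * x \<in> ?I" "h * y \<in> ?I" using * by auto
      then have "c * (h * x) + h * y \<in> ?I" by (simp only: ideal_span_add ideal_span_scale)
      then show ?case by (simp add: algebra_simps)
    qed
    then show "h \<in> residual ?f pt" by (simp add: residual_def ideal_quotient_def)
  qed
  also have "\<dots> \<longleftrightarrow> interp h"
  proof
    assume *: "\<forall>v. h * partial_deriv v ?f \<in> ?I"
    show "interp h" unfolding interp_def
    proof
      fix v
      obtain a b where ab: "h * partial_deriv v ?f = a * ?f + b * directional_deriv pt ?f"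
        using * I by blast
      have "Const C * (\<Sum>H\<in>A. (h * Const (l H v) - b) * Q H) = Const C * (a * f)"
        using ab unfolding pd dd by (simp add: algebra_simps sum_subtractf sum_distrib_left)
      then have "Const C * ((\<Sum>H\<in>A. (h * Const (l H v) - b) * Q H) - a * f) = 0"
        by (simp add: right_diff_distrib)
      moreover have "(Const C :: ('v, 'k) mpoly) \<noteq> 0"
        using C by simp
      ultimately have eq: "(\<Sum>H\<in>A. (h * Const (l H v) - b) * Q H) = a * f"
        using mpoly_no_zero_divisors by fastforce
      have "van (Hp H) (b - h * Const (l H v))" if H: "H \<in> A" for H
      proof -
        have "(\<Sum>H\<in>A. (h * Const (l H v) - b) * Q H) = (h * Const (l H v) - b) * Q H
            + (\<Sum>H'\<in>A - {H}. (h * Const (l H' v) - b) * Q H')"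
          using finite_A H by (rule sum.remove)
        then have "(h * Const (l H v) - b) * Q H = a * f - (\<Sum>H'\<in>A - {H}. (h * Const (l H' v) - b) * Q H')"
          unfolding eq by (simp add: algebra_simps)
        moreover have "van (Hp H) \<dots>"
          by (intro van_diff van_mult_left van_f H van_sum Q_other) auto
        ultimately have "van (Hp H) (Q H * (h * Const (l H v) - b))" by (simp only: mult.commute)
        then have "van (Hp H) (h * Const (l H v) - b)"
          using flat_prime[OF flat_hyperplane _ Q_not[OF H]] by blast
        then show ?thesis by (simp add: van_eq)
      qed
      then show "\<exists>\<beta>. \<forall>H\<in>A. van (Hp H) (\<beta> - h * Const (l H v))" by blast
    qed
  next
    assume "interp h"
    show "\<forall>v. h * partial_deriv v ?f \<in> ?I"
    proof
      fix v
      obtain b where b: "\<And>H. H \<in> A \<Longrightarrow> van (UNIV \<inter> Hp H) (b - h * Const (l H v))"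
        using \<open>interp h\<close> unfolding interp_def Int_UNIV_left by blast
      have "\<exists>u. b - h * Const (l H v) = L H * u" if "H \<in> A" for H
        using flat_div[OF flat_UNIV b[OF that]] by (simp add: L_def)
      then obtain u where u: "\<And>H. H \<in> A \<Longrightarrow> b - h * Const (l H v) = L H * u H" by metis
      \<comment> \<open>The quotients \<open>u H\<close> of \<open>b - h * Const (l H v)\<close> by
        the forms add up, with opposite sign, to the coefficient of \<open>?f\<close>.\<close>
      have "h * partial_deriv v ?f - b * directional_deriv pt ?f
          = Const C * (\<Sum>H\<in>A. (h * Const (l H v) - b) * Q H)"
        unfolding pd dd by (simp add: algebra_simps sum_subtractf sum_distrib_left)
      also have "(\<Sum>H\<in>A. (h * Const (l H v) - b) * Q H) = (\<Sum>H\<in>A. - u H * f)"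
      proof (intro sum.cong refl)
        fix H assume H: "H \<in> A"
        have "(h * Const (l H v) - b) * Q H = - (b - h * Const (l H v)) * Q H" by simp
        also have "\<dots> = - u H * f" unfolding u[OF H] fQ[OF H] by (simp add: ac_simps)
        finally show "(h * Const (l H v) - b) * Q H = - u H * f" .
      qed
      also have "Const C * \<dots> = (\<Sum>H\<in>A. - u H) * ?f" by (simp only: sum_distrib_right[symmetric] ac_simps)
      finally have "h * partial_deriv v ?f = (\<Sum>H\<in>A. - u H) * ?f + b * directional_deriv pt ?f"
        by (simp add: diff_eq_eq)
      then show "h * partial_deriv v ?f \<in> ?I" using I by blast
    qed
  qed
  finally show ?thesis .
qed

section \<open>The pencil generators solve the interpolation problem\<close>

lemma interp_add:
  assumes "interp p" "interp q" shows "interp (p + q)"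
  unfolding interp_def
proof
  fix v
  obtain b c where bc: "\<forall>H\<in>A. van (Hp H) (b - p * Const (l H v))" "\<forall>H\<in>A. van (Hp H) (c - q * Const (l H v))"
    using assms unfolding interp_def by meson
  show "\<exists>\<beta>. \<forall>H\<in>A. van (Hp H) (\<beta> - (p + q) * Const (l H v))"
    by (intro exI[of _ "b + c"]) (use bc in \<open>simp add: van_eq distrib_right\<close>)
qed

lemma interp_mult:
  assumes "interp p" shows "interp (q * p)"
  unfolding interp_def
proof
  fix v
  obtain b where b: "\<forall>H\<in>A. van (Hp H) (b - p * Const (l H v))"
    using assms unfolding interp_def by meson
  show "\<exists>\<beta>. \<forall>H\<in>A. van (Hp H) (\<beta> - (q * p) * Const (l H v))"
    by (intro exI[of _ "q * b"]) (use b in \<open>simp add: van_eq mult.assoc\<close>)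
qed

lemma interp_sum: "(\<And>i. i \<in> T \<Longrightarrow> interp (g i)) \<Longrightarrow> interp (sum g T)"
proof (induction T rule: infinite_finite_induct)
  case (insert x T)
  then show ?case by (simp add: interp_add)
qed (auto simp: interp_def intro!: exI[of _ 0])

text \<open>\<open>F i * z i\<close> is the product of all forms but that of \<open>B i\<close>. It
  vanishes on every other hyperplane, so \<open>l (B i) v\<close> may serve as the multiplier
  everywhere.\<close>

lemma interp_z: assumes "i < k" shows "interp (F i * z i)"
  unfolding interp_def
proof
  fix v
  have "van (Hp H) (F i * z i * Const (l (B i) v) - F i * z i * Const (l H v))" if H: "H \<in> A" for H
  proof (cases "H = B i")
    case False
    have "van (Hp H) (F i * z i)"
    proof (cases "H \<in> G i")
      case True
      then have "van (Hp H) (z i)"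
        using False finite_G[OF assms] by (auto simp: van_def z_def hyperplane_iff L_eval intro!: prod_zero)
      then show ?thesis by (rule van_mult_left)
    next
      case False
      then show ?thesis by (intro van_mult_right van_F H)
    qed
    then show ?thesis by (simp add: van_diff van_mult_right)
  qed simp
  then show "\<exists>\<beta>. \<forall>H\<in>A. van (Hp H) (\<beta> - F i * z i * Const (l H v))" by blast
qed

lemma interp_Y: assumes "i < m" shows "interp (F i * Y i)"
  unfolding interp_def
proof
  fix v
  \<comment> \<open>On a member with form \<open>l (B i) + c * y i\<close>, the form of
    \<open>B i\<close> equals \<open>- c * y i\<close>, so the bracket becomes \<open>y i\<close>
    times \<open>l (B i) v + c * y i v = l H v\<close>.\<close>
  let ?b = "F i * (Y i * Const (l (B i) v) - L (B i) * Const (y i v))"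
  have "van (Hp H) (?b - F i * Y i * Const (l H v))" if H: "H \<in> A" for H
  proof (cases "H \<in> G i")
    case True
    obtain c where c: "\<And>x. dot (l H) x = dot (l (B i)) x + c * dot (y i) x"
      using pencil_eq[OF assms True] by blast
    have cv: "l H v = l (B i) v + c * y i v" using c[of "vec_unit v"] by simp
    have x: "dot (l (B i)) x = - c * dot (y i) x" if "x \<in> Hp H" for x
      using that c[of x] by (simp add: hyperplane_iff eq_neg_iff_add_eq_0)
    show ?thesis unfolding van_eq
      by (auto simp: cv L_eval Y_eval x algebra_simps)
  next
    case False
    then have "van (Hp H) (F i)" using H by (rule van_F[rotated])
    then show ?thesis by (intro van_diff van_mult_right)
  qed
  then show "\<exists>\<beta>. \<forall>H\<in>A. van (Hp H) (\<beta> - F i * Y i * Const (l H v))" by blast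
qed

lemma interp_comb: "interp (comb \<alpha> \<beta>)"
proof -
  have "interp (F i * (\<alpha> i * z i + \<beta> i * Y i))" if i: "i < k" for i
  proof -
    have "interp (F i * Y i)"
    proof (cases "i < m")
      case False
      then show ?thesis using Y_single[of i] i by (auto simp: interp_def intro!: exI[of _ 0])
    qed (rule interp_Y)
    then have "interp (\<alpha> i * (F i * z i) + \<beta> i * (F i * Y i))"
      by (rule interp_add[OF interp_mult[OF interp_z[OF i]] interp_mult])
    then show ?thesis by (simp add: algebra_simps)
  qed
  then show ?thesis unfolding comb_def by (intro interp_sum) auto
qed

section \<open>Solutions of the interpolation problem lie in the pencil ideal\<close>

lemma interp_pair:
  assumes "interp h" "H \<in> A" "H' \<in> A" "H \<noteq> H'"
  shows "van (Hp H \<inter> Hp H') h"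
proof -
  have "l H \<noteq> l H'" using l_dist[OF assms(2-4)] by auto
  then obtain v where v: "l H v \<noteq> l H' v" by blast
  \<comment> \<open>On the intersection the interpolating polynomial equals both
    \<open>h * l H v\<close> and \<open>h * l H' v\<close>, while the two coefficients differ at
    this \<open>v\<close>.\<close>
  obtain b where b: "\<And>H. H \<in> A \<Longrightarrow> van (Hp H) (b - h * Const (l H v))"
    using assms(1) unfolding interp_def by blast
  show ?thesis unfolding van_def
  proof
    fix x assume "x \<in> Hp H \<inter> Hp H'"
    then have "poly_eval h x * l H v = poly_eval h x * l H' v"
      using b[OF assms(2)] b[OF assms(3)] by (auto simp: van_eq)
    then show "poly_eval h x = 0" using v by simp
  qed
qed

text \<open>\<open>h\<close> vanishes where \<open>H\<close> meets hyperplanes of other groups.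
  These traces on \<open>H\<close> are distinct, because three hyperplanes share a codimension two
  flat only within one group.\<close>

lemma interp_mod_line:
  assumes h: "interp h" and i: "i < k" and H: "H \<in> G i"
  shows "\<exists>u. van (Hp H) (h - F i * u)"
proof -
  have HA: "H \<in> A" using H G_sub[OF i] by blast
  have "\<exists>u. van (Hp H) (h - (\<Prod>H'\<in>A - G i. linear_form (l H')) * u)"
  proof (rule flat_div_prod[OF flat_hyperplane])
    show "finite (A - G i)" using finite_A by simp
    show "van (Hp H \<inter> Hp H') h" if "H' \<in> A - G i" for H'
      using interp_pair[OF h HA, of H'] that H by auto
    show "\<not> Hp H \<inter> Hp H' \<subseteq> Hp H''" if "H' \<in> A - G i" "H'' \<in> A - G i" "H' \<noteq> H''" for H' H''
      by (rule Hp_Hp_not_sub[OF i H]) (use that H in auto)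
  qed
  then show ?thesis by (simp add: F_def L_def)
qed

text \<open>\<open>L K\<close> is a nonzerodivisor modulo \<open>L H\<close> and \<open>F i\<close>:
  as \<open>F i\<close> does not vanish on \<open>Hp H \<inter> Hp K\<close>, the cofactor
  \<open>u\<close> must, and then \<open>L K\<close> divides it on \<open>Hp H\<close>.\<close>

lemma cancel_L_mod:
  assumes i: "i < k" and H: "H \<in> G i" "K \<in> G i" "K \<noteq> H" and u: "van (Hp H) (L K * w - F i * u)"
  shows "\<exists>u'. van (Hp H) (w - F i * u')"
proof -
  have HK: "H \<in> A" "K \<in> A" using H G_sub[OF i] by auto
  let ?W = "Hp H \<inter> Hp K"
  have W: "flat ?W" by (intro flat_Int_hyperplane flat_hyperplane)
  have "van ?W (F i * u)"
    unfolding van_def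
  proof
    fix x assume x: "x \<in> ?W"
    then have "poly_eval (L K * w - F i * u) x = 0" using u by (simp only: van_def Int_iff)
    then show "poly_eval (F i * u) x = 0" using x by (simp add: L_eval hyperplane_iff)
  qed
  moreover have "\<not> van ?W (F i)"
  proof (rule F_not_van[OF W])
    fix H' assume "H' \<in> A" "H' \<notin> G i"
    then show "\<not> ?W \<subseteq> Hp H'" using Hp_Hp_not_sub[OF i H(1) HK(2), of H'] H by auto
  qed
  ultimately have "van ?W u" using flat_prime[OF W] by blast
  then obtain u' where u': "van (Hp H) (u - L K * u')"
    using flat_div[OF flat_hyperplane \<open>van ?W u\<close>] by (auto simp: L_def)
  have "van (Hp H) ((L K * w - F i * u) + F i * (u - L K * u'))"
    by (rule van_add[OF u van_mult_left[OF u']])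
  also have "(L K * w - F i * u) + F i * (u - L K * u') = L K * (w - F i * u')"
    by (simp add: algebra_simps)
  finally have "van (Hp H) (w - F i * u')"
    using flat_prime[OF flat_hyperplane] l_dist[OF HK] H(3) van_L_iff by blast
  then show ?thesis by blast
qed

lemma cancel_prod_mod:
  assumes i: "i < k" and H: "H \<in> G i" and T: "finite T" "T \<subseteq> G i - {H}"
    and u: "\<exists>u. van (Hp H) ((\<Prod>K\<in>T. L K) * w - F i * u)"
  shows "\<exists>u'. van (Hp H) (w - F i * u')"
  using T u
proof (induction T rule: finite_induct)
  case (insert K T)
  obtain u where "van (Hp H) ((\<Prod>K\<in>insert K T. L K) * w - F i * u)" using insert.prems by blast
  then have "van (Hp H) (L K * ((\<Prod>K\<in>T. L K) * w) - F i * u)"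
    using insert.hyps by (simp add: mult.assoc)
  then have "\<exists>u. van (Hp H) ((\<Prod>K\<in>T. L K) * w - F i * u)"
    by (rule cancel_L_mod[OF i H, rotated 2]) (use insert.prems in auto)
  then show ?case using insert by blast
qed auto

text \<open>The congruences to multiples of \<open>F i\<close> on single hyperplanes are glued to
  one modulo the product of the group: the product of the forms already split off is cancelled
  modulo the next form and \<open>F i\<close>.\<close>

lemma interp_decomp:
  assumes h: "interp h" and i: "i < k"
  shows "\<exists>u w. h = F i * u + L (B i) * z i * w"
proof -
  have "\<exists>u w. h = F i * u + (\<Prod>H\<in>T. L H) * w" if "finite T" "T \<subseteq> G i" for T
    using that
  proof (induction T rule: finite_induct)
    case empty
    show ?case by (intro exI[of _ 0] exI[of _ h]) simp
  next
    case (insert H T)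
    then obtain u w where uw: "h = F i * u + (\<Prod>H\<in>T. L H) * w" by auto
    obtain u' where u': "van (Hp H) (h - F i * u')"
      using interp_mod_line[OF h i, of H] insert.prems by auto
    have "h - F i * u' = (\<Prod>H\<in>T. L H) * w - F i * (u' - u)" by (simp add: uw algebra_simps)
    with u' have "\<exists>u. van (Hp H) ((\<Prod>K\<in>T. L K) * w - F i * u)" by metis
    then obtain v where v: "van (Hp H) (w - F i * v)"
      using cancel_prod_mod[OF i, of H T w] insert by auto
    then obtain w' where "w - F i * v = L H * w'"
      using flat_div[OF flat_UNIV, of "l H"] by (auto simp: L_def)
    then have "w = F i * v + L H * w'" by (simp add: algebra_simps)
    then have "h = F i * (u + (\<Prod>H\<in>T. L H) * v) + (\<Prod>H\<in>insert H T. L H) * w'"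
      using insert.hyps by (simp add: uw algebra_simps)
    then show ?case by blast
  qed
  from this[OF finite_G[OF i]] show ?thesis by (simp add: group_prod[OF i])
qed

text \<open>On \<open>Yp i\<close> all forms of the pencil coincide, so the product is a power there
  and \<open>flat_div_prod\<close> does not apply. The forms are peeled off singly; each cuts
  \<open>Yp i\<close> in a flat on which \<open>F i\<close> does not vanish.\<close>

lemma coprime_F_mod_Y:
  assumes i: "i < m" and T: "finite T" "T \<subseteq> G i" 
    and u: "van (Yp i) (F i * u - (\<Prod>H\<in>T. L H) * q)"
  shows "\<exists>q. van (Yp i) (u - (\<Prod>H\<in>T. L H) * q)"
  using T u
proof (induction T arbitrary: q rule: finite_induct)
  case empty
  show ?case by (intro exI[of _ u]) simp
next
  case (insert H T)
  have HA: "H \<in> A" "H \<in> G i" using insert.prems G_sub[of i] i m_le_k by auto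
  let ?P = "\<Prod>H\<in>T. L H"
  have "van (Yp i) (F i * u - ?P * (L H * q))"
    using insert.prems(2) insert.hyps by (simp add: ac_simps)
  then obtain r where r: "van (Yp i) (u - ?P * r)" using insert by blast
  have "van (Yp i) ((F i * u - ?P * (L H * q)) - F i * (u - ?P * r))"
    by (rule van_diff[OF \<open>van (Yp i) (F i * u - ?P * (L H * q))\<close> van_mult_left[OF r]])
  also have "(F i * u - ?P * (L H * q)) - F i * (u - ?P * r) = ?P * (F i * r - L H * q)"
    by (simp add: algebra_simps)
  finally have e: "van (Yp i) (?P * (F i * r - L H * q))" .
  have Y_not: "\<not> Yp i \<subseteq> Hp K" if "K \<in> G i" for K
  proof
    assume sub: "Yp i \<subseteq> Hp K"
    have KA: "K \<in> A" using that G_sub[of i] i m_le_k by auto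
    have "pt \<in> Yp i" using y_pt[OF i] by (simp add: hyperplane_iff)
    then show False using sub l_pt[OF KA] by (auto simp: hyperplane_iff)
  qed
  have "\<not> van (Yp i) ?P"
    using insert.prems Y_not by (intro flat_prime_prod flat_hyperplane) (auto simp: van_L_iff)
  with e have e2: "van (Yp i) (F i * r - L H * q)" using flat_prime[OF flat_hyperplane] by blast
  let ?W = "Yp i \<inter> Hp H"
  have W: "flat ?W" by (intro flat_Int_hyperplane flat_hyperplane)
  have "van ?W (F i * r)" unfolding van_def
  proof
    fix x assume "x \<in> ?W"
    then show "poly_eval (F i * r) x = 0" using e2 by (auto simp: van_def L_eval hyperplane_iff)
  qed
  moreover have "\<not> van ?W (F i)"
    by (rule F_not_van[OF W]) (use Yp_Hp_not_sub[OF i HA(2)] in blast)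
  ultimately have "van ?W r" using flat_prime[OF W] by blast
  then obtain s where s: "van (Yp i) (r - L H * s)"
    using flat_div[OF flat_hyperplane \<open>van ?W r\<close>] by (auto simp: L_def)
  have "van (Yp i) ((u - ?P * r) + ?P * (r - L H * s))"
    by (rule van_add[OF r van_mult_left[OF s]])
  also have "(u - ?P * r) + ?P * (r - L H * s) = u - (\<Prod>H\<in>insert H T. L H) * s"
    using insert.hyps by (simp add: algebra_simps)
  finally show ?case by blast
qed

text \<open>For \<open>v\<close> with \<open>y i v \<noteq> 0\<close>, the combination
  \<open>?e\<close> involves the interpolating polynomial \<open>b\<close> only with the factor
  \<open>Y i\<close>, and it vanishes on the entire pencil. Divisibility by the product of the group
  and cancellation of \<open>L (B i)\<close> modulo \<open>Y i\<close> leave a multiple of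
  \<open>z i\<close>.\<close>

lemma interp_local:
  assumes h: "interp h" and i: "i < m"
  shows "\<exists>q. van (Yp i) (h - z i * q)"
proof -
  have ik: "i < k" using i m_le_k by simp
  obtain v where v: "y i v \<noteq> 0" using y_nonzero[OF i] by blast
  obtain b where b: "\<And>H. H \<in> A \<Longrightarrow> van (Hp H) (b - h * Const (l H v))"
    using h unfolding interp_def by blast
  \<comment> \<open>On a member \<open>l (B i) + c * y i\<close> the difference
    \<open>b - h * l (B i) v\<close> is \<open>c * h * y i v\<close> and \<open>L (B i)\<close> is
    \<open>- c * Y i\<close>, so the two terms cancel.\<close>
  let ?e = "Y i * (b - h * Const (l (B i) v)) + L (B i) * (h * Const (y i v))"
  have "van (UNIV \<inter> Hp H) ?e" if H: "H \<in> G i" for H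
    unfolding van_def
  proof
    fix x assume "x \<in> UNIV \<inter> Hp H"
    then have x: "dot (l H) x = 0" "x \<in> Hp H" by (simp_all add: hyperplane_iff)
    obtain c where c: "\<And>x. dot (l H) x = dot (l (B i)) x + c * dot (y i) x"
      using pencil_eq[OF i H] by blast
    have cv: "l H v = l (B i) v + c * y i v" using c[of "vec_unit v"] by simp
    have 1: "dot (l (B i)) x = - c * dot (y i) x" using c[of x] x by (simp add: eq_neg_iff_add_eq_0)
    have 2: "poly_eval b x = poly_eval h x * (l (B i) v + c * y i v)"
      using b[of H] H G_sub[OF ik] x(2) by (auto simp: van_def cv)
    show "poly_eval ?e x = 0" by (simp add: L_eval Y_eval 1 2 algebra_simps)
  qed
  then obtain g where g: "?e = (\<Prod>H\<in>G i. L H) * g"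
    using flat_div_prod[OF flat_UNIV finite_G[OF ik], of l ?e] l_dist G_sub[OF ik]
    by (auto simp: L_def subset_iff)
  let ?q = "Const (inverse (y i v)) * g"
  have e: "Y i * (b - h * Const (l (B i) v)) + L (B i) * (h * Const (y i v)) = L (B i) * (z i * g)"
    using g by (simp only: group_prod[OF ik] mult.assoc)
  have "van (Yp i) (L (B i) * (h * Const (y i v) - z i * g))"
    unfolding van_def
  proof
    fix x assume "x \<in> Yp i"
    then have "poly_eval (Y i) x = 0" by (simp add: Y_eval hyperplane_iff)
    then show "poly_eval (L (B i) * (h * Const (y i v) - z i * g)) x = 0"
      using arg_cong[OF e, of "\<lambda>p. poly_eval p x"] by (simp add: algebra_simps)
  qed
  moreover have "\<not> van (Yp i) (L (B i))"
  proof -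
    have "pt \<in> Yp i" using y_pt[OF i] by (simp add: hyperplane_iff)
    then show ?thesis using l_pt[OF B_A[OF ik]] by (auto simp: van_def L_eval intro!: bexI[of _ pt])
  qed
  ultimately have "van (Yp i) (h * Const (y i v) - z i * g)" using flat_prime[OF flat_hyperplane] by blast
  then have "van (Yp i) (Const (inverse (y i v)) * (h * Const (y i v) - z i * g))" by (rule van_mult_left)
  also have "Const (inverse (y i v)) * (h * Const (y i v) - z i * g) = h - z i * ?q"
    by (rule eval_eqI) (use v in \<open>simp add: algebra_simps\<close>)
  finally show ?thesis by blast
qed

text \<open>In a pencil, both \<open>h\<close> and the product part are multiples of
  \<open>z i\<close> modulo \<open>Y i\<close>, hence so is \<open>F i * u\<close>; as
  \<open>F i\<close> is coprime to \<open>z i\<close> there, \<open>u\<close> lies in the ideal of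
  \<open>z i\<close> and \<open>Y i\<close>.\<close>

lemma interp_group:
  assumes h: "interp h" and i: "i < k"
  shows "\<exists>a b w. h = F i * (a * z i + b * Y i) + L (B i) * z i * w"
proof -
  obtain u w where uw: "h = F i * u + L (B i) * z i * w" using interp_decomp[OF h i] by blast
  have "\<exists>a b. u = a * z i + b * Y i"
  proof (cases "i < m")
    case True
    obtain q where q: "van (Yp i) (h - z i * q)" using interp_local[OF h True] by blast
    have "h - z i * q = F i * u - z i * (q - L (B i) * w)" by (simp add: uw algebra_simps)
    with q have "van (Yp i) (F i * u - (\<Prod>H\<in>G i - {B i}. L H) * (q - L (B i) * w))" by (simp add: z_def)
    then obtain a where "van (Yp i) (u - z i * a)"
      using coprime_F_mod_Y[OF True, of "G i - {B i}" u] finite_G[OF i] by (auto simp: z_def)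
    then obtain b where "u - z i * a = Y i * b"
      using flat_div[OF flat_UNIV, of "y i"] by (auto simp: Y_def)
    then have "u = a * z i + b * Y i" by (simp add: algebra_simps)
    then show ?thesis by blast
  next
    case False
    then show ?thesis using z_single[of i] i by (intro exI[of _ u] exI[of _ 0]) simp
  qed
  then show ?thesis using uw by metis
qed

text \<open>The parts found for the separate groups are added up. On a hyperplane of group
  \<open>i\<close> the other parts vanish and the remainder of \<open>h\<close> is a multiple of the
  product of the group, so the sum agrees with \<open>h\<close> on all of \<open>A\<close>; the
  difference is a multiple of \<open>f\<close>, itself in \<open>R\<close>.\<close>

lemma interp_imp_R:
  assumes h: "interp h" shows "h \<in> R"
proof -
  obtain \<alpha> \<beta> \<omega> where abw: "\<And>i. i < k \<Longrightarrow> h = F i * (\<alpha> i * z i + \<beta> i * Y i) + L (B i) * z i * \<omega> i"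
    using interp_group[OF h] by metis
  have "van (UNIV \<inter> Hp H) (h - comb \<alpha> \<beta>)" if H: "H \<in> A" for H
  proof -
    obtain i where i: "i < k" "H \<in> G i" using H by (auto simp: A_eq)
    have "comb \<alpha> \<beta> = F i * (\<alpha> i * z i + \<beta> i * Y i) + (\<Sum>j\<in>{..<k} - {i}. F j * (\<alpha> j * z j + \<beta> j * Y j))"
      unfolding comb_def using i by (intro sum.remove) auto
    then have "h - comb \<alpha> \<beta> = (\<Prod>H\<in>G i. L H) * \<omega> i - (\<Sum>j\<in>{..<k} - {i}. F j * (\<alpha> j * z j + \<beta> j * Y j))"
      using abw[OF i(1)] by (simp add: group_prod[OF i(1)] algebra_simps)
    moreover have "van (Hp H) (\<Prod>H\<in>G i. L H)"
      using i finite_G by (auto simp: van_def hyperplane_iff L_eval intro!: prod_zero)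
    moreover have "van (Hp H) (\<Sum>j\<in>{..<k} - {i}. F j * (\<alpha> j * z j + \<beta> j * Y j))"
    proof (rule van_sum)
      fix j assume "j \<in> {..<k} - {i}"
      then have "H \<notin> G j" using i same_group by blast
      then show "van (Hp H) (F j * (\<alpha> j * z j + \<beta> j * Y j))" using van_F[OF H] van_mult_right by blast
    qed
    ultimately show ?thesis by (simp add: van_diff van_mult_right)
  qed
  then obtain w where w: "h - comb \<alpha> \<beta> = f * w"
    using flat_div_prod[OF flat_UNIV finite_A, of l "h - comb \<alpha> \<beta>"] l_dist by (auto simp: f_def L_def)
  then have "h = comb \<alpha> \<beta> + w * f" by (simp add: algebra_simps)
  then show ?thesis
    using ideal_subspace_add[OF R_ideal comb_in_R ideal_subspace_scale[OF R_ideal f_in_R]] by simp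
qed

theorem residual_eq_R: "C \<noteq> 0 \<Longrightarrow> residual (Const C * f) pt = R"
  using residual_iff interp_imp_R interp_comb by (auto simp: R_def)

end

section \<open>Homogeneous components\<close>

lemma mon_degree_add: "mon_degree (m + n) = mon_degree m + mon_degree n"
  by (simp add: mon_degree_def lookup_add sum.distrib)

lemma mon_degree_0 [simp]: "mon_degree 0 = 0"
  by (simp add: mon_degree_def)

lemma mon_degree_single [simp]: "mon_degree (mterm v n) = n"
  by (simp add: mon_degree_def lookup_single when_def)

lemma homogeneous_iff: "homogeneous k p \<longleftrightarrow> (\<forall>m. coeff_of p m \<noteq> 0 \<longrightarrow> int (mon_degree m) = k)"
  by (auto simp: homogeneous_def in_keys_iff)

lemma homogeneous_0 [simp]: "homogeneous k 0" by (simp add: homogeneous_def)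

lemma homogeneous_add: "homogeneous k p \<Longrightarrow> homogeneous k q \<Longrightarrow> homogeneous k (p + q)"
  unfolding homogeneous_iff lookup_add by (metis add.right_neutral)

lemma homogeneous_uminus: "homogeneous k p \<Longrightarrow> homogeneous k (- p)"
  by (simp add: homogeneous_iff)

lemma homogeneous_sum: "(\<And>i. i \<in> T \<Longrightarrow> homogeneous k (g i)) \<Longrightarrow> homogeneous k (sum g T)"
  by (induction T rule: infinite_finite_induct) (simp_all add: homogeneous_add)

lemma homogeneous_mult:
  assumes "homogeneous j p" "homogeneous k q"
  shows "homogeneous (j + k) (p * q)"
  unfolding homogeneous_def
proof
  fix m assume "m \<in> Poly_Mapping.keys (p * q)"
  then obtain a b where "m = a + b" "a \<in> Poly_Mapping.keys p" "b \<in> Poly_Mapping.keys q"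
    using keys_mult[of p q] by blast
  then show "int (mon_degree m) = j + k" using assms by (auto simp: homogeneous_def mon_degree_add)
qed

lemma homogeneous_Const: "homogeneous 0 (Const c)"
  by (auto simp: homogeneous_iff Const_def lookup_single when_def)

lemma homogeneous_1: "homogeneous 0 1" using homogeneous_Const[of 1] by simp

lemma homogeneous_Var: "homogeneous 1 (Var v)"
  by (auto simp: homogeneous_iff Var_def lookup_single when_def)

lemma homogeneous_linear_form: "homogeneous 1 (linear_form a)"
  unfolding linear_form_def
  by (intro homogeneous_sum) (use homogeneous_mult[OF homogeneous_Const homogeneous_Var] in simp)

lemma homogeneous_prod:
  "(\<And>i. i \<in> T \<Longrightarrow> homogeneous 1 (g i)) \<Longrightarrow> homogeneous (int (card T)) (prod g T)"
proof (induction T rule: infinite_finite_induct)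
  case (insert x T)
  then have "homogeneous (1 + int (card T)) (g x * prod g T)" by (intro homogeneous_mult) auto
  then show ?case using insert by simp
qed (simp_all add: homogeneous_1)

definition hcomp :: "int \<Rightarrow> ('v::finite, 'k::field) mpoly \<Rightarrow> ('v, 'k) mpoly" where
  "hcomp k p = (\<Sum>m\<in>{m\<in>Poly_Mapping.keys p. int (mon_degree m) = k}. mterm m (coeff_of p m))"

lemma lookup_hcomp: "coeff_of (hcomp k p) m = (if int (mon_degree m) = k then coeff_of p m else 0)"
proof -
  have "coeff_of (hcomp k p) m
      = (\<Sum>n\<in>{n\<in>Poly_Mapping.keys p. int (mon_degree n) = k}. if n = m then coeff_of p m else 0)"
    unfolding hcomp_def lookup_sum by (intro sum.cong) (auto simp: lookup_single)
  also have "\<dots> = (if int (mon_degree m) = k then coeff_of p m else 0)"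
    by (auto simp: in_keys_iff)
  finally show ?thesis .
qed

lemma hcomp_add: "hcomp k (p + q) = hcomp k p + hcomp k q"
  by (rule poly_mapping_eqI) (simp add: lookup_hcomp lookup_add)

lemma hcomp_diff: "hcomp k (p - q) = hcomp k p - hcomp k q"
  by (rule poly_mapping_eqI) (simp add: lookup_hcomp lookup_minus)

lemma hcomp_0 [simp]: "hcomp k 0 = 0"
  by (rule poly_mapping_eqI) (simp add: lookup_hcomp)

lemma hcomp_sum: "hcomp k (sum g T) = (\<Sum>i\<in>T. hcomp k (g i))"
  by (induction T rule: infinite_finite_induct) (simp_all add: hcomp_add)

lemma homogeneous_hcomp: "homogeneous k (hcomp k p)"
  by (simp add: homogeneous_iff lookup_hcomp)

lemma hcomp_homogeneous: "homogeneous k p \<Longrightarrow> hcomp k p = p"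
  by (rule poly_mapping_eqI) (auto simp: lookup_hcomp homogeneous_iff)

lemma hcomp_mult:
  fixes p q :: "('v::finite, 'k::field) mpoly"
  assumes "homogeneous j p"
  shows "hcomp (j + k) (p * q) = p * hcomp k q"
proof -
  have mono: "hcomp (j + k) (mterm m a * q) = mterm m a * hcomp k q" if "int (mon_degree m) = j" for m a
  proof (induction q rule: mpoly_induct_monomials)
    case (mterm n b)
    have hs: "hcomp i (mterm n' c) = (if int (mon_degree n') = i then mterm n' c else 0)" for i n' and c :: 'k
      by (rule poly_mapping_eqI) (auto simp: lookup_hcomp lookup_single when_def)
    show ?case using that by (auto simp: hs mult_single mon_degree_add)
  qed (simp add: distrib_left hcomp_add)
  have "hcomp (j + k) (p * q) = hcomp (j + k) ((\<Sum>m\<in>Poly_Mapping.keys p. mterm m (coeff_of p m)) * q)"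
    by (simp only: mpoly_sum_monomials)
  also have "\<dots> = (\<Sum>m\<in>Poly_Mapping.keys p. mterm m (coeff_of p m)) * hcomp k q"
    unfolding sum_distrib_right hcomp_sum
    by (intro sum.cong refl mono) (use assms in \<open>simp add: homogeneous_def\<close>)
  finally show ?thesis by (simp only: mpoly_sum_monomials)
qed

text \<open>The constant term is taken as the value at the origin, which makes it a ring
  homomorphism covered by the evaluation rules.\<close>

abbreviation c0 :: "('v::finite, 'k::field) mpoly \<Rightarrow> 'k" where "c0 p \<equiv> poly_eval p (\<lambda>_. 0)"

lemma c0_eq_lookup:
  fixes p :: "('v::finite, 'k::field) mpoly"
  shows "c0 p = coeff_of p 0"
proof (induction p rule: mpoly_induct_monomials)
  case (mterm m a)
  show ?case
  proof (cases "m = 0")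
    case True
    then show ?thesis using eval_simps(1)[of a "\<lambda>_. 0"] by (simp add: Const_def)
  next
    case False
    then obtain v where "coeff_of m v \<noteq> 0" by (metis lookup_zero poly_mapping_eqI)
    then have "(\<Prod>v\<in>UNIV. (0::'k) ^ coeff_of m v) = 0" by (intro prod_zero) auto
    then show ?thesis using False by (simp add: poly_eval_def lookup_single)
  qed
qed (simp add: lookup_add)

lemma irrelevant_iff: "p \<in> irrelevant_ideal \<longleftrightarrow> c0 p = 0"
  by (simp add: irrelevant_ideal_def c0_eq_lookup)

lemma c0_homogeneous: "homogeneous k p \<Longrightarrow> c0 p \<noteq> 0 \<Longrightarrow> k = 0"
  by (auto simp: c0_eq_lookup homogeneous_iff)

section \<open>Uniqueness of minimal graded free resolutions\<close>

text \<open>The degree-zero maps from the sum of the \<open>S(-c ! q)\<close> to the sum of the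
  \<open>S(-r ! p)\<close>.\<close>

definition graded_mat :: "int list \<Rightarrow> int list \<Rightarrow> ('v::finite, 'k::field) mpoly mat \<Rightarrow> bool" where
  "graded_mat r c M \<longleftrightarrow> M \<in> carrier_mat (length r) (length c) \<and>
     (\<forall>p<length r. \<forall>q<length c. homogeneous (c ! q - r ! p) (M $$ (p, q)))"

lemma graded_mat_mult:
  assumes M: "graded_mat r c M" and N: "graded_mat c e N"
  shows "graded_mat r e (M * N)"
  unfolding graded_mat_def
proof (intro conjI allI impI)
  show "M * N \<in> carrier_mat (length r) (length e)" using M N by (auto simp: graded_mat_def)
  fix p q assume pq: "p < length r" "q < length e"
  have "(M * N) $$ (p, q) = (\<Sum>i<length c. M $$ (p, i) * N $$ (i, q))"
    using M N pq by (auto simp: graded_mat_def scalar_prod_def atLeast0LessThan)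
  moreover have "homogeneous (e ! q - r ! p) (M $$ (p, i) * N $$ (i, q))" if "i < length c" for i
    using homogeneous_mult[of "c ! i - r ! p" "M $$ (p, i)" "e ! q - c ! i" "N $$ (i, q)"] M N pq that
    by (auto simp: graded_mat_def)
  ultimately show "homogeneous (e ! q - r ! p) ((M * N) $$ (p, q))" by (auto intro: homogeneous_sum)
qed

text \<open>Each entry of \<open>X\<close> is replaced by its component of the required degree;
  multiplied by a graded matrix, the other components land in degrees where \<open>Y\<close> has
  none.\<close>

lemma graded_lift:
  assumes \<phi>: "graded_mat r c \<phi>" and Y: "graded_mat r e Y" and X: "X \<in> carrier_mat (length c) (length e)"
    and eq: "Y = \<phi> * X"
  shows "\<exists>X'. graded_mat c e X' \<and> Y = \<phi> * X'"
proof -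
  define X' where "X' = mat (length c) (length e) (\<lambda>(i, q). hcomp (e ! q - c ! i) (X $$ (i, q)))"
  have X': "graded_mat c e X'" by (auto simp: X'_def graded_mat_def homogeneous_hcomp)
  have "Y = \<phi> * X'"
  proof (rule eq_matI)
    fix p q assume "p < dim_row (\<phi> * X')" "q < dim_col (\<phi> * X')"
    then have pq: "p < length r" "q < length e" using \<phi> by (auto simp: X'_def graded_mat_def)
    have "Y $$ (p, q) = hcomp (e ! q - r ! p) (Y $$ (p, q))"
      using Y pq by (simp add: graded_mat_def hcomp_homogeneous)
    also have "\<dots> = hcomp (e ! q - r ! p) (\<Sum>i<length c. \<phi> $$ (p, i) * X $$ (i, q))"
      using \<phi> X pq by (auto simp: eq graded_mat_def scalar_prod_def atLeast0LessThan)
    also have "\<dots> = (\<Sum>i<length c. \<phi> $$ (p, i) * X' $$ (i, q))"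
      unfolding hcomp_sum
    proof (intro sum.cong refl)
      fix i assume i: "i \<in> {..<length c}"
      have "hcomp ((c ! i - r ! p) + (e ! q - c ! i)) (\<phi> $$ (p, i) * X $$ (i, q))
          = \<phi> $$ (p, i) * hcomp (e ! q - c ! i) (X $$ (i, q))"
        by (rule hcomp_mult) (use \<phi> pq i in \<open>simp add: graded_mat_def\<close>)
      then show "hcomp (e ! q - r ! p) (\<phi> $$ (p, i) * X $$ (i, q)) = \<phi> $$ (p, i) * X' $$ (i, q)"
        using i pq by (simp add: X'_def)
    qed
    also have "\<dots> = (\<phi> * X') $$ (p, q)"
      using \<phi> X' pq by (auto simp: graded_mat_def scalar_prod_def atLeast0LessThan)
    finally show "Y $$ (p, q) = (\<phi> * X') $$ (p, q)" .
  qed (use Y \<phi> X' in \<open>auto simp: graded_mat_def\<close>)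
  with X' show ?thesis by blast
qed

lemma mat_lift:
  fixes \<psi> :: "'r::comm_ring_1 mat"
  assumes \<psi>: "\<psi> \<in> carrier_mat n l" and Y: "Y \<in> carrier_mat n c"
    and col: "\<And>j. j < c \<Longrightarrow> col Y j \<in> (\<lambda>w. \<psi> *\<^sub>v w) ` carrier_vec l"
  shows "\<exists>X\<in>carrier_mat l c. Y = \<psi> * X"
proof -
  obtain w where w: "\<And>j. j < c \<Longrightarrow> w j \<in> carrier_vec l" "\<And>j. j < c \<Longrightarrow> col Y j = \<psi> *\<^sub>v w j"
    using col by (auto simp: image_iff) metis
  define X where "X = mat l c (\<lambda>(i, j). w j $ i)"
  have X: "X \<in> carrier_mat l c" by (simp add: X_def)
  have colX: "col X j = w j" if "j < c" for j
    using w(1)[OF that] that by (intro eq_vecI) (auto simp: X_def)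
  have "Y = \<psi> * X"
  proof (rule eq_matI)
    fix i j assume "i < dim_row (\<psi> * X)" "j < dim_col (\<psi> * X)"
    then have ij: "i < n" "j < c" using \<psi> X by auto
    have "Y $$ (i, j) = col Y j $ i" using ij Y by auto
    also have "\<dots> = row \<psi> i \<bullet> col X j" using ij \<psi> by (simp add: w(2) colX)
    also have "\<dots> = (\<psi> * X) $$ (i, j)" using ij \<psi> X by auto
    finally show "Y $$ (i, j) = (\<psi> * X) $$ (i, j)" .
  qed (use \<psi> X Y in auto)
  then show ?thesis using X by blast
qed

definition exact_at :: "'r::comm_ring_1 mat \<Rightarrow> 'r mat \<Rightarrow> nat \<Rightarrow> nat \<Rightarrow> nat \<Rightarrow> bool" where
  "exact_at \<phi> \<psi> a b c \<longleftrightarrow> \<phi> \<in> carrier_mat a b \<and> \<psi> \<in> carrier_mat b c \<and>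
     {v \<in> carrier_vec b. \<phi> *\<^sub>v v = 0\<^sub>v a} = (\<lambda>w. \<psi> *\<^sub>v w) ` carrier_vec c"

lemma exact_lift:
  assumes ex: "exact_at \<phi> \<psi> a b c" and Y: "Y \<in> carrier_mat b e" and 0: "\<phi> * Y = 0\<^sub>m a e"
  shows "\<exists>X\<in>carrier_mat c e. Y = \<psi> * X"
proof (rule mat_lift)
  show "\<psi> \<in> carrier_mat b c" "Y \<in> carrier_mat b e" using ex Y by (auto simp: exact_at_def)
  fix j assume j: "j < e"
  have \<phi>: "\<phi> \<in> carrier_mat a b" using ex by (simp add: exact_at_def)
  have "\<phi> *\<^sub>v col Y j = col (\<phi> * Y) j" using \<phi> Y j by (simp add: col_mult2)
  also have "\<dots> = 0\<^sub>v a" using j by (simp add: 0)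
  finally show "col Y j \<in> (\<lambda>w. \<psi> *\<^sub>v w) ` carrier_vec c"
    using ex Y j unfolding exact_at_def by (metis (mono_tags, lifting) carrier_matD(1) col_dim mem_Collect_eq)
qed

lemma mult_unit_vec_eq_col:
  fixes M :: "'r::comm_ring_1 mat"
  assumes "M \<in> carrier_mat n c" "j < c"
  shows "M *\<^sub>v unit_vec c j = col M j"
  using assms by (intro eq_vecI) auto

lemma exact_comp:
  assumes ex: "exact_at \<phi> \<psi> a b c" 
  shows "\<phi> * \<psi> = 0\<^sub>m a c"
proof (rule eq_matI)
  have \<phi>: "\<phi> \<in> carrier_mat a b" and \<psi>: "\<psi> \<in> carrier_mat b c" using ex by (auto simp: exact_at_def)
  fix i j assume "i < dim_row (0\<^sub>m a c :: 'a mat)" "j < dim_col (0\<^sub>m a c :: 'a mat)"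
  then have ij: "i < a" "j < c" by auto
  have "\<psi> *\<^sub>v unit_vec c j \<in> (\<lambda>w. \<psi> *\<^sub>v w) ` carrier_vec c" by auto
  then have "\<phi> *\<^sub>v (\<psi> *\<^sub>v unit_vec c j) = 0\<^sub>v a" using ex unfolding exact_at_def by auto
  moreover have "\<psi> *\<^sub>v unit_vec c j = col \<psi> j" using mult_unit_vec_eq_col[OF \<psi>] ij by simp
  ultimately have "\<phi> *\<^sub>v col \<psi> j = 0\<^sub>v a" by simp
  then have "(\<phi> *\<^sub>v col \<psi> j) $ i = 0" using ij by simp
  then show "(\<phi> * \<psi>) $$ (i, j) = 0\<^sub>m a c $$ (i, j)" using ij \<phi> \<psi> by simp
qed (use ex in \<open>auto simp: exact_at_def\<close>)

definition irr_mat :: "('v::finite, 'k::field) mpoly mat \<Rightarrow> bool" where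
  "irr_mat M \<longleftrightarrow> (\<forall>i<dim_row M. \<forall>j<dim_col M. c0 (M $$ (i, j)) = 0)"

lemma irr_mat_mult_left: "irr_mat M \<Longrightarrow> dim_col M = dim_row N \<Longrightarrow> irr_mat (M * N)"
  by (auto simp: irr_mat_def scalar_prod_def)

lemma irr_mat_mult_right: "irr_mat N \<Longrightarrow> dim_col M = dim_row N \<Longrightarrow> irr_mat (M * N)"
  by (auto simp: irr_mat_def scalar_prod_def)

text \<open>One degree of a comparison map of complexes, together with what the next degree
  requires: the factor \<open>X\<close>, made graded, becomes the next map.\<close>

definition chain_lift where
  "chain_lift b b' bn bn' \<phi> \<phi>' U \<longleftrightarrow> graded_mat b' b U \<and>
    (\<exists>X\<in>carrier_mat (length bn') (length bn). U * \<phi> = \<phi>' * X)"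

text \<open>The summand \<open>T\<close> plays the role of \<open>s d\<close> in \<open>W - 1 = d s + s d\<close>: only the two properties
  listed here are passed on to the next step.\<close>

definition homotopic_id where
  "homotopic_id b bn \<phi> W \<longleftrightarrow> (\<exists>s\<in>carrier_mat (length bn) (length b). \<exists>T\<in>carrier_mat (length b) (length b).
     W = 1\<^sub>m (length b) + \<phi> * s + T \<and> T * \<phi> = 0\<^sub>m (length b) (length bn) \<and> irr_mat T)"

text \<open>The graded factor, composed with \<open>\<psi>\<close>, is killed by
  \<open>\<phi>'\<close> because \<open>\<phi> * \<psi> = 0\<close>; exactness of the second complex
  supplies the factor for the following degree.\<close>

lemma chain_lift_step:
  assumes \<phi>: "graded_mat b bn \<phi>" and \<phi>': "graded_mat b' bn' \<phi>'"
    and ex: "exact_at \<phi> \<psi> (length b) (length bn) (length bm)"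
    and ex': "exact_at \<phi>' \<psi>' (length b') (length bn') (length bm')"
    and U: "chain_lift b b' bn bn' \<phi> \<phi>' U"
  shows "\<exists>U'. U * \<phi> = \<phi>' * U' \<and> chain_lift bn bn' bm bm' \<psi> \<psi>' U'"
proof -
  have gU: "graded_mat b' b U" using U by (simp add: chain_lift_def)
  obtain X where "X \<in> carrier_mat (length bn') (length bn)" "U * \<phi> = \<phi>' * X"
    using U by (auto simp: chain_lift_def)
  then obtain U' where U': "graded_mat bn' bn U'" "U * \<phi> = \<phi>' * U'"
    using graded_lift[OF \<phi>' graded_mat_mult[OF gU \<phi>]] by blast
  have c: "U \<in> carrier_mat (length b') (length b)" "U' \<in> carrier_mat (length bn') (length bn)"
    "\<phi> \<in> carrier_mat (length b) (length bn)" "\<phi>' \<in> carrier_mat (length b') (length bn')"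
    "\<psi> \<in> carrier_mat (length bn) (length bm)"
    using gU U' \<phi> \<phi>' ex by (auto simp: graded_mat_def exact_at_def)
  have "\<phi>' * (U' * \<psi>) = (\<phi>' * U') * \<psi>" using c by (simp add: assoc_mult_mat[of \<phi>' _ _ U' _ \<psi>])
  also have "\<dots> = U * (\<phi> * \<psi>)" using c by (simp add: assoc_mult_mat[of U _ _ \<phi> _ \<psi>] flip: U'(2))
  also have "\<dots> = 0\<^sub>m (length b') (length bm)" using c by (simp add: exact_comp[OF ex])
  finally have "\<exists>X\<in>carrier_mat (length bm') (length bm). U' * \<psi> = \<psi>' * X"
    using c by (intro exact_lift[OF ex']) auto
  then show ?thesis using U' by (auto simp: chain_lift_def)
qed

text \<open>From \<open>W = 1 + \<phi> s + T\<close> and \<open>T \<phi> = 0\<close> follows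
  \<open>\<phi> W' = \<phi> (1 + s \<phi>)\<close>, so \<open>W' - 1 - s \<phi>\<close> factors
  through \<open>\<psi>\<close>. The next \<open>T\<close> is \<open>s \<phi>\<close>: it is
  annihilated by \<open>\<psi>\<close> on the right, and minimality gives it entries without
  constant term.\<close>

lemma homotopy_step:
  assumes \<phi>: "\<phi> \<in> carrier_mat (length b) (length bn)" and irr: "irr_mat \<phi>"
    and ex: "exact_at \<phi> \<psi> (length b) (length bn) (length bm)"
    and W: "homotopic_id b bn \<phi> W" and W': "W' \<in> carrier_mat (length bn) (length bn)"
    and eq: "W * \<phi> = \<phi> * W'"
  shows "homotopic_id bn bm \<psi> W'"
proof -
  let ?n = "length b" and ?m = "length bn"
  obtain s T where s: "s \<in> carrier_mat ?m ?n" and T: "T \<in> carrier_mat ?n ?n"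
    and WsT: "W = 1\<^sub>m ?n + \<phi> * s + T" and T0: "T * \<phi> = 0\<^sub>m ?n ?m"
    using W by (auto simp: homotopic_id_def)
  have "W * \<phi> = (1\<^sub>m ?n + \<phi> * s) * \<phi> + T * \<phi>"
    unfolding WsT using \<phi> s T by (intro add_mult_distrib_mat) auto
  also have "(1\<^sub>m ?n + \<phi> * s) * \<phi> = 1\<^sub>m ?n * \<phi> + \<phi> * s * \<phi>"
    using \<phi> s by (intro add_mult_distrib_mat) auto
  also have "\<phi> * s * \<phi> = \<phi> * (s * \<phi>)" using \<phi> s by (intro assoc_mult_mat) auto
  also have "1\<^sub>m ?n * \<phi> + \<phi> * (s * \<phi>) + T * \<phi> = \<phi> * 1\<^sub>m ?m + \<phi> * (s * \<phi>)"
    using \<phi> s by (simp add: T0 right_add_zero_mat[of _ ?n ?m])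
  also have "\<dots> = \<phi> * (1\<^sub>m ?m + s * \<phi>)"
    using \<phi> s by (intro mult_add_distrib_mat[symmetric]) auto
  finally have e: "\<phi> * W' = \<phi> * (1\<^sub>m ?m + s * \<phi>)" using eq by simp
  have "\<phi> * (W' - (1\<^sub>m ?m + s * \<phi>)) = \<phi> * W' - \<phi> * (1\<^sub>m ?m + s * \<phi>)"
    using \<phi> s W' by (intro mult_minus_distrib_mat) auto
  also have "\<dots> = 0\<^sub>m ?n ?m" unfolding e using \<phi> s by (intro minus_r_inv_mat) auto
  finally have "\<phi> * (W' - (1\<^sub>m ?m + s * \<phi>)) = 0\<^sub>m ?n ?m" .
  moreover have "W' - (1\<^sub>m ?m + s * \<phi>) \<in> carrier_mat ?m ?m" using \<phi> s by (intro minus_carrier_mat) auto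
  ultimately obtain s' where s': "s' \<in> carrier_mat (length bm) ?m" "W' - (1\<^sub>m ?m + s * \<phi>) = \<psi> * s'"
    using exact_lift[OF ex] by blast
  have \<psi>: "\<psi> \<in> carrier_mat ?m (length bm)" using ex by (simp add: exact_at_def)
  have "W' = 1\<^sub>m ?m + (W' - (1\<^sub>m ?m + s * \<phi>)) + s * \<phi>"
    using \<phi> s W' by (intro eq_matI) auto
  then have "W' = 1\<^sub>m ?m + \<psi> * s' + s * \<phi>" unfolding s'(2) .
  moreover have "(s * \<phi>) * \<psi> = 0\<^sub>m ?m (length bm)"
    using s \<phi> \<psi> by (simp add: assoc_mult_mat[of s _ _ \<phi> _ \<psi>] exact_comp[OF ex])
  moreover have "irr_mat (s * \<phi>)" using s \<phi> irr by (intro irr_mat_mult_right) auto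
  ultimately show ?thesis unfolding homotopic_id_def
    using s' \<phi> s by (intro bexI[of _ s'] bexI[of _ "s * \<phi>"]) auto
qed

text \<open>Gaussian elimination: an equation with a nonzero coefficient is solved for its unknown
  \<open>p\<close>, so each equation uses up at most one unknown.\<close>

lemma underdetermined_system:
  fixes a :: "'m \<Rightarrow> 'e \<Rightarrow> 'k::field"
  assumes "finite M" "finite E" "card M < card E"
  shows "\<exists>c. (\<exists>e\<in>E. c e \<noteq> 0) \<and> (\<forall>m\<in>M. (\<Sum>e\<in>E. a m e * c e) = 0)"
  using assms
proof (induction M arbitrary: a E rule: finite_induct)
  case empty
  then obtain e where "e \<in> E" by (metis all_not_in_conv card.empty less_irrefl)
  then show ?case by (intro exI[of _ "\<lambda>_. 1"]) auto
next
  case (insert x M)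
  show ?case
  proof (cases "\<exists>e\<in>E. a x e \<noteq> 0")
    case False
    obtain c where "\<exists>e\<in>E. c e \<noteq> 0" "\<forall>m\<in>M. (\<Sum>e\<in>E. a m e * c e) = 0"
      using insert.IH[of E a] insert.prems insert.hyps by auto
    then show ?thesis using False by (intro exI[of _ c]) auto
  next
    case True
    then obtain p where p: "p \<in> E" "a x p \<noteq> 0" by blast
    let ?E = "E - {p}"
    define a' where "a' m e = a m e - a m p / a x p * a x e" for m e
    have "card M < card ?E" using insert p by (simp add: card_Diff_singleton)
    then obtain c where c: "\<exists>e\<in>?E. c e \<noteq> 0" "\<forall>m\<in>M. (\<Sum>e\<in>?E. a' m e * c e) = 0"
      using insert.IH[of ?E a'] insert.prems by auto
    define d where "d e = (if e = p then - (\<Sum>e\<in>?E. a x e * c e) / a x p else c e)" for e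
    have sum: "(\<Sum>e\<in>E. a m e * d e) = a m p * d p + (\<Sum>e\<in>?E. a m e * c e)" for m
      using insert.prems p by (subst sum.remove[of E p]) (auto simp: d_def intro: sum.cong)
    have "(\<Sum>e\<in>E. a x e * d e) = 0" unfolding sum using p by (simp add: d_def)
    moreover have "(\<Sum>e\<in>E. a m e * d e) = 0" if "m \<in> M" for m
    proof -
      have "0 = (\<Sum>e\<in>?E. a m e * c e) - a m p / a x p * (\<Sum>e\<in>?E. a x e * c e)"
        using c(2) that by (simp add: a'_def left_diff_distrib sum_subtractf sum_distrib_left mult.assoc)
      then show ?thesis unfolding sum by (simp add: d_def)
    qed
    moreover have "\<exists>e\<in>E. d e \<noteq> 0" using c(1) by (auto simp: d_def)
    ultimately show ?thesis by (intro exI[of _ d]) auto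
  qed
qed

lemma card_le_of_left_inverse:
  fixes u :: "'m \<Rightarrow> 'e \<Rightarrow> 'k::field"
  assumes "finite M" "finite E" 
    and inv: "\<And>p q. p \<in> E \<Longrightarrow> q \<in> E \<Longrightarrow> (\<Sum>i\<in>M. v p i * u i q) = (if p = q then 1 else 0)"
  shows "card E \<le> card M"
proof (rule ccontr)
  assume "\<not> ?thesis"
  then obtain c where c: "\<exists>e\<in>E. c e \<noteq> 0" "\<forall>i\<in>M. (\<Sum>e\<in>E. u i e * c e) = 0"
    using underdetermined_system[of M E u] assms by auto
  then obtain p where p: "p \<in> E" "c p \<noteq> 0" by blast
  have "c p = (\<Sum>q\<in>E. if q = p then c p else 0)" using p assms by simp
  also have "\<dots> = (\<Sum>q\<in>E. (\<Sum>i\<in>M. v p i * u i q) * c q)"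
    by (intro sum.cong) (auto simp: inv p)
  also have "\<dots> = (\<Sum>i\<in>M. v p i * (\<Sum>q\<in>E. u i q * c q))"
    unfolding sum_distrib_right sum_distrib_left by (subst sum.swap) (simp add: mult.assoc)
  also have "\<dots> = 0" using c by simp
  finally show False using p by simp
qed

text \<open>Constant terms turn \<open>V * U = 1 + \<phi> * s + T\<close> into a left inverse
  relation between scalar matrices. Since a graded matrix has constant terms only between basis
  elements of equal degree, the relation restricts to degree \<open>j\<close>, where it compares the
  multiplicities.\<close>

lemma graded_count_le:
  assumes U: "graded_mat b' b U" and V: "graded_mat b b' V"
    and irr: "irr_mat \<phi>" and \<phi>: "\<phi> \<in> carrier_mat (length b) (length bn)"
    and h: "homotopic_id b bn \<phi> (V * U)"
  shows "count (mset b) j \<le> count (mset b') j"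
proof -
  obtain s T where s: "s \<in> carrier_mat (length bn) (length b)" and T: "T \<in> carrier_mat (length b) (length b)"
    and eq: "V * U = 1\<^sub>m (length b) + \<phi> * s + T" and T0: "irr_mat T"
    using h by (auto simp: homotopic_id_def)
  have ps: "irr_mat (\<phi> * s)" using irr \<phi> s by (intro irr_mat_mult_left) auto
  let ?E = "{p. p < length b \<and> b ! p = j}" and ?M = "{p. p < length b' \<and> b' ! p = j}"
  have "card ?E \<le> card ?M"
  proof (rule card_le_of_left_inverse)
    fix p q assume p: "p \<in> ?E" and q: "q \<in> ?E"
    have Uc: "U \<in> carrier_mat (length b') (length b)" and Vc: "V \<in> carrier_mat (length b) (length b')"
      using U V by (auto simp: graded_mat_def)
    have "(\<Sum>i\<in>?M. c0 (V $$ (p, i)) * c0 (U $$ (i, q))) = (\<Sum>i<length b'. c0 (V $$ (p, i)) * c0 (U $$ (i, q)))"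
    proof (rule sum.mono_neutral_left)
      show "\<forall>i\<in>{..<length b'} - ?M. c0 (V $$ (p, i)) * c0 (U $$ (i, q)) = 0"
      proof
        fix i assume i: "i \<in> {..<length b'} - ?M"
        then have "homogeneous (b ! q - b' ! i) (U $$ (i, q))" using U q by (auto simp: graded_mat_def)
        then have "c0 (U $$ (i, q)) = 0" using c0_homogeneous i q by fastforce
        then show "c0 (V $$ (p, i)) * c0 (U $$ (i, q)) = 0" by simp
      qed
    qed auto
    also have "\<dots> = c0 ((V * U) $$ (p, q))"
      using Uc Vc p q by (auto simp: scalar_prod_def atLeast0LessThan)
    also have "\<dots> = c0 ((1\<^sub>m (length b) + \<phi> * s + T) $$ (p, q))" by (simp only: eq)
    also have "\<dots> = (if p = q then 1 else 0) + c0 ((\<phi> * s) $$ (p, q)) + c0 (T $$ (p, q))"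
    proof -
      have "(1\<^sub>m (length b) + \<phi> * s + T) $$ (p, q) = (if p = q then 1 else 0) + (\<phi> * s) $$ (p, q) + T $$ (p, q)"
        using p q \<phi> s T by (auto simp del: index_mult_mat(1))
      then show ?thesis by (simp del: index_mult_mat(1))
    qed
    also have "c0 ((\<phi> * s) $$ (p, q)) = 0" using ps p q \<phi> s unfolding irr_mat_def by auto
    also have "c0 (T $$ (p, q)) = 0" using T0 p q T unfolding irr_mat_def by auto
    finally show "(\<Sum>i\<in>?M. c0 (V $$ (p, i)) * c0 (U $$ (i, q))) = (if p = q then 1 else 0)" by simp
  qed auto
  moreover have "count (mset xs) j = card {p. p < length xs \<and> xs ! p = j}" for xs
    unfolding count_mset count_list_eq_length_filter length_filter_conv_card by (rule arg_cong[of _ _ card]) auto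
  ultimately show ?thesis by simp
qed

text \<open>Each generator of one system is expressed by the other modulo \<open>I\<close>, and the
  coefficients are cut down to the degrees of a graded matrix; homogeneity of \<open>I\<close>
  preserves the congruence.\<close>

lemma initial_lift:
  fixes J I :: "('v::finite, 'k::field) mpoly set"
  assumes I: "is_ideal I" and I_hcomp: "\<And>k p. p \<in> I \<Longrightarrow> hcomp k p \<in> I"
    and g: "g \<in> carrier_vec (length b)" "\<And>q. q < length b \<Longrightarrow> g $ q \<in> J \<and> homogeneous (b ! q) (g $ q)"
    and g': "g' \<in> carrier_vec (length b')" "\<And>p. p < length b' \<Longrightarrow> homogeneous (b' ! p) (g' $ p)"
    and surj: "\<forall>h\<in>J. \<exists>v\<in>carrier_vec (length b'). h - g' \<bullet> v \<in> I"
  shows "\<exists>U. graded_mat b' b U \<and> (\<forall>w\<in>carrier_vec (length b). g \<bullet> w - g' \<bullet> (U *\<^sub>v w) \<in> I)"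
proof -
  have "\<exists>v. g $ q - (\<Sum>p<length b'. g' $ p * v p) \<in> I \<and> (\<forall>p<length b'. homogeneous (b ! q - b' ! p) (v p))"
    if q: "q < length b" for q
  proof -
    obtain v where v: "v \<in> carrier_vec (length b')" "g $ q - g' \<bullet> v \<in> I" using surj g(2)[OF q] by blast
    let ?v = "\<lambda>p. hcomp (b ! q - b' ! p) (v $ p)"
    have "hcomp (b ! q) (g $ q - g' \<bullet> v) = g $ q - (\<Sum>p<length b'. hcomp (b ! q) (g' $ p * v $ p))"
      using v(1) g(2)[OF q] by (simp add: hcomp_diff hcomp_homogeneous scalar_prod_def hcomp_sum atLeast0LessThan)
    also have "(\<Sum>p<length b'. hcomp (b ! q) (g' $ p * v $ p)) = (\<Sum>p<length b'. g' $ p * ?v p)"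
    proof (intro sum.cong refl)
      fix p assume "p \<in> {..<length b'}"
      then show "hcomp (b ! q) (g' $ p * v $ p) = g' $ p * ?v p"
        using hcomp_mult[OF g'(2), of p "b ! q - b' ! p" "v $ p"] by simp
    qed
    finally have "g $ q - (\<Sum>p<length b'. g' $ p * ?v p) \<in> I" using I_hcomp[OF v(2), of "b ! q"] by simp
    then show ?thesis by (intro exI[of _ ?v]) (simp add: homogeneous_hcomp)
  qed
  then have "\<forall>q. \<exists>v. q < length b \<longrightarrow> g $ q - (\<Sum>p<length b'. g' $ p * v p) \<in> I \<and>
      (\<forall>p<length b'. homogeneous (b ! q - b' ! p) (v p))" by blast
  from choice[OF this] obtain v where v: "\<And>q. q < length b \<Longrightarrow> g $ q - (\<Sum>p<length b'. g' $ p * v q p) \<in> I \<and>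
      (\<forall>p<length b'. homogeneous (b ! q - b' ! p) (v q p))" by blast
  define U where "U = mat (length b') (length b) (\<lambda>(p, q). v q p)"
  have "g \<bullet> w - g' \<bullet> (U *\<^sub>v w) \<in> I" if w: "w \<in> carrier_vec (length b)" for w
  proof -
    have "g' \<bullet> (U *\<^sub>v w) = (\<Sum>p<length b'. g' $ p * (\<Sum>q<length b. v q p * w $ q))"
      using w by (simp add: U_def scalar_prod_def atLeast0LessThan)
    also have "\<dots> = (\<Sum>q<length b. (\<Sum>p<length b'. g' $ p * v q p) * w $ q)"
      unfolding sum_distrib_left sum_distrib_right by (subst sum.swap) (simp add: mult.assoc)
    finally have "g \<bullet> w - g' \<bullet> (U *\<^sub>v w) = (\<Sum>q<length b. w $ q * (g $ q - (\<Sum>p<length b'. g' $ p * v q p)))"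
      using w by (simp add: scalar_prod_def atLeast0LessThan algebra_simps sum_subtractf)
    also have "\<dots> \<in> I" by (intro ideal_subspace_sum[OF I] ideal_subspace_scale[OF I]) (use v in auto)
    finally show ?thesis .
  qed
  moreover have "graded_mat b' b U" using v by (auto simp: graded_mat_def U_def)
  ultimately show ?thesis by blast
qed

lemma initial_chain_lift:
  fixes I :: "('v::finite, 'k::field) mpoly set"
  assumes I: "is_ideal I" and U: "graded_mat b' b U"
    and comp: "\<forall>w\<in>carrier_vec (length b). g \<bullet> w - g' \<bullet> (U *\<^sub>v w) \<in> I"
    and \<phi>: "\<phi> \<in> carrier_mat (length b) (length bn)" and \<phi>': "\<phi>' \<in> carrier_mat (length b') (length bn')"
    and ker: "{v \<in> carrier_vec (length b). g \<bullet> v \<in> I} = (\<lambda>w. \<phi> *\<^sub>v w) ` carrier_vec (length bn)"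
    and ker': "{v \<in> carrier_vec (length b'). g' \<bullet> v \<in> I} = (\<lambda>w. \<phi>' *\<^sub>v w) ` carrier_vec (length bn')"
  shows "chain_lift b b' bn bn' \<phi> \<phi>' U"
proof -
  have Uc: "U \<in> carrier_mat (length b') (length b)" using U by (simp add: graded_mat_def)
  have "\<exists>X\<in>carrier_mat (length bn') (length bn). U * \<phi> = \<phi>' * X"
  proof (rule mat_lift[OF \<phi>'])
    show "U * \<phi> \<in> carrier_mat (length b') (length bn)" using Uc \<phi> by simp
    fix j assume j: "j < length bn"
    have "col \<phi> j \<in> (\<lambda>w. \<phi> *\<^sub>v w) ` carrier_vec (length bn)"
      unfolding mult_unit_vec_eq_col[OF \<phi> j, symmetric] by auto
    then have g: "g \<bullet> col \<phi> j \<in> I" "col \<phi> j \<in> carrier_vec (length b)" using ker by auto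
    have "g \<bullet> col \<phi> j - (g \<bullet> col \<phi> j - g' \<bullet> (U *\<^sub>v col \<phi> j)) \<in> I"
      by (rule ideal_subspace_diff[OF I g(1)]) (use comp g(2) in blast)
    then have "g' \<bullet> (U *\<^sub>v col \<phi> j) \<in> I" by simp
    moreover have "U *\<^sub>v col \<phi> j \<in> carrier_vec (length b')" using Uc g by simp
    moreover have "col (U * \<phi>) j = U *\<^sub>v col \<phi> j" using Uc \<phi> j by simp
    ultimately show "col (U * \<phi>) j \<in> (\<lambda>w. \<phi>' *\<^sub>v w) ` carrier_vec (length bn')" using ker' by auto
  qed
  then show ?thesis using U by (simp add: chain_lift_def)
qed

text \<open>Both comparison maps respect the augmentation modulo \<open>I\<close>, so the columns of
  \<open>V * U - 1\<close> lie in its kernel and come from \<open>\<phi>\<close>; the homotopy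
  starts with \<open>T = 0\<close>.\<close>

lemma initial_homotopy:
  fixes I :: "('v::finite, 'k::field) mpoly set"
  assumes I: "is_ideal I" and U: "graded_mat b' b U" and V: "graded_mat b b' V"
    and U_comp: "\<forall>w\<in>carrier_vec (length b). g \<bullet> w - g' \<bullet> (U *\<^sub>v w) \<in> I"
    and V_comp: "\<forall>w\<in>carrier_vec (length b'). g' \<bullet> w - g \<bullet> (V *\<^sub>v w) \<in> I"
    and \<phi>: "\<phi> \<in> carrier_mat (length b) (length bn)" and g: "g \<in> carrier_vec (length b)"
    and ker: "{v \<in> carrier_vec (length b). g \<bullet> v \<in> I} = (\<lambda>w. \<phi> *\<^sub>v w) ` carrier_vec (length bn)"
  shows "homotopic_id b bn \<phi> (V * U)"
proof -
  let ?n = "length b"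
  have Uc: "U \<in> carrier_mat (length b') ?n" and Vc: "V \<in> carrier_mat ?n (length b')"
    using U V by (auto simp: graded_mat_def)
  have VU: "V * U \<in> carrier_mat ?n ?n" using Uc Vc by simp
  have Z: "V * U - 1\<^sub>m ?n \<in> carrier_mat ?n ?n" by (rule minus_carrier_mat) simp
  have "\<exists>s\<in>carrier_mat (length bn) ?n. V * U - 1\<^sub>m ?n = \<phi> * s"
  proof (rule mat_lift[OF \<phi> Z])
    fix j assume j: "j < ?n"
    let ?e = "unit_vec ?n j"
    have e: "?e \<in> carrier_vec ?n" "U *\<^sub>v ?e \<in> carrier_vec (length b')" using Uc by auto
    have "(g \<bullet> ?e - g' \<bullet> (U *\<^sub>v ?e)) + (g' \<bullet> (U *\<^sub>v ?e) - g \<bullet> (V *\<^sub>v (U *\<^sub>v ?e))) \<in> I"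
      by (rule ideal_subspace_add[OF I]) (use U_comp V_comp e in blast)+
    then have "(- 1) * (g \<bullet> ?e - g \<bullet> (V *\<^sub>v (U *\<^sub>v ?e))) \<in> I"
      by (intro ideal_subspace_scale[OF I]) simp
    moreover have "V *\<^sub>v (U *\<^sub>v ?e) = (V * U) *\<^sub>v ?e" using Uc Vc e by simp
    moreover have "g \<bullet> ((V * U - 1\<^sub>m ?n) *\<^sub>v ?e) = g \<bullet> ((V * U) *\<^sub>v ?e) - g \<bullet> ?e"
    proof -
      have "(V * U - 1\<^sub>m ?n) *\<^sub>v ?e = (V * U) *\<^sub>v ?e - 1\<^sub>m ?n *\<^sub>v ?e"
        by (rule minus_mult_distrib_mat_vec[OF VU _ e(1)]) simp
      moreover have "(V * U) *\<^sub>v ?e \<in> carrier_vec ?n" using VU by (rule mult_mat_vec_carrier) simp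
      ultimately show ?thesis using scalar_prod_minus_distrib[OF g, of "(V * U) *\<^sub>v ?e" ?e] by simp
    qed
    ultimately have "g \<bullet> ((V * U - 1\<^sub>m ?n) *\<^sub>v ?e) \<in> I" by simp
    moreover have "(V * U - 1\<^sub>m ?n) *\<^sub>v ?e = col (V * U - 1\<^sub>m ?n) j"
      by (rule mult_unit_vec_eq_col[OF Z j])
    moreover have "col (V * U - 1\<^sub>m ?n) j \<in> carrier_vec ?n" by (intro carrier_vecI) simp
    ultimately show "col (V * U - 1\<^sub>m ?n) j \<in> (\<lambda>w. \<phi> *\<^sub>v w) ` carrier_vec (length bn)"
      using ker by auto
  qed
  then obtain s where s: "s \<in> carrier_mat (length bn) ?n" "V * U - 1\<^sub>m ?n = \<phi> * s" by blast
  have "V * U = 1\<^sub>m ?n + (V * U - 1\<^sub>m ?n) + 0\<^sub>m ?n ?n" using VU by (intro eq_matI) auto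
  then have "V * U = 1\<^sub>m ?n + \<phi> * s + 0\<^sub>m ?n ?n" unfolding s(2) .
  moreover have "0\<^sub>m ?n ?n * \<phi> = 0\<^sub>m ?n (length bn)" using \<phi> by simp
  moreover have "irr_mat (0\<^sub>m ?n ?n)" by (simp add: irr_mat_def)
  ultimately show ?thesis unfolding homotopic_id_def
    using s(1) by (intro bexI[of _ s] bexI[of _ "0\<^sub>m ?n ?n"]) auto
qed

lemma minimal_resolutionD:
  assumes "minimal_graded_free_resolution J I b g \<phi>"
  shows "g \<in> carrier_vec (length (b 0))"
    and "q < length (b 0) \<Longrightarrow> g $ q \<in> J \<and> homogeneous (b 0 ! q) (g $ q)"
    and "\<forall>h\<in>J. \<exists>v\<in>carrier_vec (length (b 0)). h - g \<bullet> v \<in> I"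
    and "{v \<in> carrier_vec (length (b 0)). g \<bullet> v \<in> I} = (\<lambda>w. \<phi> 0 *\<^sub>v w) ` carrier_vec (length (b 1))"
    and "graded_mat (b i) (b (Suc i)) (\<phi> i)"
    and "irr_mat (\<phi> i)"
    and "exact_at (\<phi> i) (\<phi> (Suc i)) (length (b i)) (length (b (Suc i))) (length (b (Suc (Suc i))))"
proof -
  note R = assms[unfolded minimal_graded_free_resolution_def]
  show "g \<in> carrier_vec (length (b 0))" using R by (elim conjE)
  have "\<forall>q<length (b 0). g $ q \<in> J \<and> homogeneous (b 0 ! q) (g $ q)" using R by (elim conjE)
  then show "q < length (b 0) \<Longrightarrow> g $ q \<in> J \<and> homogeneous (b 0 ! q) (g $ q)" by simp
  show "\<forall>h\<in>J. \<exists>v\<in>carrier_vec (length (b 0)). h - g \<bullet> v \<in> I" using R by (elim conjE)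
  show "{v \<in> carrier_vec (length (b 0)). g \<bullet> v \<in> I} = (\<lambda>w. \<phi> 0 *\<^sub>v w) ` carrier_vec (length (b 1))"
    using R by (elim conjE)
  have "\<forall>i. \<phi> i \<in> carrier_mat (length (b i)) (length (b (Suc i)))" using R by (elim conjE)
  then have \<phi>: "\<phi> i \<in> carrier_mat (length (b i)) (length (b (Suc i)))" for i by simp
  have h: "\<forall>i. \<forall>p<length (b i). \<forall>q<length (b (Suc i)). homogeneous (b (Suc i) ! q - b i ! p) (\<phi> i $$ (p, q))"
    using R by (elim conjE)
  have irr: "\<forall>i. \<forall>p<length (b i). \<forall>q<length (b (Suc i)). \<phi> i $$ (p, q) \<in> irrelevant_ideal"
    using R by (elim conjE)
  show "graded_mat (b i) (b (Suc i)) (\<phi> i)" using \<phi> h by (simp add: graded_mat_def)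
  show "irr_mat (\<phi> i)" using \<phi>[of i] irr by (auto simp: irr_mat_def irrelevant_iff)
  have "\<forall>i. {v \<in> carrier_vec (length (b (Suc i))). \<phi> i *\<^sub>v v = 0\<^sub>v (length (b i))} =
       (\<lambda>w. \<phi> (Suc i) *\<^sub>v w) ` carrier_vec (length (b (Suc (Suc i))))"
    using R by (elim conjE)
  then show "exact_at (\<phi> i) (\<phi> (Suc i)) (length (b i)) (length (b (Suc i))) (length (b (Suc (Suc i))))"
    using \<phi> by (simp add: exact_at_def)
qed

text \<open>Comparison maps in both directions are built degree by degree, along with homotopies
  from both composites to the identity; each multiplicity is then bounded by that of the other
  resolution.\<close>

lemma minimal_resolution_unique:
  assumes R: "minimal_graded_free_resolution J I b g \<phi>" and R': "minimal_graded_free_resolution J I b' g' \<phi>'"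
    and I: "is_ideal I" and I_hcomp: "\<And>k p. p \<in> I \<Longrightarrow> hcomp k p \<in> I"
  shows "mset (b i) = mset (b' i)"
proof -
  note D = minimal_resolutionD[OF R] and D' = minimal_resolutionD[OF R']
  have gr: "graded_mat (b i) (b (Suc i)) (\<phi> i)" "graded_mat (b' i) (b' (Suc i)) (\<phi>' i)" for i
    by (rule D D')+
  then have car: "\<phi> i \<in> carrier_mat (length (b i)) (length (b (Suc i)))"
    "\<phi>' i \<in> carrier_mat (length (b' i)) (length (b' (Suc i)))" for i by (auto simp: graded_mat_def)
  have "\<exists>U V. chain_lift (b i) (b' i) (b (Suc i)) (b' (Suc i)) (\<phi> i) (\<phi>' i) U \<and>
      chain_lift (b' i) (b i) (b' (Suc i)) (b (Suc i)) (\<phi>' i) (\<phi> i) V \<and>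
      homotopic_id (b i) (b (Suc i)) (\<phi> i) (V * U) \<and> homotopic_id (b' i) (b' (Suc i)) (\<phi>' i) (U * V)"
  proof (induction i)
    case 0
    obtain U where U: "graded_mat (b' 0) (b 0) U"
      "\<forall>w\<in>carrier_vec (length (b 0)). g \<bullet> w - g' \<bullet> (U *\<^sub>v w) \<in> I"
      using initial_lift[OF I I_hcomp D(1,2) D'(1) conjunct2[OF D'(2)] D'(3)] by blast
    obtain V where V: "graded_mat (b 0) (b' 0) V"
      "\<forall>w\<in>carrier_vec (length (b' 0)). g' \<bullet> w - g \<bullet> (V *\<^sub>v w) \<in> I"
      using initial_lift[OF I I_hcomp D'(1,2) D(1) conjunct2[OF D(2)] D(3)] by blast
    note c = car[of 0, folded One_nat_def]
    show ?case unfolding One_nat_def[symmetric]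
      using initial_chain_lift[OF I U c D(4) D'(4)] initial_chain_lift[OF I V c(2,1) D'(4) D(4)]
        initial_homotopy[OF I U(1) V(1) U(2) V(2) c(1) D(1) D(4)]
        initial_homotopy[OF I V(1) U(1) V(2) U(2) c(2) D'(1) D'(4)] by blast
  next
    case (Suc i)
    then obtain U V where U: "chain_lift (b i) (b' i) (b (Suc i)) (b' (Suc i)) (\<phi> i) (\<phi>' i) U"
      and V: "chain_lift (b' i) (b i) (b' (Suc i)) (b (Suc i)) (\<phi>' i) (\<phi> i) V"
      and VU: "homotopic_id (b i) (b (Suc i)) (\<phi> i) (V * U)"
      and UV: "homotopic_id (b' i) (b' (Suc i)) (\<phi>' i) (U * V)" by blast
    obtain U' where U': "U * \<phi> i = \<phi>' i * U'"
      "chain_lift (b (Suc i)) (b' (Suc i)) (b (Suc (Suc i))) (b' (Suc (Suc i))) (\<phi> (Suc i)) (\<phi>' (Suc i)) U'"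
      using chain_lift_step[OF gr D(7) D'(7) U] by blast
    obtain V' where V': "V * \<phi>' i = \<phi> i * V'"
      "chain_lift (b' (Suc i)) (b (Suc i)) (b' (Suc (Suc i))) (b (Suc (Suc i))) (\<phi>' (Suc i)) (\<phi> (Suc i)) V'"
      using chain_lift_step[OF gr(2,1) D'(7) D(7) V] by blast
    have c: "U \<in> carrier_mat (length (b' i)) (length (b i))" "V \<in> carrier_mat (length (b i)) (length (b' i))"
      "U' \<in> carrier_mat (length (b' (Suc i))) (length (b (Suc i)))"
      "V' \<in> carrier_mat (length (b (Suc i))) (length (b' (Suc i)))"
      using U V U'(2) V'(2) by (auto simp: chain_lift_def graded_mat_def)
    have e: "V * U * \<phi> i = \<phi> i * (V' * U')"
    proof -
      have "V * U * \<phi> i = V * (\<phi>' i * U')" using assoc_mult_mat[OF c(2,1) car(1)] U'(1) by simp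
      also have "\<dots> = \<phi> i * V' * U'" using assoc_mult_mat[OF c(2) car(2) c(3)] V'(1) by simp
      finally show ?thesis using assoc_mult_mat[OF car(1) c(4) c(3)] by simp
    qed
    have e': "U * V * \<phi>' i = \<phi>' i * (U' * V')"
    proof -
      have "U * V * \<phi>' i = U * (\<phi> i * V')" using assoc_mult_mat[OF c(1,2) car(2)] V'(1) by simp
      also have "\<dots> = \<phi>' i * U' * V'" using assoc_mult_mat[OF c(1) car(1) c(4)] U'(1) by simp
      finally show ?thesis using assoc_mult_mat[OF car(2) c(3) c(4)] by simp
    qed
    have "homotopic_id (b (Suc i)) (b (Suc (Suc i))) (\<phi> (Suc i)) (V' * U')"
      by (rule homotopy_step[OF car(1) D(6) D(7) VU _ e]) (use c in auto)
    moreover have "homotopic_id (b' (Suc i)) (b' (Suc (Suc i))) (\<phi>' (Suc i)) (U' * V')"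
      by (rule homotopy_step[OF car(2) D'(6) D'(7) UV _ e']) (use c in auto)
    ultimately show ?case using U' V' by blast
  qed
  then obtain U V where "chain_lift (b i) (b' i) (b (Suc i)) (b' (Suc i)) (\<phi> i) (\<phi>' i) U"
    "chain_lift (b' i) (b i) (b' (Suc i)) (b (Suc i)) (\<phi>' i) (\<phi> i) V" and
    h: "homotopic_id (b i) (b (Suc i)) (\<phi> i) (V * U)" "homotopic_id (b' i) (b' (Suc i)) (\<phi>' i) (U * V)" by blast
  then have UV: "graded_mat (b' i) (b i) U" "graded_mat (b i) (b' i) V" by (auto simp: chain_lift_def)
  show ?thesis
  proof (rule multiset_eqI)
    fix j
    show "count (mset (b i)) j = count (mset (b' i)) j"
      using graded_count_le[OF UV D(6) car(1) h(1), of j] graded_count_le[OF UV(2,1) D'(6) car(2) h(2), of j]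
      by simp
  qed
qed

lemma graded_betti_eq:
  assumes "has_minimal_resolution J I \<beta>" and "is_ideal I" and "\<And>k p. p \<in> I \<Longrightarrow> hcomp k p \<in> I"
  shows "graded_betti J I i j = count (\<beta> i) j"
  unfolding graded_betti_def
proof (rule the_equality)
  fix c assume "\<exists>\<beta>. has_minimal_resolution J I \<beta> \<and> c = count (\<beta> i) j"
  then obtain \<beta>' b' g' \<phi>' where 1: "minimal_graded_free_resolution J I b' g' \<phi>'" "\<forall>i. mset (b' i) = \<beta>' i"
    "c = count (\<beta>' i) j" by (auto simp: has_minimal_resolution_def)
  obtain b g \<phi> where 2: "minimal_graded_free_resolution J I b g \<phi>" "\<forall>i. mset (b i) = \<beta> i"
    using assms(1) by (auto simp: has_minimal_resolution_def)
  have "mset (b' i) = mset (b i)" by (rule minimal_resolution_unique[OF 1(1) 2(1) assms(2,3)])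
  then show "c = count (\<beta> i) j" using 1 2 by simp
qed (use assms in blast)

section \<open>Depth and Krull dimension\<close>

lemma prime_idealD:
  assumes "is_prime_ideal P"
  shows "is_ideal P" "P \<noteq> UNIV" "a * b \<in> P \<Longrightarrow> a \<in> P \<or> b \<in> P" "1 \<notin> P"
proof -
  show I: "is_ideal P" and U: "P \<noteq> UNIV" and "a * b \<in> P \<Longrightarrow> a \<in> P \<or> b \<in> P"
    using assms unfolding is_prime_ideal_def by blast+
  show "1 \<notin> P"
  proof
    assume "1 \<in> P"
    then have "x * 1 \<in> P" for x by (rule ideal_subspace_scale[OF I])
    then show False using U by auto
  qed
qed

lemma prime_ideal_power: "is_prime_ideal P \<Longrightarrow> x ^ n \<in> P \<Longrightarrow> x \<in> P"
proof (induction n)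
  case 0
  then show ?case using prime_idealD(4) by auto
next
  case (Suc n)
  then show ?case using prime_idealD(3)[of P x "x ^ n"] by auto
qed

lemma prime_ideal_prod:
  assumes "is_prime_ideal P" "prod g T \<in> P"
  shows "\<exists>i\<in>T. g i \<in> P"
  using assms(2)
proof (induction T rule: infinite_finite_induct)
  case (insert x T)
  then show ?case using prime_idealD(3)[OF assms(1), of "g x" "prod g T"] by auto
qed (use prime_idealD(4)[OF assms(1)] in auto)

text \<open>Zorn's lemma gives an ideal maximal among those containing \<open>J\<close> and avoiding
  \<open>T\<close>. Adjoining an outside element makes it meet \<open>T\<close>; multiplying two
  such elements of \<open>T\<close> shows that a product of outside elements stays outside.\<close>

lemma exists_prime_avoiding:
  fixes J T :: "'r::comm_ring_1 set"
  assumes J: "is_ideal J" and T1: "1 \<in> T" and Tm: "\<And>a b. a \<in> T \<Longrightarrow> b \<in> T \<Longrightarrow> a * b \<in> T"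
    and JT: "J \<inter> T = {}"
  shows "\<exists>Q. is_prime_ideal Q \<and> J \<subseteq> Q \<and> Q \<inter> T = {}"
proof -
  define C where "C = {Q. is_ideal Q \<and> J \<subseteq> Q \<and> Q \<inter> T = {}}"
  have "\<exists>M\<in>C. \<forall>X\<in>C. M \<subseteq> X \<longrightarrow> X = M"
  proof (rule subset_Zorn_nonempty)
    show "C \<noteq> {}" using J JT by (auto simp: C_def)
    fix D assume D: "D \<noteq> {}" "subset.chain C D"
    have I: "is_ideal Q" if "Q \<in> D" for Q using D(2) that by (auto simp: subset.chain_def C_def)
    have "is_ideal (\<Union>D)"
    proof (rule Modules.module.subspaceI[OF module_mult])
      obtain Q where Q: "Q \<in> D" using D(1) by blast
      show "0 \<in> \<Union>D" using ideal_subspace_0[OF I[OF Q]] Q by blast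
      show "c * x \<in> \<Union>D" if x: "x \<in> \<Union>D" for c x
      proof -
        obtain X where X: "X \<in> D" "x \<in> X" using x by blast
        then show ?thesis using ideal_subspace_scale[OF I[OF X(1)] X(2)] by blast
      qed
      fix x y assume "x \<in> \<Union>D" "y \<in> \<Union>D"
      then obtain X Y where XY: "X \<in> D" "x \<in> X" "Y \<in> D" "y \<in> Y" by blast
      then have "X \<subseteq> Y \<or> Y \<subseteq> X" using D(2) by (auto simp: subset.chain_def)
      then obtain Z where Z: "Z \<in> D" "x \<in> Z" "y \<in> Z" using XY by blast
      then show "x + y \<in> \<Union>D" using ideal_subspace_add[OF I[OF Z(1)] Z(2,3)] by blast
    qed
    then show "\<Union>D \<in> C" using D by (auto simp: C_def subset.chain_def)
  qed
  then obtain M where M: "M \<in> C" and max: "\<And>X. X \<in> C \<Longrightarrow> M \<subseteq> X \<Longrightarrow> X = M" by blast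
  have IM: "is_ideal M" and JM: "J \<subseteq> M" and MT: "M \<inter> T = {}" using M by (auto simp: C_def)
  have meets: "\<exists>r. \<exists>p\<in>M. p + r * a \<in> T" if "a \<notin> M" for a
  proof (rule ccontr)
    assume no: "\<not> ?thesis"
    have sub: "M \<subseteq> ideal_generated (insert a M)" using ideal_span_superset by blast
    have "ideal_generated (insert a M) \<inter> T = {}"
    proof (rule ccontr)
      assume "ideal_generated (insert a M) \<inter> T \<noteq> {}"
      then obtain t where t: "t \<in> ideal_generated (insert a M)" "t \<in> T" by blast
      then obtain r where "t - r * a \<in> ideal_generated M" by (auto simp: ideal_span_breakdown_eq)
      then have "t - r * a \<in> M" using ideal_span_minimal[OF order_refl IM] by blast
      moreover have "(t - r * a) + r * a \<in> T" using t(2) by simp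
      ultimately show False using no by blast
    qed
    then have "ideal_generated (insert a M) \<in> C"
      using JM sub ideal_subspace_span by (auto simp: C_def)
    from max[OF this sub] have "a \<in> M" using ideal_span_base[of a "insert a M"] by simp
    then show False using that by simp
  qed
  have "is_prime_ideal M" unfolding is_prime_ideal_def
  proof (intro conjI allI impI)
    show "M \<noteq> UNIV" using MT T1 by auto
    fix a b assume ab: "a * b \<in> M"
    show "a \<in> M \<or> b \<in> M"
    proof (rule ccontr)
      assume "\<not> (a \<in> M \<or> b \<in> M)"
      then obtain r p s q where rp: "p \<in> M" "p + r * a \<in> T" and sq: "q \<in> M" "q + s * b \<in> T"
        using meets by meson
      have "(p + r * a) * (q + s * b) = (q + s * b) * p + (r * a) * q + (r * s) * (a * b)"
        by (simp add: algebra_simps)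
      moreover have "\<dots> \<in> M"
        by (intro ideal_subspace_add[OF IM]) (rule ideal_subspace_scale[OF IM], rule ab rp sq)+
      ultimately show False using Tm[OF rp(2) sq(2)] MT by auto
    qed
  qed (rule IM)
  then show ?thesis using JM MT by blast
qed

text \<open>A nonzerodivisor modulo \<open>J\<close> cannot lie in a prime that is minimal over \<open>J\<close>.\<close>

lemma exists_smaller_prime:
  fixes J P :: "'r::comm_ring_1 set"
  assumes P: "is_prime_ideal P" and J: "is_ideal J" "J \<subseteq> P" and x: "x \<in> P"
    and nzd: "\<And>g. x * g \<in> J \<Longrightarrow> g \<in> J"
  shows "\<exists>Q. is_prime_ideal Q \<and> J \<subseteq> Q \<and> Q \<subset> P"
proof -
  \<comment> \<open>A prime avoiding this multiplicative set is contained in \<open>P\<close> and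
    omits \<open>x\<close>. As \<open>x\<close> is a nonzerodivisor modulo \<open>J\<close>, the set
    does not meet \<open>J\<close>.\<close>
  define T where "T = {s * x ^ n | s n. s \<notin> P}"
  have TI: "s \<notin> P \<Longrightarrow> s * x ^ n \<in> T" for s n by (auto simp: T_def)
  have nzdn: "s * x ^ n \<in> J \<Longrightarrow> s \<in> J" for s n
    by (induction n) (use nzd in \<open>auto simp: mult.left_commute\<close>)
  have "\<exists>Q. is_prime_ideal Q \<and> J \<subseteq> Q \<and> Q \<inter> T = {}"
  proof (rule exists_prime_avoiding[OF J(1)])
    show "1 \<in> T" using TI[of 1 0] prime_idealD(4)[OF P] by simp
    fix a b assume "a \<in> T" "b \<in> T"
    then obtain s n t k where st: "a = s * x ^ n" "s \<notin> P" "b = t * x ^ k" "t \<notin> P" by (auto simp: T_def)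
    then have "s * t \<notin> P" using prime_idealD(3)[OF P] by blast
    moreover have "a * b = (s * t) * x ^ (n + k)" by (simp add: st power_add ac_simps)
    ultimately show "a * b \<in> T" using TI by metis
  next
    show "J \<inter> T = {}" using nzdn J(2) by (auto simp: T_def)
  qed
  then obtain Q where Q: "is_prime_ideal Q" "J \<subseteq> Q" "Q \<inter> T = {}" by blast
  have "s \<in> P" if "s \<in> Q" for s using TI[of s 0] Q(3) that by auto
  moreover have "x \<notin> Q" using TI[of 1 1] Q(3) prime_idealD(4)[OF P] by auto
  ultimately show ?thesis using Q x by blast
qed

text \<open>The chain grows downwards from a prime over the full ideal. The last element of the
  sequence is a nonzerodivisor modulo the earlier ones, so dropping it makes room for a strictly
  smaller prime; \<open>j\<close> counts the dropped elements.\<close>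

lemma regular_sequence_prime_chain:
  fixes I :: "'r::comm_ring_1 set"
  assumes reg: "regular_sequence_quot I xs" and "j \<le> length xs"
  shows "\<exists>P :: nat \<Rightarrow> 'r set. (\<forall>i\<le>j. is_prime_ideal (P i) \<and> ideal_generated (I \<union> set (take (length xs - j) xs)) \<subseteq> P i) \<and>
    (\<forall>i<j. P i \<subset> P (Suc i))"
  using assms(2)
proof (induction j)
  case 0
  let ?J = "ideal_generated (I \<union> set xs)"
  have "1 \<notin> ?J"
  proof
    assume 1: "1 \<in> ?J"
    have "x * 1 \<in> ?J" for x by (rule ideal_span_scale[OF 1])
    then show False using reg by (auto simp: regular_sequence_quot_def)
  qed
  then have "\<exists>Q. is_prime_ideal Q \<and> ?J \<subseteq> Q \<and> Q \<inter> {1} = {}"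
    by (intro exists_prime_avoiding ideal_subspace_span) auto
  then obtain Q where "is_prime_ideal Q" "?J \<subseteq> Q" by blast
  then show ?case by (intro exI[of _ "\<lambda>_. Q"]) simp
next
  case (Suc j)
  let ?t = "length xs - Suc j"
  let ?J = "\<lambda>t. ideal_generated (I \<union> set (take t xs))"
  have t: "length xs - j = Suc ?t" "?t < length xs" using Suc.prems by auto
  obtain P where P: "\<And>i. i \<le> j \<Longrightarrow> is_prime_ideal (P i) \<and> ?J (Suc ?t) \<subseteq> P i"
    "\<And>i. i < j \<Longrightarrow> P i \<subset> P (Suc i)" using Suc.IH Suc.prems unfolding t(1) by auto
  have sub: "?J ?t \<subseteq> ?J (Suc ?t)"
    by (intro ideal_span_mono) (auto simp: take_Suc_conv_app_nth[OF t(2)])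
  have "xs ! ?t \<in> ?J (Suc ?t)"
    by (intro ideal_span_base) (simp add: take_Suc_conv_app_nth[OF t(2)])
  then have "\<exists>Q. is_prime_ideal Q \<and> ?J ?t \<subseteq> Q \<and> Q \<subset> P 0"
    using P(1)[of 0] sub reg t(2)
    by (intro exists_smaller_prime[of _ _ "xs ! ?t"] ideal_subspace_span)
      (auto simp: regular_sequence_quot_def)
  then obtain Q where Q: "is_prime_ideal Q" "?J ?t \<subseteq> Q" "Q \<subset> P 0" by blast
  have "is_prime_ideal (case_nat Q P i) \<and> ?J ?t \<subseteq> case_nat Q P i" if "i \<le> Suc j" for i
  proof (cases i)
    case (Suc i')
    then show ?thesis using P(1)[of i'] sub that by auto
  qed (use Q in simp)
  moreover have "case_nat Q P i \<subset> case_nat Q P (Suc i)" if "i < Suc j" for i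
  proof (cases i)
    case (Suc i')
    then show ?thesis using P(2)[of i'] that by simp
  qed (use Q in simp)
  ultimately show ?case by (intro exI[of _ "case_nat Q P"]) blast
qed

lemma depth_le_krull_dim: "depth_quot I \<le> krull_dim_quot I"
  unfolding depth_quot_def
proof (rule Sup_least)
  fix x assume "x \<in> {enat (length xs) | xs. set xs \<subseteq> irrelevant_ideal \<and> regular_sequence_quot I xs}"
  then obtain xs where x: "x = enat (length xs)" "regular_sequence_quot I xs" by blast
  obtain P where P: "\<forall>i\<le>length xs. is_prime_ideal (P i) \<and> ideal_generated (I \<union> set (take (length xs - length xs) xs)) \<subseteq> P i"
    "\<forall>i<length xs. P i \<subset> P (Suc i)"
    using regular_sequence_prime_chain[OF x(2) order_refl] by blast
  have "I \<subseteq> ideal_generated (I \<union> set (take (length xs - length xs) xs))"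
    using ideal_span_superset by fastforce
  then have "\<forall>i\<le>length xs. is_prime_ideal (P i) \<and> I \<subseteq> P i" using P by blast
  then show "x \<le> krull_dim_quot I"
    unfolding krull_dim_quot_def x(1) using P(2) by (intro Sup_upper) blast
qed

section \<open>Upper bound on the length of prime chains\<close>

fun chain_monomial :: "(nat \<Rightarrow> 'r::comm_ring_1) \<Rightarrow> nat list \<Rightarrow> nat \<Rightarrow> 'r" where
  "chain_monomial x [] i = 1"
| "chain_monomial x (e # es) i = x i ^ e * chain_monomial x es (Suc i)"

abbreviation exps :: "nat \<Rightarrow> nat \<Rightarrow> nat list set" where
  "exps M r \<equiv> {es. set es \<subseteq> {..M} \<and> length es = r}"

lemma finite_exps: "finite (exps M r)"
  using finite_lists_length_eq[of "{..M}" r] by simp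

lemma sum_exps_Suc:
  fixes h :: "nat list \<Rightarrow> 'r::comm_monoid_add"
  shows "(\<Sum>es\<in>exps M (Suc r). h es) = (\<Sum>j\<le>M. \<Sum>es\<in>exps M r. h (j # es))"
proof -
  have "(\<Sum>es\<in>exps M (Suc r). h es) = (\<Sum>(j, es)\<in>{..M} \<times> exps M r. h (j # es))"
    by (rule sum.reindex_bij_witness[of _ "\<lambda>(j, es). j # es" "\<lambda>es. (hd es, tl es)"])
      (auto simp: length_Suc_conv)
  then show ?thesis by (simp add: sum.cartesian_product)
qed

text \<open>A strict chain of primes yields elements that satisfy no algebraic relation modulo its first member:
  look at the terms of lowest degree in the first element.\<close>

lemma chain_independent:
  fixes P :: "nat \<Rightarrow> ('v::finite, 'k::field) mpoly set"
  assumes "\<And>t. i \<le> t \<Longrightarrow> t \<le> i + r \<Longrightarrow> is_prime_ideal (P t)"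
    and "\<And>t. i \<le> t \<Longrightarrow> t < i + r \<Longrightarrow> P t \<subseteq> P (Suc t) \<and> x t \<in> P (Suc t) \<and> x t \<notin> P t"
    and "(\<Sum>es\<in>exps M r. Const (c es) * chain_monomial x es i) \<in> P i"
    and "es \<in> exps M r"
  shows "c es = 0"
  using assms
proof (induction r arbitrary: i c es)
  case 0
  then have es: "es = []" and C: "Const (c []) \<in> P i"
    by (auto simp: conj_commute cong: conj_cong)
  show ?case
  proof (rule ccontr)
    assume "c es \<noteq> 0"
    then have "Const (inverse (c [])) * Const (c []) = (1 :: ('v, 'k) mpoly)"
      using Const_inverse[of "c []"] es by (simp add: mult.commute)
    moreover have pr: "is_prime_ideal (P i)" using 0 by auto
    ultimately show False
      using ideal_subspace_scale[OF prime_idealD(1)[OF pr] C, of "Const (inverse (c []))"] prime_idealD(4)[OF pr] by simp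
  qed
next
  case (Suc r)
  define Fj where "Fj j = (\<Sum>es\<in>exps M r. Const (c (j # es)) * chain_monomial x es (Suc i))" for j
  have pr: "is_prime_ideal (P i)" "is_prime_ideal (P (Suc i))" using Suc.prems(1) by auto
  note I = prime_idealD(1)[OF pr(1)] and I' = prime_idealD(1)[OF pr(2)]
  have x: "P i \<subseteq> P (Suc i)" "x i \<in> P (Suc i)" "x i \<notin> P i" using Suc.prems(2)[of i] by auto
  have "(\<Sum>es\<in>exps M (Suc r). Const (c es) * chain_monomial x es i) = (\<Sum>j\<le>M. x i ^ j * Fj j)"
    unfolding sum_exps_Suc Fj_def sum_distrib_left
    by (intro sum.cong refl) (simp add: ac_simps)
  then have S: "(\<Sum>j\<le>M. x i ^ j * Fj j) \<in> P i" using Suc.prems(3) by simp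
  have "\<forall>es\<in>exps M r. c (j # es) = 0" if "j \<le> M" for j
    using that
  proof (induction j rule: less_induct)
    case (less j)
    have F0: "Fj j' = 0" if "j' < j" for j'
      unfolding Fj_def using less.IH[OF that] that less.prems by (intro sum.neutral) auto
    have "(\<Sum>j'\<le>M. x i ^ j' * Fj j') = (\<Sum>j'\<in>{j..M}. x i ^ j' * Fj j')"
      by (rule sum.mono_neutral_right) (auto simp: F0)
    also have "\<dots> = x i ^ j * (\<Sum>j'\<in>{j..M}. x i ^ (j' - j) * Fj j')"
      unfolding sum_distrib_left by (intro sum.cong refl) (simp add: mult.assoc[symmetric] flip: power_add)
    \<comment> \<open>The power of \<open>x i\<close> cancels because \<open>x i\<close> is outside
      the prime \<open>P i\<close>; modulo \<open>P (Suc i)\<close>, which contains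
      \<open>x i\<close>, only the coefficient \<open>Fj j\<close> remains.\<close>
    finally have "x i ^ j * (\<Sum>j'\<in>{j..M}. x i ^ (j' - j) * Fj j') \<in> P i" using S by simp
    then have "(\<Sum>j'\<in>{j..M}. x i ^ (j' - j) * Fj j') \<in> P i"
      using prime_idealD(3)[OF pr(1)] prime_ideal_power[OF pr(1)] x(3) by blast
    then have "(\<Sum>j'\<in>{j..M}. x i ^ (j' - j) * Fj j') \<in> P (Suc i)" using x(1) by blast
    moreover have "(\<Sum>j'\<in>{j<..M}. x i ^ (j' - j) * Fj j') \<in> P (Suc i)"
    proof (rule ideal_subspace_sum[OF I'])
      fix j' assume "j' \<in> {j<..M}"
      then have "x i ^ (j' - j) = x i ^ (j' - j - 1) * x i"
        by (metis Suc_diff_1 greaterThanAtMost_iff power_Suc2 zero_less_diff)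
      then have "x i ^ (j' - j) * Fj j' = (x i ^ (j' - j - 1) * Fj j') * x i" by (simp add: ac_simps)
      then show "x i ^ (j' - j) * Fj j' \<in> P (Suc i)" using ideal_subspace_scale[OF I' x(2)] by metis
    qed
    moreover have "(\<Sum>j'\<in>{j..M}. x i ^ (j' - j) * Fj j') = Fj j + (\<Sum>j'\<in>{j<..M}. x i ^ (j' - j) * Fj j')"
      using less.prems by (subst sum.head) auto
    ultimately have "Fj j + (\<Sum>j'\<in>{j<..M}. x i ^ (j' - j) * Fj j') - (\<Sum>j'\<in>{j<..M}. x i ^ (j' - j) * Fj j') \<in> P (Suc i)"
      by (metis (no_types, lifting) ideal_subspace_diff[OF I'])
    then have Fj: "Fj j \<in> P (Suc i)" by (simp only: add_diff_cancel_right')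
    show ?case
    proof
      fix es assume es: "es \<in> exps M r"
      show "c (j # es) = 0"
        by (rule Suc.IH[of "Suc i" "\<lambda>es. c (j # es)" es, OF _ _ Fj[unfolded Fj_def] es])
          (use Suc.prems(1,2) in auto)
    qed
  qed
  moreover obtain j es' where "es = j # es'" "j \<le> M" "es' \<in> exps M r"
    using Suc.prems(4) by (auto simp: length_Suc_conv)
  ultimately show ?case by blast
qed

lemma minors_vanish_imp:
  fixes a b :: "'v::finite \<Rightarrow> 'k::field"
  assumes "\<And>u w. a u * b w = a w * b u"
  shows "dot a x * dot b y = dot a y * dot b x"
proof -
  have "dot a x * dot b y = (\<Sum>u\<in>UNIV. \<Sum>w\<in>UNIV. (a u * b w) * (x u * y w))"
    unfolding dot_def sum_product by (intro sum.cong refl) (simp add: ac_simps)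
  also have "\<dots> = (\<Sum>u\<in>UNIV. \<Sum>w\<in>UNIV. (a w * y w) * (b u * x u))"
    by (intro sum.cong refl) (simp add: assms ac_simps)
  also have "\<dots> = (\<Sum>w\<in>UNIV. \<Sum>u\<in>UNIV. (a w * y w) * (b u * x u))" by (rule sum.swap)
  also have "\<dots> = dot a y * dot b x" unfolding dot_def sum_product ..
  finally show ?thesis .
qed

lemma exists_minor:
  fixes a b :: "'v::finite \<Rightarrow> 'k::field"
  assumes "\<not> hyperplane a \<subseteq> hyperplane b" "a \<noteq> (\<lambda>_. 0)"
  shows "\<exists>u w. a u * b w - a w * b u \<noteq> 0"
proof (rule ccontr)
  assume "\<not> ?thesis"
  then have m: "a u * b w = a w * b u" for u w by auto
  obtain v where v: "a v \<noteq> 0" using assms(2) by blast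
  obtain x where "x \<in> hyperplane a" "x \<notin> hyperplane b" using assms(1) by blast
  then have x: "dot a x = 0" "dot b x \<noteq> 0" by (simp_all add: hyperplane_iff)
  show False using minors_vanish_imp[of a b x "vec_unit v", OF m] x v by simp
qed

lemma card_monomials_le:
  fixes T :: "'v::finite set"
  shows "finite {m :: 'v \<Rightarrow>\<^sub>0 nat. (\<forall>v. v \<notin> T \<longrightarrow> coeff_of m v = 0) \<and> mon_degree m \<le> K} \<and>
    card {m :: 'v \<Rightarrow>\<^sub>0 nat. (\<forall>v. v \<notin> T \<longrightarrow> coeff_of m v = 0) \<and> mon_degree m \<le> K} \<le> (K + 1) ^ card T"
proof -
  let ?S = "{m :: 'v \<Rightarrow>\<^sub>0 nat. (\<forall>v. v \<notin> T \<longrightarrow> coeff_of m v = 0) \<and> mon_degree m \<le> K}"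
  let ?r = "\<lambda>m :: 'v \<Rightarrow>\<^sub>0 nat. restrict (coeff_of m) T"
  have inj: "inj_on ?r ?S"
  proof (rule inj_onI, rule poly_mapping_eqI)
    fix m m' v assume "m \<in> ?S" "m' \<in> ?S" "?r m = ?r m'"
    then show "coeff_of m v = coeff_of m' v" by (cases "v \<in> T") (auto dest: fun_cong[of _ _ v])
  qed
  have le: "coeff_of m v \<le> mon_degree m" for m :: "'v \<Rightarrow>\<^sub>0 nat" and v
    unfolding mon_degree_def by (rule member_le_sum) auto
  then have im: "?r ` ?S \<subseteq> (\<Pi>\<^sub>E v\<in>T. {..K})" by (auto intro!: order_trans[OF le])
  have fin: "finite (\<Pi>\<^sub>E v\<in>T. {..K})" by (intro finite_PiE) auto
  have "card ?S \<le> card (\<Pi>\<^sub>E v\<in>T. {..K})" by (rule card_inj_on_le[OF inj im fin])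
  then show ?thesis using finite_imageD[OF finite_subset[OF im fin] inj] by (simp add: card_PiE)
qed

definition deg_bdd :: "'v set \<Rightarrow> nat \<Rightarrow> ('v::finite, 'k::field) mpoly \<Rightarrow> bool" where
  "deg_bdd T D p \<longleftrightarrow> (\<forall>m\<in>Poly_Mapping.keys p. (\<forall>v. v \<notin> T \<longrightarrow> coeff_of m v = 0) \<and> mon_degree m \<le> D)"

lemma deg_bdd_mono: "deg_bdd T D p \<Longrightarrow> D \<le> E \<Longrightarrow> deg_bdd T E p"
  by (auto simp: deg_bdd_def intro: order_trans)

lemma deg_bdd_add: "deg_bdd T D p \<Longrightarrow> deg_bdd T D q \<Longrightarrow> deg_bdd T D (p + q)"
  using keys_add[of p q] by (auto simp: deg_bdd_def)

lemma deg_bdd_sum: "(\<And>i. i \<in> X \<Longrightarrow> deg_bdd T D (g i)) \<Longrightarrow> deg_bdd T D (sum g X)"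
  by (induction X rule: infinite_finite_induct) (simp_all add: deg_bdd_add, simp_all add: deg_bdd_def)

lemma deg_bdd_mult:
  assumes "deg_bdd T D p" "deg_bdd T E q" shows "deg_bdd T (D + E) (p * q)"
  unfolding deg_bdd_def
proof
  fix m assume "m \<in> Poly_Mapping.keys (p * q)"
  then obtain a b where "m = a + b" "a \<in> Poly_Mapping.keys p" "b \<in> Poly_Mapping.keys q"
    using keys_mult[of p q] by blast
  then show "(\<forall>v. v \<notin> T \<longrightarrow> coeff_of m v = 0) \<and> mon_degree m \<le> D + E"
    using assms by (auto simp: deg_bdd_def mon_degree_add lookup_add intro!: add_mono)
qed

lemma deg_bdd_Const: "deg_bdd T 0 (Const c)"
  by (auto simp: deg_bdd_def Const_def)

lemma deg_bdd_Var: "v \<in> T \<Longrightarrow> deg_bdd T 1 (Var v)"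
  by (auto simp: deg_bdd_def Var_def lookup_single when_def)

lemma deg_bdd_power: "deg_bdd T D p \<Longrightarrow> deg_bdd T (D * n) (p ^ n)"
proof (induction n)
  case (Suc n)
  then show ?case using deg_bdd_mult[of T D p "D * n" "p ^ n"] by simp
qed (use deg_bdd_Const[of T 1] in simp)

lemma deg_bdd_chain_monomial:
  assumes "\<And>t. i \<le> t \<Longrightarrow> t < i + length es \<Longrightarrow> deg_bdd T D (x t)"
  shows "deg_bdd T (D * sum_list es) (chain_monomial x es i)"
  using assms
proof (induction es arbitrary: i)
  case Nil
  then show ?case using deg_bdd_Const[of T 1] by simp
next
  case (Cons e es)
  have "deg_bdd T (D * e + D * sum_list es) (x i ^ e * chain_monomial x es (Suc i))"
    by (intro deg_bdd_mult deg_bdd_power Cons.IH) (use Cons.prems in auto)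
  then show ?case by (simp add: distrib_left)
qed

lemma subst_chain_monomial:
  "subst.ev \<sigma> (chain_monomial x es i) = chain_monomial (\<lambda>t. subst.ev \<sigma> (x t)) es i"
  by (induction es arbitrary: i) (simp_all add: subst.ev_mult subst.ev_power)

lemma lookup_Const_mult: "coeff_of (Const c * p) m = c * coeff_of p m"
proof (induction p rule: mpoly_induct_monomials)
  case (mterm n a)
  show ?case by (simp add: Const_def mult_single lookup_single when_def)
qed (simp add: distrib_left lookup_add)

text \<open>Two independent linear forms in \<open>P 0\<close> eliminate the variables
  \<open>u\<close> and \<open>w\<close>, leaving \<open>CARD('v) - 2\<close> of them modulo
  \<open>P 0\<close>. A longer chain would give \<open>r = CARD('v) - 1\<close> elements without
  algebraic relation modulo \<open>P 0\<close>, but their products with bounded exponents outnumber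
  the monomials available in the remaining variables.\<close>

lemma prime_chain_bound:
  fixes P :: "nat \<Rightarrow> ('v::finite, 'k::field_char_0) mpoly set"
  assumes minor: "a u * b w - a w * b u \<noteq> 0" 
    and ab: "linear_form a \<in> P 0" "linear_form b \<in> P 0"
    and P: "\<And>i. i \<le> j \<Longrightarrow> is_prime_ideal (P i)" "\<And>i. i < j \<Longrightarrow> P i \<subset> P (Suc i)"
  shows "j \<le> CARD('v) - 2"
proof (rule ccontr)
  assume j: "\<not> j \<le> CARD('v) - 2"
  have uw: "u \<noteq> w" using minor by auto
  then have "card {u, w} \<le> CARD('v)" by (intro card_mono) auto
  then have card2: "CARD('v) \<ge> 2" using uw by simp
  define r where "r = CARD('v) - 1"
  have rj: "r \<le> j" "r \<ge> 1" using j card2 by (auto simp: r_def)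
  define T where "T = UNIV - {u, w}"
  have cardT: "card T = r - 1" using uw by (simp add: T_def r_def card_Diff_subset)
  have "\<forall>i. \<exists>x. i < j \<longrightarrow> x \<in> P (Suc i) \<and> x \<notin> P i" using P(2) by blast
  then obtain x where x: "\<And>i. i < j \<Longrightarrow> x i \<in> P (Suc i) \<and> x i \<notin> P i" by metis
  define \<Delta> where "\<Delta> = a u * b w - a w * b u"
  have \<Delta>: "\<Delta> \<noteq> 0" using minor by (simp add: \<Delta>_def)
  \<comment> \<open>Cramer's rule: \<open>\<alpha>\<close> and \<open>\<beta>\<close> are the
    combinations of \<open>a\<close> and \<open>b\<close> whose coefficients at \<open>u\<close> and
    \<open>w\<close> are \<open>(1, 0)\<close> and \<open>(0, 1)\<close>.\<close>
  define \<alpha> where "\<alpha> v = (b w / \<Delta>) * a v + (- a w / \<Delta>) * b v" for v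
  define \<beta> where "\<beta> v = (- b u / \<Delta>) * a v + (a u / \<Delta>) * b v" for v
  have \<alpha>\<beta>: "\<alpha> u = 1" "\<alpha> w = 0" "\<beta> u = 0" "\<beta> w = 1"
  proof -
    have "\<alpha> v = (b w * a v - a w * b v) / \<Delta>" "\<beta> v = (a u * b v - b u * a v) / \<Delta>" for v
      by (simp_all add: \<alpha>_def \<beta>_def diff_divide_distrib)
    moreover have "b w * a u - a w * b u = \<Delta>" "a u * b w - b u * a w = \<Delta>" by (simp_all add: \<Delta>_def)
    ultimately show "\<alpha> u = 1" "\<alpha> w = 0" "\<beta> u = 0" "\<beta> w = 1" using \<Delta> by simp_all
  qed
  note pr = P(1)[of 0, simplified]
  note I = prime_idealD(1)[OF pr]
  have lin: "linear_form \<alpha> \<in> P 0" "linear_form \<beta> \<in> P 0"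
    unfolding \<alpha>_def[abs_def] \<beta>_def[abs_def] linear_form_combination
    by (intro ideal_subspace_add[OF I] ideal_subspace_scale[OF I] ab)+
  define \<sigma> where "\<sigma> v = (if v = u then (\<Sum>t\<in>T. Const (- \<alpha> t) * Var t)
      else if v = w then (\<Sum>t\<in>T. Const (- \<beta> t) * Var t) else Var v)" for v
  have split: "dot c y = c u * y u + (c w * y w + (\<Sum>t\<in>T. c t * y t))" for c y :: "'v \<Rightarrow> 'k"
  proof -
    have "dot c y = c u * y u + (\<Sum>t\<in>UNIV - {u}. c t * y t)"
      unfolding dot_def by (rule sum.remove) auto
    also have "(\<Sum>t\<in>UNIV - {u}. c t * y t) = c w * y w + (\<Sum>t\<in>UNIV - {u} - {w}. c t * y t)"
      by (rule sum.remove) (use uw in auto)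
    also have "UNIV - {u} - {w} = T" by (auto simp: T_def)
    finally show ?thesis .
  qed
  have "Var v - \<sigma> v \<in> P 0" for v
  proof -
    have "Var u - \<sigma> u = linear_form \<alpha>"
      by (rule eval_eqI) (simp add: \<sigma>_def split[of \<alpha>] \<alpha>\<beta> sum_negf)
    moreover have "Var w - \<sigma> w = linear_form \<beta>"
      using uw by (intro eval_eqI) (simp add: \<sigma>_def split[of \<beta>] \<alpha>\<beta> sum_negf)
    moreover have "Var v - \<sigma> v = 0" if "v \<noteq> u" "v \<noteq> w" using that by (simp add: \<sigma>_def)
    ultimately show ?thesis using lin ideal_subspace_0[OF I] by (cases "v = u"; cases "v = w") auto
  qed
  then have diff: "p - subst.ev \<sigma> p \<in> P 0" for p by (rule diff_subst_in_ideal[OF I])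
  have \<sigma>_bdd: "deg_bdd T 1 (\<sigma> v)" for v
  proof -
    have "deg_bdd T (0 + 1) (Const c * Var t)" if "t \<in> T" for t and c :: 'k
      by (intro deg_bdd_mult deg_bdd_Const deg_bdd_Var that)
    then have "deg_bdd T 1 (\<Sum>t\<in>T. Const (c t) * Var t)" for c :: "'v \<Rightarrow> 'k"
      by (intro deg_bdd_sum) simp
    moreover have "deg_bdd T 1 (Var v :: ('v, 'k) mpoly)" if "v \<noteq> u" "v \<noteq> w"
      by (rule deg_bdd_Var) (simp add: T_def that)
    ultimately show ?thesis unfolding \<sigma>_def by (simp split: if_split)
  qed
  have ex_bdd: "\<exists>D. deg_bdd T D (subst.ev \<sigma> p)" for p
  proof (induction p rule: mpoly_induct)
    case (add p q)
    then obtain D E where "deg_bdd T D (subst.ev \<sigma> p)" "deg_bdd T E (subst.ev \<sigma> q)" by blast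
    then have "deg_bdd T (max D E) (subst.ev \<sigma> p + subst.ev \<sigma> q)"
      by (intro deg_bdd_add; elim deg_bdd_mono) simp_all
    then show ?case by (auto simp: subst.ev_add)
  next
    case (mult p q)
    then obtain D E where "deg_bdd T D (subst.ev \<sigma> p)" "deg_bdd T E (subst.ev \<sigma> q)" by blast
    from deg_bdd_mult[OF this] show ?case unfolding subst.ev_mult by blast
  qed (use \<sigma>_bdd deg_bdd_Const in auto)
  have "\<exists>D. \<forall>i<r'. deg_bdd T D (subst.ev \<sigma> (x i))" for r'
  proof (induction r')
    case (Suc r')
    then obtain D E where DE: "\<And>i. i < r' \<Longrightarrow> deg_bdd T D (subst.ev \<sigma> (x i))" "deg_bdd T E (subst.ev \<sigma> (x r'))"
      using ex_bdd by blast
    have "deg_bdd T (max D E) (subst.ev \<sigma> (x i))" if "i < Suc r'" for i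
    proof (cases "i = r'")
      case True
      show ?thesis unfolding True by (rule deg_bdd_mono[OF DE(2)]) simp
    next
      case False
      then have "i < r'" using that by simp
      then show ?thesis by (rule deg_bdd_mono[OF DE(1)]) simp
    qed
    then show ?case by blast
  qed simp
  then obtain D where D: "\<And>i. i < r \<Longrightarrow> deg_bdd T D (subst.ev \<sigma> (x i))" by blast
  \<comment> \<open>There are \<open>(M + 1) ^ r\<close> products with exponents up to
    \<open>M\<close>, of degree at most \<open>K\<close> after substitution, and at most
    \<open>(K + 1) ^ (r - 1)\<close> monomials for them. As
    \<open>K + 1 \<le> (D * r + 1) * (M + 1)\<close>, this \<open>M\<close> bounds the latter by
    \<open>M * (M + 1) ^ (r - 1)\<close>, which is smaller.\<close>
  define M where "M = (D * r + 1) ^ (r - 1)"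
  define K where "K = D * (r * M)"
  define Mon where "Mon = {m :: 'v \<Rightarrow>\<^sub>0 nat. (\<forall>v. v \<notin> T \<longrightarrow> coeff_of m v = 0) \<and> mon_degree m \<le> K}"
  have "card Mon \<le> (K + 1) ^ (r - 1)" and finM: "finite Mon"
    using card_monomials_le[of T K] by (simp_all add: Mon_def cardT)
  note \<open>card Mon \<le> (K + 1) ^ (r - 1)\<close>
  also have "(K + 1) ^ (r - 1) \<le> ((D * r + 1) * (M + 1)) ^ (r - 1)"
    by (rule power_mono) (auto simp: K_def algebra_simps)
  also have "\<dots> = M * (M + 1) ^ (r - 1)" by (simp only: power_mult_distrib M_def)
  also have "\<dots> < (M + 1) * (M + 1) ^ (r - 1)" by simp
  also have "\<dots> = (M + 1) ^ r" using rj(2) by (simp flip: power_Suc)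
  also have "\<dots> = card (exps M r)" by (simp add: card_lists_length_eq)
  finally have lt: "card Mon < card (exps M r)" .
  define a' where "a' m es = coeff_of (subst.ev \<sigma> (chain_monomial x es 0)) m" for m es
  obtain c where c: "\<exists>es\<in>exps M r. c es \<noteq> 0" "\<forall>m\<in>Mon. (\<Sum>es\<in>exps M r. a' m es * c es) = 0"
    using underdetermined_system[OF finM finite_exps lt, of a'] by blast
  let ?p = "\<Sum>es\<in>exps M r. Const (c es) * chain_monomial x es 0"
  have bdd: "deg_bdd T K (subst.ev \<sigma> (chain_monomial x es 0))" if es: "es \<in> exps M r" for es
  proof -
    have "sum_list es \<le> (\<Sum>e\<leftarrow>es. M)" using es sum_list_mono[of es "\<lambda>e. e" "\<lambda>_. M"] by auto
    then have le: "D * sum_list es \<le> K" using es by (simp add: K_def sum_list_triv)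
    have "deg_bdd T (D * sum_list es) (chain_monomial (\<lambda>t. subst.ev \<sigma> (x t)) es 0)"
      by (rule deg_bdd_chain_monomial) (use D es in simp)
    then show ?thesis unfolding subst_chain_monomial using le by (rule deg_bdd_mono)
  qed
  have "subst.ev \<sigma> ?p = 0"
  proof (rule poly_mapping_eqI)
    fix m
    have "coeff_of (subst.ev \<sigma> ?p) m = (\<Sum>es\<in>exps M r. a' m es * c es)"
      by (simp add: subst.ev_sum subst.ev_mult lookup_sum lookup_Const_mult a'_def mult.commute)
    also have "\<dots> = 0"
    proof (cases "m \<in> Mon")
      case False
      have "a' m es = 0" if "es \<in> exps M r" for es
      proof (rule ccontr)
        assume "a' m es \<noteq> 0"
        then have "m \<in> Poly_Mapping.keys (subst.ev \<sigma> (chain_monomial x es 0))" by (simp add: a'_def in_keys_iff)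
        then have "m \<in> Mon" using bdd[OF that] by (simp add: deg_bdd_def Mon_def)
        then show False using False by simp
      qed
      then show ?thesis by simp
    qed (use c in simp)
    finally show "coeff_of (subst.ev \<sigma> ?p) m = coeff_of 0 m" by simp
  qed
  then have "?p \<in> P 0" using diff[of ?p] by simp
  then have "c es = 0" if "es \<in> exps M r" for es
  proof (rule chain_independent[rotated 2, OF _ that])
    show "is_prime_ideal (P t)" if "t \<le> 0 + r" for t using P(1) that rj(1) by simp
    show "P t \<subseteq> P (Suc t) \<and> x t \<in> P (Suc t) \<and> x t \<notin> P t" if "t < 0 + r" for t
      using P(2)[of t] x[of t] that rj(1) by auto
  qed
  then show False using c(1) by blast
qed

section \<open>Planes in general position\<close>

lemma exists_nonvanishing:
  fixes T :: "('v::finite \<Rightarrow> 'k::field_char_0) set"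
  assumes "finite T" "\<And>a. a \<in> T \<Longrightarrow> a \<noteq> (\<lambda>_. 0)"
  shows "\<exists>x. \<forall>a\<in>T. dot a x \<noteq> 0"
proof -
  have "\<not> van UNIV (\<Prod>a\<in>T. linear_form a)"
  proof (rule flat_prime_prod[OF flat_UNIV])
    fix a assume "a \<in> T"
    then obtain v where "a v \<noteq> 0" using assms(2) by blast
    then have "vec_unit v \<notin> hyperplane a" by (simp add: hyperplane_iff)
    then show "\<not> van UNIV (linear_form a)" by (auto simp only: van_linear_form_iff)
  qed
  then obtain x where "(\<Prod>a\<in>T. dot a x) \<noteq> 0" by (auto simp: van_def simp del: van_UNIV_iff)
  then show ?thesis using assms(1) by (auto simp: prod_zero_iff)
qed

text \<open>The plane spanned by \<open>x\<close> and \<open>y\<close> meets each \<open>hyperplane a\<close> in a line outside \<open>hyperplane b\<close>.\<close>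

lemma exists_generic_plane:
  fixes S :: "(('v::finite \<Rightarrow> 'k::field_char_0) \<times> ('v \<Rightarrow> 'k)) set"
  assumes S: "finite S" "\<And>a b. (a, b) \<in> S \<Longrightarrow> a \<noteq> (\<lambda>_. 0) \<and> \<not> hyperplane a \<subseteq> hyperplane b"
  shows "\<exists>x y. \<forall>(a, b)\<in>S. dot a y * dot b x - dot a x * dot b y \<noteq> 0"
proof -
  obtain x where x: "\<And>a b. (a, b) \<in> S \<Longrightarrow> dot a x \<noteq> 0"
    using exists_nonvanishing[of "fst ` S"] S by force
  \<comment> \<open>For fixed \<open>x\<close> the determinant is a linear form in \<open>y\<close>.
    It is not zero: at a point \<open>p\<close> of \<open>hyperplane a\<close> outside
    \<open>hyperplane b\<close> its value is \<open>- dot a x * dot b p\<close>.\<close>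
  define T where "T = (\<lambda>(a, b). (\<lambda>v. dot b x * a v + (- dot a x) * b v)) ` S"
  have "\<exists>y. \<forall>c\<in>T. dot c y \<noteq> 0"
  proof (rule exists_nonvanishing)
    show "finite T" using S(1) by (simp add: T_def)
    fix c assume "c \<in> T"
    then obtain a b where ab: "(a, b) \<in> S" "c = (\<lambda>v. dot b x * a v + (- dot a x) * b v)" by (auto simp: T_def)
    obtain p where p: "p \<in> hyperplane a" "p \<notin> hyperplane b" using S(2)[OF ab(1)] by blast
    have "dot c p = - dot a x * dot b p" unfolding ab(2) dot_linear_left using p by (simp add: hyperplane_iff)
    then have "dot c p \<noteq> 0" using p x[OF ab(1)] by (simp add: hyperplane_iff)
    then show "c \<noteq> (\<lambda>_. 0)" by auto
  qed
  then obtain y where y: "\<And>c. c \<in> T \<Longrightarrow> dot c y \<noteq> 0" by blast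
  have "dot a y * dot b x - dot a x * dot b y \<noteq> 0" if "(a, b) \<in> S" for a b
  proof -
    have "dot (\<lambda>v. dot b x * a v + (- dot a x) * b v) y \<noteq> 0" using y that by (force simp: T_def)
    then show ?thesis unfolding dot_linear_left by (simp add: mult.commute)
  qed
  then show ?thesis by blast
qed

text \<open>The combination of \<open>x\<close> and \<open>y\<close> with coefficients
  \<open>dot a y\<close> and \<open>- dot a x\<close> lies in \<open>hyperplane a\<close>, and the
  determinant is the value of \<open>b\<close> on it.\<close>

lemma generic_plane_not_sub:
  assumes W: "lin_closed W" "x \<in> W" "y \<in> W" and ne: "dot a y * dot b x - dot a x * dot b y \<noteq> 0"
  shows "\<not> W \<inter> hyperplane a \<subseteq> hyperplane b"
proof
  assume sub: "W \<inter> hyperplane a \<subseteq> hyperplane b"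
  let ?p = "\<lambda>v. dot a y * x v + (- dot a x) * y v"
  have "?p \<in> W" using W unfolding lin_closed_def by blast
  moreover have "dot a ?p = 0" unfolding dot_linear_right by simp
  ultimately have "dot b ?p = 0" using sub by (auto simp: hyperplane_iff)
  then show False using ne unfolding dot_linear_right by simp
qed

section \<open>Depth and Krull dimension of the quotient by the pencil ideal\<close>

context pencil_partition
begin

lemma l_nonzero: "H \<in> A \<Longrightarrow> l H \<noteq> (\<lambda>_. 0)"
  using l_pt by fastforce

lemma R_constant_term:
  assumes "2 \<le> card A" "p \<in> R"
  shows "c0 p = 0"
proof -
  have gens: "c0 (F i * (\<alpha> * z i + \<beta> * Y i)) = 0" if i: "i < k" for i \<alpha> \<beta>
  proof -
    have "A \<noteq> {B i}" using assms(1) by auto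
    then obtain H where H: "H \<in> A" "H \<noteq> B i" using B_A[OF i] by blast
    have "c0 (F i) = 0 \<or> c0 (z i) = 0"
    proof (cases "H \<in> G i")
      case True
      then have "c0 (z i) = 0" unfolding z_def eval_simps
        using H finite_G[OF i] by (intro prod_zero) (auto simp: L_eval)
      then show ?thesis by simp
    next
      case False
      then have "c0 (F i) = 0" unfolding F_def eval_simps
        using H finite_A by (intro prod_zero) (auto simp: L_eval)
      then show ?thesis by simp
    qed
    then show ?thesis by (auto simp: Y_eval)
  qed
  obtain \<alpha> \<beta> where p: "p = (\<Sum>i<k. F i * (\<alpha> i * z i + \<beta> i * Y i))"
    using assms(2) by (auto simp: R_def comb_def)
  show ?thesis unfolding p eval_simps(10) by (intro sum.neutral ballI gens) simp
qed

lemma R_plus_flat: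
  assumes "finite \<Lambda>"
  shows "p \<in> ideal_generated (R \<union> linear_form ` \<Lambda>) \<longleftrightarrow> (\<exists>\<rho>\<in>R. van {x. \<forall>a\<in>\<Lambda>. dot a x = 0} (p - \<rho>))"
    (is "_ \<longleftrightarrow> (\<exists>\<rho>\<in>R. van ?W _)")
proof
  assume "p \<in> ideal_generated (R \<union> linear_form ` \<Lambda>)"
  then show "\<exists>\<rho>\<in>R. van ?W (p - \<rho>)"
  proof (induction p rule: ideal_span_induct_alt[consumes 1, case_names base step])
    case base
    show ?case by (intro bexI[of _ 0]) (simp_all add: ideal_subspace_0[OF R_ideal])
  next
    case (step c x y)
    obtain \<rho> where \<rho>: "\<rho> \<in> R" "van ?W (y - \<rho>)" using step by blast
    from step(1) show ?case
    proof
      assume "x \<in> R"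
      then have "c * x + \<rho> \<in> R"
        using ideal_subspace_add[OF R_ideal ideal_subspace_scale[OF R_ideal] \<rho>(1)] by blast
      then show ?thesis using \<rho> by (intro bexI[of _ "c * x + \<rho>"]) simp_all
    next
      assume "x \<in> linear_form ` \<Lambda>"
      then have "van ?W x" by (auto simp: van_def)
      then have "van ?W (c * x + (y - \<rho>))" using \<rho> by (intro van_add van_mult_left)
      then show ?thesis using \<rho> by (intro bexI[of _ \<rho>]) (simp_all add: add_diff_eq)
    qed
  qed
next
  assume "\<exists>\<rho>\<in>R. van ?W (p - \<rho>)"
  then obtain \<rho> where \<rho>: "\<rho> \<in> R" "van ?W (p - \<rho>)" by blast
  then have "p - \<rho> \<in> ideal_generated (linear_form ` \<Lambda>)" using van_zeros_iff[OF assms] by blast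
  then have "p - \<rho> \<in> ideal_generated (R \<union> linear_form ` \<Lambda>)"
    using ideal_span_mono[of "linear_form ` \<Lambda>" "R \<union> linear_form ` \<Lambda>"] by blast
  moreover have "\<rho> \<in> ideal_generated (R \<union> linear_form ` \<Lambda>)" using \<rho> by (intro ideal_span_base) blast
  ultimately have "(p - \<rho>) + \<rho> \<in> ideal_generated (R \<union> linear_form ` \<Lambda>)" by (rule ideal_span_add)
  then show "p \<in> ideal_generated (R \<union> linear_form ` \<Lambda>)" by simp
qed

text \<open>Syzygies over the smaller flat lift, so that a linear form cutting it out is regular.\<close>

lemma linear_form_regular:
  assumes W: "flat W" and not_sub0: "\<not> W \<subseteq> hyperplane b"
    and dist: "\<And>H H'. H \<in> A \<Longrightarrow> H' \<in> A \<Longrightarrow> H \<noteq> H' \<Longrightarrow> \<not> W \<inter> hyperplane b \<inter> Hp H \<subseteq> Hp H'"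
    and ynot: "\<And>i H. i < m \<Longrightarrow> H \<in> G i \<Longrightarrow> \<not> W \<inter> hyperplane b \<inter> Hp H \<subseteq> Yp i"
    and not_sub: "\<And>H. H \<in> A \<Longrightarrow> \<not> W \<inter> hyperplane b \<subseteq> Hp H"
    and h: "\<rho> \<in> R" "van W (linear_form b * g - \<rho>)"
  shows "\<exists>\<rho>\<in>R. van W (g - \<rho>)"
proof -
  let ?b = "linear_form b" and ?W = "W \<inter> hyperplane b"
  obtain \<alpha> \<beta> where ab: "\<rho> = comb \<alpha> \<beta>" using h(1) by (auto simp: R_def)
  have W': "flat ?W" by (rule flat_Int_hyperplane[OF W])
  have "van ?W (comb \<alpha> \<beta>)"
    unfolding van_def
  proof
    fix x assume x: "x \<in> ?W"
    then have "poly_eval (?b * g - comb \<alpha> \<beta>) x = 0" using h(2) by (simp add: van_def ab)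
    then show "poly_eval (comb \<alpha> \<beta>) x = 0" using x by (simp add: hyperplane_iff)
  qed
  then obtain \<gamma> \<delta> where gd: "\<And>i. i < k \<Longrightarrow> van ?W (\<alpha> i - (\<gamma> i * L (B i) - \<delta> i * Y i)) \<and> van ?W (\<beta> i - \<delta> i * z i)"
    and gs: "van ?W (\<Sum>i<k. \<gamma> i)"
    using syzygies[OF W' dist ynot not_sub] by blast
  have "\<exists>c. van W (\<alpha> i - (\<gamma> i * L (B i) - \<delta> i * Y i) - ?b * c)" if "i < k" for i
    using flat_div[OF W] gd[OF that] by blast
  then obtain \<epsilon> where \<epsilon>: "\<And>i. i < k \<Longrightarrow> van W (\<alpha> i - (\<gamma> i * L (B i) - \<delta> i * Y i) - ?b * \<epsilon> i)" by metis
  have "\<exists>c. van W (\<beta> i - \<delta> i * z i - ?b * c)" if "i < k" for i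
    using flat_div[OF W] gd[OF that] by blast
  then obtain \<eta> where \<eta>: "\<And>i. i < k \<Longrightarrow> van W (\<beta> i - \<delta> i * z i - ?b * \<eta> i)" by metis
  obtain c where c: "van W ((\<Sum>i<k. \<gamma> i) - ?b * c)" using flat_div[OF W gs] by blast
  \<comment> \<open>After insertion of the lifted syzygies the terms with \<open>\<delta> i\<close>
    cancel, and the \<open>\<gamma> i\<close> contribute \<open>f\<close> times their sum, which is
    \<open>?b * c\<close> on \<open>W\<close>. So \<open>?b * g\<close> and
    \<open>?b * ?\<rho>\<close> agree on \<open>W\<close>, and \<open>?b\<close> cancels.\<close>
  let ?\<rho> = "comb \<epsilon> \<eta> + c * f"
  have \<rho>R: "?\<rho> \<in> R" by (intro ideal_subspace_add[OF R_ideal] comb_in_R ideal_subspace_scale[OF R_ideal] f_in_R)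
  have "van W (?b * (g - ?\<rho>))"
    unfolding van_def
  proof
    fix x assume x: "x \<in> W"
    have 1: "poly_eval (\<alpha> i) x = poly_eval (\<gamma> i) x * dot (l (B i)) x - poly_eval (\<delta> i) x * dot (y i) x
        + dot b x * poly_eval (\<epsilon> i) x" if "i < k" for i
      using \<epsilon>[OF that] x by (simp add: van_def L_eval Y_eval algebra_simps)
    have 2: "poly_eval (\<beta> i) x = poly_eval (\<delta> i) x * poly_eval (z i) x + dot b x * poly_eval (\<eta> i) x" if "i < k" for i
      using \<eta>[OF that] x by (simp add: van_def algebra_simps)
    have 3: "(\<Sum>i<k. poly_eval (\<gamma> i) x) = dot b x * poly_eval c x"
      using c x by (simp add: van_def)
    have f: "poly_eval f x = poly_eval (F i) x * (dot (l (B i)) x * poly_eval (z i) x)" if "i < k" for i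
      using arg_cong[OF f_eq[OF that], of "\<lambda>p. poly_eval p x"] by (simp add: L_eval)
    have "poly_eval (comb \<alpha> \<beta>) x = (\<Sum>i<k. poly_eval (\<gamma> i) x * poly_eval f x
        + dot b x * (poly_eval (F i) x * (poly_eval (\<epsilon> i) x * poly_eval (z i) x + poly_eval (\<eta> i) x * dot (y i) x)))"
      unfolding comb_def eval_simps by (intro sum.cong refl) (simp add: 1 2 f Y_eval algebra_simps)
    also have "\<dots> = (\<Sum>i<k. poly_eval (\<gamma> i) x) * poly_eval f x
        + dot b x * (\<Sum>i<k. poly_eval (F i) x * (poly_eval (\<epsilon> i) x * poly_eval (z i) x + poly_eval (\<eta> i) x * dot (y i) x))"
      by (simp only: sum.distrib sum_distrib_right sum_distrib_left)
    also have "\<dots> = dot b x * poly_eval ?\<rho> x"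
      unfolding 3 by (simp add: comb_def Y_eval algebra_simps)
    finally have "poly_eval (comb \<alpha> \<beta>) x = dot b x * poly_eval ?\<rho> x" .
    moreover have "dot b x * poly_eval g x = poly_eval (comb \<alpha> \<beta>) x" using h(2) x by (simp add: van_def ab)
    ultimately have "dot b x * poly_eval g x = dot b x * poly_eval ?\<rho> x" by simp
    then show "poly_eval (?b * (g - ?\<rho>)) x = 0" by (simp add: right_diff_distrib)
  qed
  then have "van W (g - ?\<rho>)" using flat_prime[OF W] not_sub0 van_linear_form_iff by blast
  then show ?thesis using \<rho>R by blast
qed

text \<open>The regular sequence consists of linear forms cutting out a generic plane spanned by
  \<open>p\<close> and \<open>q\<close>. Every intermediate flat contains this plane, which keeps
  the traces of the hyperplanes apart from each other and outside \<open>Yp i\<close>, as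
  \<open>linear_form_regular\<close> demands.\<close>

lemma depth_R_ge:
  assumes A2: "2 \<le> card A"
  shows "enat (CARD('v) - 2) \<le> depth_quot R"
proof -
  \<comment> \<open>The pairs of forms that must stay independent on the plane: those of two
    hyperplanes, or that of a pencil member and its \<open>y i\<close>.\<close>
  define S where "S = {(l H, l H') | H H'. H \<in> A \<and> H' \<in> A \<and> H \<noteq> H'} \<union> {(l H, y i) | H i. i < m \<and> H \<in> G i}"
  have S1: "finite {(l H, l H') | H H'. H \<in> A \<and> H' \<in> A \<and> H \<noteq> H'}"
    by (rule finite_subset[of _ "(\<lambda>(H, H'). (l H, l H')) ` (A \<times> A)"]) (use finite_A in auto)
  have S2: "finite {(l H, y i) | H i. i < m \<and> H \<in> G i}"
  proof (rule finite_subset)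
    show "{(l H, y i) | H i. i < m \<and> H \<in> G i} \<subseteq> (\<lambda>(H, i). (l H, y i)) ` (A \<times> {..<m})"
    proof clarify
      fix H i assume "i < m" "H \<in> G i"
      then show "(l H, y i) \<in> (\<lambda>(H, i). (l H, y i)) ` (A \<times> {..<m})"
        using G_sub[of i] m_le_k by (intro image_eqI[of _ _ "(H, i)"]) auto
    qed
    show "finite ((\<lambda>(H, i). (l H, y i)) ` (A \<times> {..<m}))" using finite_A by simp
  qed
  have "\<exists>x y. \<forall>(a, b)\<in>S. dot a y * dot b x - dot a x * dot b y \<noteq> 0"
  proof (rule exists_generic_plane)
    show "finite S" using S1 S2 by (simp add: S_def)
    fix a b assume "(a, b) \<in> S"
    then consider (1) H H' where "a = l H" "b = l H'" "H \<in> A" "H' \<in> A" "H \<noteq> H'"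
      | (2) H i where "a = l H" "b = y i" "i < m" "H \<in> G i" by (auto simp: S_def)
    then show "a \<noteq> (\<lambda>_. 0) \<and> \<not> hyperplane a \<subseteq> hyperplane b"
    proof cases
      case 1
      from l_nonzero[OF 1(3)] l_dist[OF 1(3-5)] show ?thesis unfolding 1(1,2) by (rule conjI)
    next
      case 2
      then have "H \<in> A" using G_sub[of i] m_le_k by auto
      from l_nonzero[OF this] Hp_not_sub_Yp[OF 2(3,4)] show ?thesis unfolding 2(1,2) by (rule conjI)
    qed
  qed
  then obtain p q where pq: "\<And>a b. (a, b) \<in> S \<Longrightarrow> dot a q * dot b p - dot a p * dot b q \<noteq> 0" by blast
  have dist: "\<not> W \<inter> Hp H \<subseteq> Hp H'" if "lin_closed W" "p \<in> W" "q \<in> W" "H \<in> A" "H' \<in> A" "H \<noteq> H'" for W H H'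
    by (rule generic_plane_not_sub[OF that(1-3)], rule pq) (use that in \<open>auto simp: S_def\<close>)
  have ynot: "\<not> W \<inter> Hp H \<subseteq> Yp i" if "lin_closed W" "p \<in> W" "q \<in> W" "i < m" "H \<in> G i" for W H i
    by (rule generic_plane_not_sub[OF that(1-3)], rule pq) (use that in \<open>auto simp: S_def\<close>)
  have other: "\<exists>H'\<in>A. H' \<noteq> H" for H
  proof (rule ccontr)
    assume "\<not> ?thesis"
    then have "A \<subseteq> {H}" by blast
    then have "card A \<le> card {H}" by (intro card_mono) auto
    then show False using A2 by simp
  qed
  have not_sub: "\<not> W \<subseteq> Hp H" if W: "lin_closed W" "p \<in> W" "q \<in> W" and H: "H \<in> A" for W H
  proof -
    obtain H' where "H' \<in> A" "H' \<noteq> H" using other by blast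
    then show ?thesis using dist[OF W _ H, of H'] by auto
  qed
  \<comment> \<open>The determinant for two different hyperplanes is nonzero, so \<open>p\<close>
    and \<open>q\<close> are independent and some coordinates \<open>u\<close> and \<open>w\<close>
    parametrise the plane.\<close>
  have "\<exists>u w. p u * q w - p w * q u \<noteq> 0"
  proof (rule ccontr)
    assume "\<not> ?thesis"
    then have mz: "p u * q w = p w * q u" for u w by auto
    have swap: "dot a x = dot x a" for a x :: "'v \<Rightarrow> 'k" by (simp add: dot_def mult.commute)
    obtain H where H: "H \<in> A" using B_A[OF k_pos] by blast
    obtain H' where H': "H' \<in> A" "H' \<noteq> H" using other by blast
    have "dot (l H) q * dot (l H') p - dot (l H) p * dot (l H') q \<noteq> 0"
      by (rule pq) (use H H' in \<open>auto simp: S_def\<close>)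
    moreover have "dot p (l H) * dot q (l H') = dot p (l H') * dot q (l H)" by (rule minors_vanish_imp[OF mz])
    ultimately show False by (simp add: swap[of p] swap[of q] mult.commute)
  qed
  then obtain u w where minor: "p u * q w - p w * q u \<noteq> 0" by blast
  have uw: "u \<noteq> w" using minor by auto
  define \<Delta> where "\<Delta> = p u * q w - p w * q u"
  have \<Delta>: "\<Delta> \<noteq> 0" using minor by (simp add: \<Delta>_def)
  \<comment> \<open>On the plane the coordinate \<open>v\<close> is a combination of those at
    \<open>u\<close> and \<open>w\<close>, by Cramer's rule. Apart from these two,
    \<open>lam v\<close> involves only the variable \<open>v\<close>, so unit vectors separate the
    forms.\<close>
  define lam where "lam v = (\<lambda>j. 1 * vec_unit v j +
      1 * ((- ((p v * q w - q v * p w) / \<Delta>)) * vec_unit u j + (- ((p u * q v - q u * p v) / \<Delta>)) * vec_unit w j))" for v :: 'v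
  have dot_lam: "dot (lam v) x = x v - (p v * q w - q v * p w) / \<Delta> * x u - (p u * q v - q u * p v) / \<Delta> * x w" for v x
    unfolding lam_def dot_linear_left by simp
  have lam_p: "dot (lam v) p = 0" for v
  proof -
    have "(p v * q w - q v * p w) * p u + (p u * q v - q u * p v) * p w = p v * \<Delta>"
      by (simp add: \<Delta>_def algebra_simps)
    then have "(p v * q w - q v * p w) / \<Delta> * p u + (p u * q v - q u * p v) / \<Delta> * p w = p v"
      using \<Delta> by (simp add: add_divide_distrib[symmetric])
    then show ?thesis by (simp add: dot_lam algebra_simps)
  qed
  have lam_q: "dot (lam v) q = 0" for v
  proof -
    have "(p v * q w - q v * p w) * q u + (p u * q v - q u * p v) * q w = q v * \<Delta>"
      by (simp add: \<Delta>_def algebra_simps)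
    then have "(p v * q w - q v * p w) / \<Delta> * q u + (p u * q v - q u * p v) / \<Delta> * q w = q v"
      using \<Delta> by (simp add: add_divide_distrib[symmetric])
    then show ?thesis by (simp add: dot_lam algebra_simps)
  qed
  obtain vs where vs: "set vs = UNIV - {u, w}" "distinct vs" using finite_distinct_list[of "UNIV - {u, w}"] by auto
  define xs where "xs = map (\<lambda>v. linear_form (lam v)) vs"
  have "length vs = CARD('v) - 2"
    using distinct_card[OF vs(2)] vs(1) uw by (simp add: card_Diff_subset)
  then have len: "length xs = CARD('v) - 2" by (simp add: xs_def)
  define Lam where "Lam i = lam ` set (take i vs)" for i
  define Wi where "Wi i = {x. \<forall>a\<in>Lam i. dot a x = 0}" for i
  have finL: "finite (Lam i)" for i by (simp add: Lam_def)
  have flatW: "flat (Wi i)" for i using finL by (auto simp: flat_def Wi_def)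
  have pqW: "p \<in> Wi i" "q \<in> Wi i" for i by (auto simp: Wi_def Lam_def lam_p lam_q)
  have take_xs: "set (take i xs) = linear_form ` Lam i" for i
    by (simp add: xs_def Lam_def take_map image_image)
  have mem: "h \<in> ideal_generated (R \<union> set (take i xs)) \<longleftrightarrow> (\<exists>\<rho>\<in>R. van (Wi i) (h - \<rho>))" for h i
    unfolding take_xs Wi_def by (rule R_plus_flat[OF finL])
  have reg: "g \<in> ideal_generated (R \<union> set (take i xs))"
    if i: "i < length xs" and g: "xs ! i * g \<in> ideal_generated (R \<union> set (take i xs))" for i g
  proof -
    have ivs: "i < length vs" using i by (simp add: xs_def)
    let ?v = "vs ! i"
    let ?W = "Wi i \<inter> hyperplane (lam ?v)"
    have xi: "xs ! i = linear_form (lam ?v)" using ivs by (simp add: xs_def)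
    obtain \<rho> where \<rho>: "\<rho> \<in> R" "van (Wi i) (linear_form (lam ?v) * g - \<rho>)" using g unfolding mem xi by blast
    have W: "lin_closed ?W" "p \<in> ?W" "q \<in> ?W"
      using flat_lin_closed[OF flat_Int_hyperplane[OF flatW]] pqW by (auto simp: hyperplane_iff lam_p lam_q)
    have vuw: "v \<noteq> u \<and> v \<noteq> w" if "v \<in> set vs" for v using that vs(1) by auto
    have "vec_unit ?v \<in> Wi i"
    proof -
      have "dot (lam v) (vec_unit ?v) = 0" if v: "v \<in> set (take i vs)" for v
      proof -
        obtain j where j: "j < i" "v = vs ! j" using v ivs by (auto simp: in_set_conv_nth)
        then have "v \<noteq> ?v" using vs(2) ivs by (simp add: nth_eq_iff_index_eq)
        then show ?thesis using vuw[of ?v] ivs by (simp only: dot_lam) (auto simp: vec_unit_def)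
      qed
      then show ?thesis by (auto simp: Wi_def Lam_def)
    qed
    moreover have "dot (lam ?v) (vec_unit ?v) = 1"
      using vuw[of ?v] ivs by (simp only: dot_lam) (auto simp: vec_unit_def)
    ultimately have "\<not> Wi i \<subseteq> hyperplane (lam ?v)" by (auto simp: hyperplane_iff)
    then show ?thesis unfolding mem
      by (rule linear_form_regular[OF flatW _ dist[OF W] ynot[OF W] not_sub[OF W] \<rho>])
  qed
  have "1 \<notin> ideal_generated (R \<union> set (take (length xs) xs))"
  proof
    assume "1 \<in> ideal_generated (R \<union> set (take (length xs) xs))"
    then obtain \<rho> where "\<rho> \<in> R" "van (Wi (length xs)) (1 - \<rho>)" unfolding mem by blast
    then show False using R_constant_term[OF A2, of \<rho>] flat_0[OF flatW[of "length xs"]] by (auto simp: van_def)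
  qed
  then have "regular_sequence_quot R xs"
    using reg by (auto simp: regular_sequence_quot_def)
  moreover have "set xs \<subseteq> irrelevant_ideal"
    by (auto simp: xs_def irrelevant_iff)
  ultimately show ?thesis unfolding depth_quot_def len[symmetric] by (intro Sup_upper) blast
qed

text \<open>A prime over \<open>R\<close> contains \<open>f\<close>, hence the form of some
  \<open>H\<close>. The generator \<open>F i * z i\<close> if \<open>H = B i\<close>, and
  \<open>F i * Y i\<close> otherwise, has no factor proportional to that form, so the prime contains
  a second, independent linear form.\<close>

lemma krull_dim_R_le:
  assumes A2: "2 \<le> card A"
  shows "krull_dim_quot R \<le> enat (CARD('v) - 2)"
  unfolding krull_dim_quot_def
proof (rule Sup_least)
  fix e assume "e \<in> {enat j | j. \<exists>P. (\<forall>i\<le>j. is_prime_ideal (P i) \<and> R \<subseteq> P i) \<and> (\<forall>i<j. P i \<subset> P (Suc i))}"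
  then obtain j P where e: "e = enat j" and P: "\<And>i. i \<le> j \<Longrightarrow> is_prime_ideal (P i)" "\<And>i. i < j \<Longrightarrow> P i \<subset> P (Suc i)"
    and RP: "R \<subseteq> P 0" by blast
  have pr: "is_prime_ideal (P 0)" using P by simp
  obtain H where H: "H \<in> A" "L H \<in> P 0"
    using prime_ideal_prod[OF pr, of L A] f_in_R RP by (auto simp: f_def)
  obtain i where i: "i < k" "H \<in> G i" using H by (auto simp: A_eq)
  have "\<exists>b. linear_form b \<in> P 0 \<and> \<not> Hp H \<subseteq> hyperplane b"
  proof -
    have two: ?thesis if "H' \<in> A" "H' \<noteq> H" "L H' \<in> P 0" for H'
      using that H l_dist[of H H'] by (auto simp: L_def)
    have Fcase: ?thesis if "F i \<in> P 0"
      using prime_ideal_prod[OF pr, of L "A - G i"] that two i by (auto simp: F_def)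
    show ?thesis
    proof (cases "H = B i")
      case True
      have "F i * z i \<in> P 0" using z_gen_in_R[OF i(1)] RP by blast
      then consider "F i \<in> P 0" | "z i \<in> P 0" using prime_idealD(3)[OF pr] by blast
      then show ?thesis
      proof cases
        case 2
        then show ?thesis
          using prime_ideal_prod[OF pr, of L "G i - {B i}"] two True G_sub[OF i(1)] by (auto simp: z_def)
      qed (rule Fcase)
    next
      case False
      then have im: "i < m" using i G_single[of i] by force
      have "F i * Y i \<in> P 0" using Y_gen_in_R[OF i(1)] RP by blast
      then consider "F i \<in> P 0" | "Y i \<in> P 0" using prime_idealD(3)[OF pr] by blast
      then show ?thesis
      proof cases
        case 2
        then show ?thesis using Hp_not_sub_Yp[OF im i(2)] by (auto simp: Y_def)
      qed (rule Fcase)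
    qed
  qed
  then obtain b where b: "linear_form b \<in> P 0" "\<not> Hp H \<subseteq> hyperplane b" by blast
  obtain u w where "l H u * b w - l H w * b u \<noteq> 0"
    using exists_minor[OF b(2) l_nonzero[OF H(1)]] by blast
  then have "j \<le> CARD('v) - 2"
    using prime_chain_bound[of "l H" u b w P j] H(2) b(1) P by (auto simp: L_def)
  then show "e \<le> enat (CARD('v) - 2)" by (simp add: e)
qed

lemma cohen_macaulay_R: "2 \<le> card A \<Longrightarrow> cohen_macaulay_quot R"
  using depth_R_ge krull_dim_R_le depth_le_krull_dim[of R]
  unfolding cohen_macaulay_quot_def by (meson order.antisym order.trans)

end

section \<open>The minimal resolution\<close>

text \<open>The ring is spliced on in front, with the generators of \<open>I\<close> as entries of
  the new map; their vanishing constant terms keep the resolution minimal.\<close>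

lemma minimal_resolution_quotient:
  fixes I :: "('v::finite, 'k::field) mpoly set"
  assumes R: "minimal_graded_free_resolution I {0} b g \<phi>" and I: "is_ideal I"
    and irr: "\<And>p. p < length (b 0) \<Longrightarrow> c0 (g $ p) = 0"
  shows "minimal_graded_free_resolution UNIV I (case_nat [0] b) (vec 1 (\<lambda>_. 1))
    (case_nat (mat 1 (length (b 0)) (\<lambda>(_, q). g $ q)) \<phi>)"
proof -
  note D = minimal_resolutionD[OF R]
  let ?b = "case_nat [0] b" and ?r = "mat 1 (length (b 0)) (\<lambda>(_, q). g $ q)"
  let ?\<phi> = "case_nat ?r \<phi>"
  have car: "\<phi> i \<in> carrier_mat (length (b i)) (length (b (Suc i)))" for i using D(5)[of i] by (simp add: graded_mat_def)
  have row: "vec (length (b 0)) (($) g) = g" using D(1) by (intro eq_vecI) auto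
  have rv: "?r *\<^sub>v v = vec 1 (\<lambda>_. g \<bullet> v)" for v
    by (intro eq_vecI) (auto simp: row)
  note rv' = rv[unfolded One_nat_def]
  have one: "vec 1 (\<lambda>_. 1) \<bullet> v = v $ 0" if "v \<in> carrier_vec 1" for v :: "('v, 'k) mpoly vec"
    using that by (simp add: scalar_prod_def)
  have gv: "g \<bullet> v \<in> I" if "v \<in> carrier_vec (length (b 0))" for v
  proof -
    have "g \<bullet> v = (\<Sum>p<length (b 0). v $ p * g $ p)" using that by (simp add: scalar_prod_def atLeast0LessThan mult.commute)
    then show ?thesis using D(2) by (auto intro!: ideal_subspace_sum[OF I] ideal_subspace_scale[OF I])
  qed
  have in_I: "h \<in> I \<Longrightarrow> \<exists>v\<in>carrier_vec (length (b 0)). h = g \<bullet> v" for h using D(3) by fastforce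
  show ?thesis
    unfolding minimal_graded_free_resolution_def
  proof (intro conjI)
    show "\<forall>i. ?\<phi> i \<in> carrier_mat (length (?b i)) (length (?b (Suc i)))"
      using car by (auto split: nat.split)
    show "\<forall>p<length (?b 0). vec 1 (\<lambda>_. 1) $ p \<in> UNIV \<and> homogeneous (?b 0 ! p) (vec 1 (\<lambda>_. 1) $ p)"
      by (simp add: homogeneous_1)
    show "\<forall>i. \<forall>p<length (?b i). \<forall>q<length (?b (Suc i)). homogeneous (?b (Suc i) ! q - ?b i ! p) (?\<phi> i $$ (p, q))"
      using D(2,5) by (auto simp: graded_mat_def split: nat.split)
    show "\<forall>h\<in>UNIV. \<exists>v\<in>carrier_vec (length (?b 0)). h - vec 1 (\<lambda>_. 1) \<bullet> v \<in> I"
    proof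
      fix h :: "('v, 'k) mpoly"
      have "vec 1 (\<lambda>_. 1) \<bullet> vec 1 (\<lambda>_. h) = h" by (simp add: scalar_prod_def)
      then show "\<exists>v\<in>carrier_vec (length (?b 0)). h - vec 1 (\<lambda>_. 1) \<bullet> v \<in> I"
        by (intro bexI[of _ "vec 1 (\<lambda>_. h)"]) (simp_all add: ideal_subspace_0[OF I])
    qed
    show "{v \<in> carrier_vec (length (?b 0)). vec 1 (\<lambda>_. 1) \<bullet> v \<in> I} = (\<lambda>w. ?\<phi> 0 *\<^sub>v w) ` carrier_vec (length (?b 1))"
    proof (intro subset_antisym subsetI)
      fix v assume v: "v \<in> {v \<in> carrier_vec (length (?b 0)). vec 1 (\<lambda>_. 1) \<bullet> v \<in> I}"
      then obtain w where w: "w \<in> carrier_vec (length (b 0))" "v $ 0 = g \<bullet> w" using in_I one by force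
      have "v = ?r *\<^sub>v w" unfolding rv using v w by (intro eq_vecI) auto
      then show "v \<in> (\<lambda>w. ?\<phi> 0 *\<^sub>v w) ` carrier_vec (length (?b 1))" using w by auto
    next
      fix v assume "v \<in> (\<lambda>w. ?\<phi> 0 *\<^sub>v w) ` carrier_vec (length (?b 1))"
      then obtain w where "w \<in> carrier_vec (length (b 0))" "v = vec 1 (\<lambda>_. g \<bullet> w)" by (auto simp: rv')
      then show "v \<in> {v \<in> carrier_vec (length (?b 0)). vec 1 (\<lambda>_. 1) \<bullet> v \<in> I}" using gv by (simp add: one[unfolded One_nat_def])
    qed
    show "\<forall>i. {v \<in> carrier_vec (length (?b (Suc i))). ?\<phi> i *\<^sub>v v = 0\<^sub>v (length (?b i))} =
      (\<lambda>w. ?\<phi> (Suc i) *\<^sub>v w) ` carrier_vec (length (?b (Suc (Suc i))))"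
    proof
      fix i
      show "{v \<in> carrier_vec (length (?b (Suc i))). ?\<phi> i *\<^sub>v v = 0\<^sub>v (length (?b i))} =
        (\<lambda>w. ?\<phi> (Suc i) *\<^sub>v w) ` carrier_vec (length (?b (Suc (Suc i))))"
      proof (cases i)
        case 0
        have "vec 1 (\<lambda>_. g \<bullet> v) = 0\<^sub>v 1 \<longleftrightarrow> g \<bullet> v = 0" for v
          by (auto simp: vec_eq_iff)
        then show ?thesis using D(4) by (simp add: 0 rv')
      next
        case (Suc j)
        then show ?thesis using D(7)[of j] by (simp add: exact_at_def)
      qed
    qed
    show "\<forall>i. \<forall>p<length (?b i). \<forall>q<length (?b (Suc i)). ?\<phi> i $$ (p, q) \<in> irrelevant_ideal"
    proof (intro allI impI)
      fix i p q assume pq: "p < length (?b i)" "q < length (?b (Suc i))"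
      show "?\<phi> i $$ (p, q) \<in> irrelevant_ideal"
      proof (cases i)
        case 0
        then show ?thesis using pq irr by (simp add: irrelevant_iff)
      next
        case (Suc j)
        then show ?thesis using pq D(6)[of j] car[of j] by (simp add: irr_mat_def irrelevant_iff)
      qed
    qed
  qed simp
qed

lemma carrier_vec_0: "carrier_vec 0 = {vNil}"
  by (auto intro!: eq_vecI)

lemma zero_mat_mult_vNil: "(0\<^sub>m a 0 :: 'r::comm_ring_1 mat) *\<^sub>v vNil = 0\<^sub>v a"
  by (intro eq_vecI) (auto simp: scalar_prod_def)

text \<open>This covers the quotient by the whole ring, which arises from an arrangement of one
  hyperplane.\<close>

lemma minimal_resolution_zero_module:
  "minimal_graded_free_resolution UNIV UNIV (\<lambda>_. []) (vec 0 (\<lambda>_. 0)) (\<lambda>_. 0\<^sub>m 0 0)"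
  unfolding minimal_graded_free_resolution_def by (auto simp: carrier_vec_0 zero_mat_mult_vNil)

lemma sum_lessThan_add:
  fixes h :: "nat \<Rightarrow> 'a::comm_monoid_add"
  shows "(\<Sum>q<a + b. h q) = (\<Sum>q<a. h q) + (\<Sum>j<b. h (a + j))"
  by (induction b) (simp_all add: add.assoc)

section \<open>The explicit resolution of the pencil ideal\<close>

context pencil_partition
begin

text \<open>\<open>F i * z i\<close> lacks only the form of \<open>B i\<close>, and
  \<open>F i * Y i\<close> replaces the \<open>card (G i)\<close> forms of a pencil by one; all
  relations have the degree of \<open>f\<close>.\<close>

definition res_degs :: "nat \<Rightarrow> int list" where
  "res_degs i = (if i = 0 then replicate k (int (card A) - 1) @ map (\<lambda>i. int (card A) - int (card (G i)) + 1) [0..<m]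
     else if i = 1 then replicate (m + (k - 1)) (int (card A)) else [])"

definition res_gens :: "('v, 'k) mpoly vec" where
  "res_gens = vec (k + m) (\<lambda>p. if p < k then F p * z p else F (p - k) * Y (p - k))"

text \<open>The relations are \<open>z\<^sub>q (F\<^sub>q Y\<^sub>q) = Y\<^sub>q (F\<^sub>q z\<^sub>q)\<close> for \<open>q < m\<close> and, since \<open>L (B j) F\<^sub>j z\<^sub>j = f\<close> for every \<open>j\<close>,
  the differences of these equations for \<open>j\<close> and \<open>k - 1\<close>.\<close>

definition res_rels :: "('v, 'k) mpoly mat" where
  "res_rels = mat (k + m) (m + (k - 1)) (\<lambda>(p, q).
     if q < m then (if p = q then - Y q else if p = k + q then z q else 0)
     else (if p = q - m then L (B p) else if p = k - 1 then - L (B (k - 1)) else 0))"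

definition res_maps :: "nat \<Rightarrow> ('v, 'k) mpoly mat" where
  "res_maps i = (if i = 0 then res_rels else if i = 1 then 0\<^sub>m (m + (k - 1)) 0 else 0\<^sub>m 0 0)"

lemma len_res_degs: "length (res_degs 0) = k + m" "length (res_degs (Suc 0)) = m + (k - 1)"
  "length (res_degs (Suc (Suc i))) = 0"
  by (simp_all add: res_degs_def)

lemma res_degs_nth:
  "p < k \<Longrightarrow> res_degs 0 ! p = int (card A) - 1"
  "i < m \<Longrightarrow> res_degs 0 ! (k + i) = int (card A) - int (card (G i)) + 1"
  "q < m + (k - 1) \<Longrightarrow> res_degs (Suc 0) ! q = int (card A)"
  by (simp_all add: res_degs_def nth_append)

lemma homogeneous_L: "homogeneous 1 (L H)" and homogeneous_Y: "homogeneous 1 (Y i)"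
  by (simp_all add: L_def Y_def homogeneous_linear_form)

lemma homogeneous_F:
  assumes "i < k" shows "homogeneous (int (card A) - int (card (G i))) (F i)"
proof -
  have "card (A - G i) = card A - card (G i)" "card (G i) \<le> card A"
    using G_sub[OF assms] finite_A finite_G[OF assms] by (simp_all add: card_Diff_subset card_mono)
  then have "int (card (A - G i)) = int (card A) - int (card (G i))" by simp
  moreover have "homogeneous (int (card (A - G i))) (F i)"
    unfolding F_def by (rule homogeneous_prod) (rule homogeneous_L)
  ultimately show ?thesis by simp
qed

lemma homogeneous_z:
  assumes "i < k" shows "homogeneous (int (card (G i)) - 1) (z i)"
proof -
  have "0 < card (G i)" using B_in[OF assms] finite_G[OF assms] by (auto simp: card_gt_0_iff)
  then have "int (card (G i - {B i})) = int (card (G i)) - 1"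
    using B_in[OF assms] by (simp add: card_Diff_singleton of_nat_diff)
  moreover have "homogeneous (int (card (G i - {B i}))) (z i)"
    unfolding z_def by (rule homogeneous_prod) (rule homogeneous_L)
  ultimately show ?thesis by simp
qed

lemma homogeneous_Fz: "i < k \<Longrightarrow> homogeneous (int (card A) - 1) (F i * z i)"
  using homogeneous_mult[OF homogeneous_F homogeneous_z, of i i] by simp

lemma homogeneous_FY: "i < k \<Longrightarrow> homogeneous (int (card A) - int (card (G i)) + 1) (F i * Y i)"
  using homogeneous_mult[OF homogeneous_F homogeneous_Y, of i i] by simp

lemma R_hcomp:
  assumes "p \<in> R" shows "hcomp j p \<in> R"
proof -
  obtain \<alpha> \<beta> where p: "p = comb \<alpha> \<beta>" using assms by (auto simp: R_def)
  have "p = (\<Sum>i<k. (F i * z i) * \<alpha> i + (F i * Y i) * \<beta> i)"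
    unfolding p comb_def by (intro sum.cong refl) (simp add: algebra_simps)
  then have "hcomp j p = (\<Sum>i<k. hcomp j ((F i * z i) * \<alpha> i) + hcomp j ((F i * Y i) * \<beta> i))"
    by (simp add: hcomp_sum hcomp_add)
  also have "\<dots> = (\<Sum>i<k. hcomp (j - (int (card A) - 1)) (\<alpha> i) * (F i * z i)
      + hcomp (j - (int (card A) - int (card (G i)) + 1)) (\<beta> i) * (F i * Y i))"
  proof (intro sum.cong refl)
    fix i assume "i \<in> {..<k}"
    then have i: "i < k" by simp
    show "hcomp j ((F i * z i) * \<alpha> i) + hcomp j ((F i * Y i) * \<beta> i)
      = hcomp (j - (int (card A) - 1)) (\<alpha> i) * (F i * z i)
      + hcomp (j - (int (card A) - int (card (G i)) + 1)) (\<beta> i) * (F i * Y i)"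
      using hcomp_mult[OF homogeneous_Fz[OF i], of "j - (int (card A) - 1)" "\<alpha> i"]
        hcomp_mult[OF homogeneous_FY[OF i], of "j - (int (card A) - int (card (G i)) + 1)" "\<beta> i"]
      by (simp add: mult.commute)
  qed
  also have "\<dots> \<in> R"
    by (intro ideal_subspace_sum[OF R_ideal] ideal_subspace_add[OF R_ideal
          ideal_subspace_scale[OF R_ideal z_gen_in_R] ideal_subspace_scale[OF R_ideal Y_gen_in_R]]) simp_all
  finally show ?thesis .
qed

lemma res_gens_dot:
  assumes "v \<in> carrier_vec (k + m)"
  shows "res_gens \<bullet> v = comb (\<lambda>i. v $ i) (\<lambda>i. if i < m then v $ (k + i) else 0)"
proof -
  have "res_gens \<bullet> v = (\<Sum>i<k. F i * z i * v $ i) + (\<Sum>i<m. F i * Y i * v $ (k + i))"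
    using assms by (simp add: scalar_prod_def res_gens_def atLeast0LessThan sum_lessThan_add)
  also have "(\<Sum>i<m. F i * Y i * v $ (k + i)) = (\<Sum>i<k. F i * Y i * (if i < m then v $ (k + i) else 0))"
    by (rule sum.mono_neutral_cong_left) (use m_le_k in auto)
  also have "(\<Sum>i<k. F i * z i * v $ i) + \<dots> = comb (\<lambda>i. v $ i) (\<lambda>i. if i < m then v $ (k + i) else 0)"
    unfolding comb_def sum.distrib[symmetric] by (intro sum.cong refl) (simp add: algebra_simps)
  finally show ?thesis .
qed

text \<open>The coefficients \<open>\<gamma> j\<close> of a syzygy, which sum to zero:
  \<open>w\<close> records only those with \<open>j < k - 1\<close>, so the last one is minus the
  sum of the others.\<close>

definition rel_coeff :: "('v, 'k) mpoly vec \<Rightarrow> nat \<Rightarrow> ('v, 'k) mpoly" where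
  "rel_coeff w j = (if j < k - 1 then w $ (m + j) else - (\<Sum>j<k - 1. w $ (m + j)))"

lemma sum_rel_coeff: "(\<Sum>j<k. rel_coeff w j) = 0"
proof -
  have "{..<k} = insert (k - 1) {..<k - 1}" using k_pos by auto
  then show ?thesis by (simp add: rel_coeff_def)
qed

lemma res_rels_mult:
  assumes w: "w \<in> carrier_vec (m + (k - 1))"
  shows "p < k \<Longrightarrow> (res_rels *\<^sub>v w) $ p = rel_coeff w p * L (B p) - (if p < m then w $ p else 0) * Y p"
    and "i < m \<Longrightarrow> (res_rels *\<^sub>v w) $ (k + i) = w $ i * z i"
proof -
  have e: "(res_rels *\<^sub>v w) $ p = (\<Sum>q<m. (if p = q then - Y q else if p = k + q then z q else 0) * w $ q)
      + (\<Sum>j<k - 1. (if p = j then L (B p) else if p = k - 1 then - L (B (k - 1)) else 0) * w $ (m + j))"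
    if "p < k + m" for p
    using w that by (simp add: res_rels_def scalar_prod_def atLeast0LessThan sum_lessThan_add)
  {
    assume p: "p < k"
    have "(\<Sum>q<m. (if p = q then - Y q else if p = k + q then z q else 0) * w $ q)
        = (\<Sum>q<m. if q = p then - (w $ p * Y p) else 0)"
      using p by (intro sum.cong refl) (auto simp: mult.commute)
    also have "\<dots> = - ((if p < m then w $ p else 0) * Y p)" by simp
    finally have 1: "(\<Sum>q<m. (if p = q then - Y q else if p = k + q then z q else 0) * w $ q)
        = - ((if p < m then w $ p else 0) * Y p)" .
    have 2: "(\<Sum>j<k - 1. (if p = j then L (B p) else if p = k - 1 then - L (B (k - 1)) else 0) * w $ (m + j))
        = rel_coeff w p * L (B p)"
    proof (cases "p < k - 1")
      case True
      then have "(\<Sum>j<k - 1. (if p = j then L (B p) else if p = k - 1 then - L (B (k - 1)) else 0) * w $ (m + j))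
        = (\<Sum>j<k - 1. if j = p then w $ (m + p) * L (B p) else 0)"
        by (intro sum.cong refl) (auto simp: mult.commute)
      then show ?thesis using True by (simp add: rel_coeff_def)
    next
      case False
      then have p': "p = k - 1" using p by simp
      have "(\<Sum>j<k - 1. (if p = j then L (B p) else if p = k - 1 then - L (B (k - 1)) else 0) * w $ (m + j))
        = (\<Sum>j<k - 1. - (w $ (m + j)) * L (B p))"
        by (intro sum.cong refl) (auto simp: p' mult.commute)
      then show ?thesis using False by (simp add: rel_coeff_def sum_distrib_right sum_negf)
    qed
    show "(res_rels *\<^sub>v w) $ p = rel_coeff w p * L (B p) - (if p < m then w $ p else 0) * Y p"
      using e[of p] p unfolding 1 2 by simp
  }
  {
    assume i: "i < m"
    have "(\<Sum>q<m. (if k + i = q then - Y q else if k + i = k + q then z q else 0) * w $ q)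
        = (\<Sum>q<m. if q = i then w $ i * z i else 0)"
      using i m_le_k by (intro sum.cong refl) (auto simp: mult.commute)
    moreover have "(\<Sum>j<k - 1. (if k + i = j then L (B (k + i)) else if k + i = k - 1 then - L (B (k - 1)) else 0) * w $ (m + j)) = 0"
      using k_pos by (intro sum.neutral) auto
    ultimately show "(res_rels *\<^sub>v w) $ (k + i) = w $ i * z i" using e[of "k + i"] i by simp
  }
qed

lemma res_rels_carrier: "res_rels \<in> carrier_mat (k + m) (m + (k - 1))"
  by (simp add: res_rels_def)

lemma UNIV_not_sub_Hp: "H \<in> A \<Longrightarrow> \<not> UNIV \<subseteq> Hp H"
  using l_pt by (metis UNIV_I hyperplane_iff subsetD zero_neq_one)

lemma syzygies_global:
  assumes "comb \<alpha> \<beta> = 0"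
  shows "\<exists>\<gamma> \<delta>. (\<forall>i<k. \<alpha> i = \<gamma> i * L (B i) - \<delta> i * Y i \<and> \<beta> i = \<delta> i * z i) \<and> (\<Sum>i<k. \<gamma> i) = 0"
proof -
  have "\<exists>\<gamma> \<delta>. (\<forall>i<k. van UNIV (\<alpha> i - (\<gamma> i * L (B i) - \<delta> i * Y i)) \<and> van UNIV (\<beta> i - \<delta> i * z i)) \<and>
      van UNIV (\<Sum>i<k. \<gamma> i)"
    by (rule syzygies[OF flat_UNIV]) (use l_dist Hp_not_sub_Yp UNIV_not_sub_Hp assms in auto)
  then show ?thesis by simp
qed

text \<open>The kernel consists of the tuples described by \<open>syzygies_global\<close>, and
  omitting the last \<open>\<gamma>\<close> parametrises them freely. Conversely, a combination of
  columns is sent to \<open>f\<close> times the sum of the \<open>rel_coeff\<close>, which is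
  zero.\<close>

lemma res_kernel:
  "{v \<in> carrier_vec (k + m). res_gens \<bullet> v = 0} = (\<lambda>w. res_rels *\<^sub>v w) ` carrier_vec (m + (k - 1))"
proof (intro subset_antisym subsetI)
  fix v assume "v \<in> {v \<in> carrier_vec (k + m). res_gens \<bullet> v = 0}"
  then have v: "v \<in> carrier_vec (k + m)" "comb (\<lambda>i. v $ i) (\<lambda>i. if i < m then v $ (k + i) else 0) = 0"
    using res_gens_dot[of v] by auto
  obtain \<gamma> \<delta> where gd: "\<And>i. i < k \<Longrightarrow> v $ i = \<gamma> i * L (B i) - \<delta> i * Y i"
    "\<And>i. i < k \<Longrightarrow> (if i < m then v $ (k + i) else 0) = \<delta> i * z i" and gs: "(\<Sum>i<k. \<gamma> i) = 0"
    using syzygies_global[OF v(2)] by blast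
  define w where "w = vec (m + (k - 1)) (\<lambda>q. if q < m then \<delta> q else \<gamma> (q - m))"
  have w: "w \<in> carrier_vec (m + (k - 1))" by (simp add: w_def)
  have rc: "rel_coeff w p = \<gamma> p" if p: "p < k" for p
  proof (cases "p < k - 1")
    case False
    then have p': "p = k - 1" using p by simp
    have "{..<k} = insert (k - 1) {..<k - 1}" using k_pos by auto
    then have "\<gamma> (k - 1) + (\<Sum>i<k - 1. \<gamma> i) = 0" using gs by simp
    then show ?thesis by (simp add: rel_coeff_def w_def p' eq_neg_iff_add_eq_0 neg_eq_iff_add_eq_0 add.commute)
  qed (simp add: rel_coeff_def w_def)
  have "v = res_rels *\<^sub>v w"
  proof (rule eq_vecI)
    show "dim_vec v = dim_vec (res_rels *\<^sub>v w)" using v res_rels_carrier by simp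
    fix p assume "p < dim_vec (res_rels *\<^sub>v w)"
    then have p: "p < k + m" using res_rels_carrier by simp
    show "v $ p = (res_rels *\<^sub>v w) $ p"
    proof (cases "p < k")
      case True
      then show ?thesis
        using res_rels_mult(1)[OF w True] gd(1)[OF True] rc[OF True] Y_single[of p] by (auto simp: w_def)
    next
      case False
      then have i: "p - k < m" "k + (p - k) = p" using p by auto
      then show ?thesis using res_rels_mult(2)[OF w i(1)] gd(2)[of "p - k"] m_le_k by (simp add: w_def)
    qed
  qed
  then show "v \<in> (\<lambda>w. res_rels *\<^sub>v w) ` carrier_vec (m + (k - 1))" using w by blast
next
  fix v assume "v \<in> (\<lambda>w. res_rels *\<^sub>v w) ` carrier_vec (m + (k - 1))"
  then obtain w where w: "w \<in> carrier_vec (m + (k - 1))" and vw: "v = res_rels *\<^sub>v w" by blast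
  have v: "v \<in> carrier_vec (k + m)" unfolding vw by (rule mult_mat_vec_carrier[OF res_rels_carrier w])
  have "res_gens \<bullet> v = (\<Sum>i<k. rel_coeff w i * f)"
    unfolding res_gens_dot[OF v] comb_def
  proof (intro sum.cong refl)
    fix i assume "i \<in> {..<k}"
    then have i: "i < k" by simp
    show "F i * (v $ i * z i + (if i < m then v $ (k + i) else 0) * Y i) = rel_coeff w i * f"
    proof (cases "i < m")
      case True
      show ?thesis
        unfolding vw res_rels_mult(1)[OF w i] res_rels_mult(2)[OF w True] f_eq[OF i]
        using True by (simp add: algebra_simps)
    next
      case False
      then show ?thesis
        unfolding vw res_rels_mult(1)[OF w i] f_eq[OF i] by (simp add: algebra_simps)
    qed
  qed
  also have "\<dots> = 0" by (simp add: sum_rel_coeff flip: sum_distrib_right)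
  finally show "v \<in> {v \<in> carrier_vec (k + m). res_gens \<bullet> v = 0}" using v by simp
qed

text \<open>The rows belonging to the \<open>F i * Y i\<close> show \<open>w $ i * z i\<close> and
  so determine the first \<open>m\<close> coordinates; the others then appear multiplied by forms
  \<open>L (B j)\<close>.\<close>

lemma res_injective:
  assumes w: "w \<in> carrier_vec (m + (k - 1))" and 0: "res_rels *\<^sub>v w = 0\<^sub>v (k + m)"
  shows "w = 0\<^sub>v (m + (k - 1))"
proof (rule eq_vecI)
  have d0: "w $ i = 0" if i: "i < m" for i
  proof -
    have "w $ i * z i = 0" using res_rels_mult(2)[OF w i] i unfolding 0 by simp
    moreover have "\<not> van UNIV (z i)"
      using i m_le_k G_sub[of i] UNIV_not_sub_Hp by (intro z_not_van flat_UNIV) auto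
    ultimately show ?thesis using mpoly_no_zero_divisors by auto
  qed
  fix q assume "q < dim_vec (0\<^sub>v (m + (k - 1)) :: ('v, 'k) mpoly vec)"
  then have q: "q < m + (k - 1)" by simp
  show "w $ q = 0\<^sub>v (m + (k - 1)) $ q"
  proof (cases "q < m")
    case False
    then have j: "q - m < k - 1" using q by simp
    then have jk: "q - m < k" by simp
    have "rel_coeff w (q - m) * L (B (q - m)) = 0"
      using res_rels_mult(1)[OF w jk] jk d0[of "q - m"] unfolding 0 by (simp split: if_splits)
    moreover have "\<not> van UNIV (L (B (q - m)))" using UNIV_not_sub_Hp[OF B_A[OF jk]] by (simp only: van_L_iff) simp
    ultimately have "rel_coeff w (q - m) = 0" using mpoly_no_zero_divisors by auto
    then show ?thesis using j q False by (simp add: rel_coeff_def)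
  qed (use d0 q in simp)
qed (use w in simp)

theorem resolution_R: "minimal_graded_free_resolution R {0} res_degs res_gens res_maps"
  unfolding minimal_graded_free_resolution_def
proof (intro conjI)
  show "res_gens \<in> carrier_vec (length (res_degs 0))" by (simp add: res_gens_def len_res_degs)
  show "\<forall>i. res_maps i \<in> carrier_mat (length (res_degs i)) (length (res_degs (Suc i)))"
    using res_rels_carrier by (simp add: res_maps_def res_degs_def)
  show "\<forall>p<length (res_degs 0). res_gens $ p \<in> R \<and> homogeneous (res_degs 0 ! p) (res_gens $ p)"
  proof (intro allI impI)
    fix p assume "p < length (res_degs 0)"
    then have p: "p < k + m" by (simp add: len_res_degs)
    show "res_gens $ p \<in> R \<and> homogeneous (res_degs 0 ! p) (res_gens $ p)"
    proof (cases "p < k")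
      case True
      then show ?thesis using p z_gen_in_R homogeneous_Fz by (simp add: res_gens_def res_degs_nth)
    next
      case False
      then have i: "p - k < m" "p - k < k" "k + (p - k) = p" using p m_le_k by auto
      then show ?thesis
        using False p Y_gen_in_R[OF i(2)] homogeneous_FY[OF i(2)] res_degs_nth(2)[OF i(1)] by (simp add: res_gens_def)
    qed
  qed
  \<comment> \<open>For minimality \<open>z q\<close> must have no constant term; it has a linear
    factor because a pencil contains a hyperplane besides \<open>B q\<close>.\<close>
  have rel_entry: "homogeneous (res_degs (Suc 0) ! q - res_degs 0 ! p) (res_rels $$ (p, q)) \<and> c0 (res_rels $$ (p, q)) = 0"
    if p: "p < k + m" and q: "q < m + (k - 1)" for p q
  proof (cases "q < m")
    case True
    have qk: "q < k" using True m_le_k by simp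
    have "c0 (z q) = 0"
    proof -
      have "\<not> G q \<subseteq> {B q}"
      proof
        assume "G q \<subseteq> {B q}"
        then have "card (G q) \<le> card {B q}" by (intro card_mono) auto
        then show False using G_card[OF True] by simp
      qed
      then obtain H where "H \<in> G q" "H \<noteq> B q" by blast
      then show ?thesis unfolding z_def eval_simps
        using finite_G[OF qk] by (intro prod_zero) (auto simp: L_eval)
    qed
    then show ?thesis
      using True p q qk homogeneous_z[OF qk] homogeneous_uminus[OF homogeneous_Y]
      by (auto simp: res_rels_def res_degs_nth Y_eval)
  next
    case False
    then have "q - m < k" using q by simp
    then show ?thesis
      using False p q homogeneous_L homogeneous_uminus[OF homogeneous_L] k_pos
      by (auto simp: res_rels_def res_degs_nth L_eval)
  qed
  show "\<forall>i. \<forall>p<length (res_degs i). \<forall>q<length (res_degs (Suc i)).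
      homogeneous (res_degs (Suc i) ! q - res_degs i ! p) (res_maps i $$ (p, q))"
  proof (intro allI impI)
    fix i p q assume "p < length (res_degs i)" "q < length (res_degs (Suc i))"
    then show "homogeneous (res_degs (Suc i) ! q - res_degs i ! p) (res_maps i $$ (p, q))"
      using rel_entry by (cases i) (auto simp: len_res_degs res_maps_def)
  qed
  show "\<forall>i. \<forall>p<length (res_degs i). \<forall>q<length (res_degs (Suc i)). res_maps i $$ (p, q) \<in> irrelevant_ideal"
  proof (intro allI impI)
    fix i p q assume "p < length (res_degs i)" "q < length (res_degs (Suc i))"
    then show "res_maps i $$ (p, q) \<in> irrelevant_ideal"
      using rel_entry by (cases i) (auto simp: len_res_degs res_maps_def irrelevant_iff)
  qed
  show "\<forall>h\<in>R. \<exists>v\<in>carrier_vec (length (res_degs 0)). h - res_gens \<bullet> v \<in> {0}"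
  proof
    fix h assume "h \<in> R"
    then obtain \<alpha> \<beta> where h: "h = comb \<alpha> \<beta>" by (auto simp: R_def)
    define v where "v = vec (k + m) (\<lambda>p. if p < k then \<alpha> p else \<beta> (p - k))"
    have v: "v \<in> carrier_vec (k + m)" by (simp add: v_def)
    have "res_gens \<bullet> v = h"
      unfolding res_gens_dot[OF v] h comb_def
      by (intro sum.cong refl) (auto simp: v_def Y_single)
    then show "\<exists>v\<in>carrier_vec (length (res_degs 0)). h - res_gens \<bullet> v \<in> {0}"
      using v by (intro bexI[of _ v]) (simp_all add: len_res_degs)
  qed
  show "{v \<in> carrier_vec (length (res_degs 0)). res_gens \<bullet> v \<in> {0}} = (\<lambda>w. res_maps 0 *\<^sub>v w) ` carrier_vec (length (res_degs 1))"
    using res_kernel by (simp add: len_res_degs res_maps_def)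
  show "\<forall>i. {v \<in> carrier_vec (length (res_degs (Suc i))). res_maps i *\<^sub>v v = 0\<^sub>v (length (res_degs i))} =
      (\<lambda>w. res_maps (Suc i) *\<^sub>v w) ` carrier_vec (length (res_degs (Suc (Suc i))))"
  proof
    fix i
    show "{v \<in> carrier_vec (length (res_degs (Suc i))). res_maps i *\<^sub>v v = 0\<^sub>v (length (res_degs i))} =
      (\<lambda>w. res_maps (Suc i) *\<^sub>v w) ` carrier_vec (length (res_degs (Suc (Suc i))))"
    proof (cases i)
      case 0
      have "res_rels *\<^sub>v 0\<^sub>v (m + (k - 1)) = 0\<^sub>v (k + m)"
        using res_rels_carrier by (intro eq_vecI) (auto simp: scalar_prod_def)
      then show ?thesis using res_injective by (auto simp: 0 len_res_degs res_maps_def carrier_vec_0 zero_mat_mult_vNil)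
    next
      case (Suc j)
      then show ?thesis by (cases j) (auto simp: len_res_degs res_maps_def carrier_vec_0 zero_mat_mult_vNil)
    qed
  qed
qed

end

section \<open>Partition of an arrangement into pencils\<close>

lemma hyperplane_subset_imp_eq:
  fixes a b :: "'v::finite \<Rightarrow> 'k::field"
  assumes sub: "hyperplane a \<subseteq> hyperplane b" and a: "a \<noteq> (\<lambda>_. 0)" and b: "b \<noteq> (\<lambda>_. 0)"
  shows "hyperplane a = hyperplane b"
proof -
  obtain u where u: "a u \<noteq> 0" using a by blast
  have e: "dot b x = dot a x / a u * b u" for x
  proof -
    let ?x = "\<lambda>v. 1 * x v + (- (dot a x / a u)) * vec_unit u v"
    have "dot a ?x = 0" unfolding dot_linear_right using u by simp
    then have "dot b ?x = 0" using sub by (auto simp: hyperplane_iff)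
    then show ?thesis unfolding dot_linear_right by simp
  qed
  have "b u \<noteq> 0"
  proof
    assume "b u = 0"
    then have "b v = 0" for v using e[of "vec_unit v"] by simp
    then show False using b by blast
  qed
  then show ?thesis using u by (auto simp: hyperplane_iff e)
qed

lemma hyperplane_ne_UNIV: "a \<noteq> (\<lambda>_. 0) \<Longrightarrow> hyperplane a \<noteq> UNIV"
  by (metis UNIV_I dot_unit(1) ext hyperplane_iff)

lemma arrangement_antichain:
  assumes "hyperplane_arrangement A" "H \<in> A" "H' \<in> A" "H \<subseteq> H'"
  shows "H = H'"
  using assms hyperplane_subset_imp_eq unfolding hyperplane_arrangement_def by metis

lemma finite_multiple_flats:
  assumes "hyperplane_arrangement A" shows "finite (multiple_flats A)"
proof (rule finite_subset)
  show "multiple_flats A \<subseteq> (\<lambda>(H, H'). H \<inter> H') ` (A \<times> A)"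
    by (auto simp: multiple_flats_def codim2_flats_def)
  show "finite ((\<lambda>(H, H'). H \<inter> H') ` (A \<times> A))" using assms by (simp add: hyperplane_arrangement_def)
qed

locale normalized_arrangement =
  fixes A :: "('v::finite \<Rightarrow> 'k::field_char_0) set set" and l :: "('v \<Rightarrow> 'k) set \<Rightarrow> 'v \<Rightarrow> 'k" and pt :: "'v \<Rightarrow> 'k"
  assumes arr: "hyperplane_arrangement A"
    and l_hyp: "\<And>H. H \<in> A \<Longrightarrow> hyperplane (l H) = H"
    and l_pt: "\<And>H. H \<in> A \<Longrightarrow> dot (l H) pt = 1"
begin

lemma mem_iff: "H \<in> A \<Longrightarrow> x \<in> H \<longleftrightarrow> dot (l H) x = 0"
  using l_hyp hyperplane_iff by blast

text \<open>Points of \<open>H\<close> outside \<open>H'\<close> and of \<open>H'\<close> outside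
  \<open>H\<close> allow any \<open>x\<close> to be moved into the intersection, where the form of
  \<open>K\<close> vanishes; this expresses that form by the other two. The coefficients sum to 1
  because all three forms have value 1 at \<open>pt\<close>.\<close>

lemma span_of_pair:
  assumes "H \<in> A" "H' \<in> A" "H \<noteq> H'" "K \<in> A" "H \<inter> H' \<subseteq> K"
  obtains s t where "s + t = 1" "\<And>x. dot (l K) x = s * dot (l H) x + t * dot (l H') x"
proof -
  obtain p where p: "p \<in> H" "p \<notin> H'" using arrangement_antichain[OF arr] assms by blast
  obtain q where q: "q \<in> H'" "q \<notin> H" using arrangement_antichain[OF arr] assms by blast
  note m = mem_iff[OF assms(1)] mem_iff[OF assms(2)] mem_iff[OF assms(4)]
  have p': "dot (l H) p = 0" "dot (l H') p \<noteq> 0" using p m by auto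
  have q': "dot (l H') q = 0" "dot (l H) q \<noteq> 0" using q m by auto
  define s where "s = dot (l K) q / dot (l H) q"
  define t where "t = dot (l K) p / dot (l H') p"
  have e: "dot (l K) x = s * dot (l H) x + t * dot (l H') x" for x
  proof -
    let ?x = "\<lambda>v. 1 * x v + 1 * ((- (dot (l H) x / dot (l H) q)) * q v + (- (dot (l H') x / dot (l H') p)) * p v)"
    have "dot (l H) ?x = 0" "dot (l H') ?x = 0"
      unfolding dot_linear_right using p' q' by simp_all
    then have "?x \<in> K" using assms(5) m by blast
    then have "dot (l K) ?x = 0" using m by blast
    then show ?thesis unfolding dot_linear_right by (simp add: s_def t_def algebra_simps)
  qed
  have "s + t = 1" using e[of pt] assms l_pt by simp
  then show ?thesis using e that by blast
qed

text \<open>By the normalisation a member of the pencil is determined by one coefficient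
  \<open>s\<close>. On the intersection of two members with different \<open>s\<close>, the forms of
  \<open>H\<close> and \<open>H'\<close> are equal and therefore zero.\<close>

lemma flat_eq_Int:
  assumes P: "P \<in> codim2_flats A" and K: "K \<in> A" "K' \<in> A" "K \<noteq> K'" "P \<subseteq> K" "P \<subseteq> K'"
  shows "P = K \<inter> K'"
proof
  obtain H H' where H: "H \<in> A" "H' \<in> A" "H \<noteq> H'" "P = H \<inter> H'" using P by (auto simp: codim2_flats_def)
  obtain s t where st: "s + t = 1" "\<And>x. dot (l K) x = s * dot (l H) x + t * dot (l H') x"
    using span_of_pair[OF H(1-3) K(1)] K(4) H(4) by blast
  obtain s' t' where st': "s' + t' = 1" "\<And>x. dot (l K') x = s' * dot (l H) x + t' * dot (l H') x"
    using span_of_pair[OF H(1-3) K(2)] K(5) H(4) by blast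
  have t: "t = 1 - s" "t' = 1 - s'" using st st' by (simp_all add: algebra_simps)
  have ne: "s \<noteq> s'"
  proof
    assume "s = s'"
    then have "dot (l K) x = dot (l K') x" for x using st(2) st'(2) t by simp
    then have "x \<in> K \<longleftrightarrow> x \<in> K'" for x using mem_iff[OF K(1)] mem_iff[OF K(2)] by simp
    then have "K = K'" by blast
    then show False using K by simp
  qed
  show "K \<inter> K' \<subseteq> P"
  proof
    fix x assume x: "x \<in> K \<inter> K'"
    then have 0: "s * dot (l H) x + (1 - s) * dot (l H') x = 0" "s' * dot (l H) x + (1 - s') * dot (l H') x = 0"
      using mem_iff K st(2) st'(2) t by auto
    have "(s - s') * (dot (l H) x - dot (l H') x)
        = (s * dot (l H) x + (1 - s) * dot (l H') x) - (s' * dot (l H) x + (1 - s') * dot (l H') x)"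
      by (simp add: algebra_simps)
    then have "dot (l H) x = dot (l H') x" using 0 ne by simp
    moreover from this have "dot (l H) x = 0" using 0(1) by (simp add: algebra_simps)
    ultimately show "x \<in> P" using H mem_iff by auto
  qed
qed (use K in blast)

text \<open>\<open>disj\<close> makes the groups through different multiple flats disjoint. In a
  pencil, \<open>y i\<close> is the difference of the forms of two members \<open>B i\<close> and
  \<open>K i\<close>, which is zero at \<open>pt\<close> by the normalisation; every member is an
  affine combination of the two, hence \<open>l (B i)\<close> plus a multiple of
  \<open>y i\<close>.\<close>

lemma pencil_partition:
  assumes disj: "\<And>H P Q. H \<in> A \<Longrightarrow> P \<in> multiple_flats A \<Longrightarrow> Q \<in> multiple_flats A \<Longrightarrow> P \<subseteq> H \<Longrightarrow> Q \<subseteq> H \<Longrightarrow> P = Q"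
    and Ps: "distinct Ps" "set Ps = multiple_flats A"
    and Ss: "distinct Ss" "set Ss = {H \<in> A. \<not> (\<exists>P\<in>multiple_flats A. P \<subseteq> H)}"
  defines "G \<equiv> \<lambda>i. if i < length Ps then {H \<in> A. Ps ! i \<subseteq> H} else {Ss ! (i - length Ps)}"
  shows "\<exists>B y. pencil_partition A l G B y (length Ps) (length Ps + length Ss) pt"
proof -
  let ?m = "length Ps" and ?k = "length Ps + length Ss"
  have finA: "finite A" using arr by (simp add: hyperplane_arrangement_def)
  have PsM: "Ps ! i \<in> multiple_flats A" if "i < ?m" for i using Ps that nth_mem by blast
  have G_card: "3 \<le> card (G i)" if "i < ?m" for i
    using PsM[OF that] that by (simp add: G_def multiple_flats_def hyperplanes_through_def)
  have "\<exists>H K. H \<in> G i \<and> K \<in> G i \<and> H \<noteq> K" if i: "i < ?m" for i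
  proof (rule ccontr)
    assume no: "\<not> ?thesis"
    have "G i \<noteq> {}" using G_card[OF i] by auto
    then obtain H where "G i \<subseteq> {H}" using no by blast
    then have "card (G i) \<le> card {H}" by (intro card_mono) auto
    then show False using G_card[OF i] by simp
  qed
  then obtain B0 K where BK: "\<And>i. i < ?m \<Longrightarrow> B0 i \<in> G i \<and> K i \<in> G i \<and> B0 i \<noteq> K i" by metis
  define B where "B i = (if i < ?m then B0 i else Ss ! (i - ?m))" for i
  define y where "y i = (if i < ?m then (\<lambda>v. 1 * l (K i) v + (- 1) * l (B i) v) else (\<lambda>_. 0))" for i
  have y: "dot (y i) x = dot (l (K i)) x - dot (l (B i)) x" if "i < ?m" for i x
    using that dot_linear_left[of 1 "l (K i)" "- 1" "l (B i)" x] by (simp add: y_def)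
  have BKA: "B i \<in> A" "K i \<in> A" "B i \<noteq> K i" "Ps ! i \<subseteq> B i" "Ps ! i \<subseteq> K i" if "i < ?m" for i
    using BK[OF that] that by (auto simp: B_def G_def)
  have Ss_A: "Ss ! (i - ?m) \<in> A" "\<And>P. P \<in> multiple_flats A \<Longrightarrow> \<not> P \<subseteq> Ss ! (i - ?m)"
    if "?m \<le> i" "i < ?k" for i
  proof -
    have "Ss ! (i - ?m) \<in> set Ss" using that by (intro nth_mem) simp
    then show "Ss ! (i - ?m) \<in> A" "\<And>P. P \<in> multiple_flats A \<Longrightarrow> \<not> P \<subseteq> Ss ! (i - ?m)" using Ss by auto
  qed
  have A_eq: "A = (\<Union>i<?k. G i)"
  proof (intro subset_antisym subsetI)
    fix H assume H: "H \<in> A"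
    show "H \<in> (\<Union>i<?k. G i)"
    proof (cases "\<exists>P\<in>multiple_flats A. P \<subseteq> H")
      case True
      then obtain i where "i < ?m" "Ps ! i \<subseteq> H" using Ps by (metis in_set_conv_nth)
      then show ?thesis using H by (intro UN_I[of i]) (auto simp: G_def)
    next
      case False
      then have "H \<in> set Ss" using H Ss by blast
      then obtain j where "j < length Ss" "Ss ! j = H" by (auto simp: in_set_conv_nth)
      then show ?thesis by (intro UN_I[of "?m + j"]) (auto simp: G_def)
    qed
  next
    fix H assume "H \<in> (\<Union>i<?k. G i)"
    then obtain i where "i < ?k" "H \<in> G i" by blast
    then show "H \<in> A" using Ss_A(1)[of i] by (auto simp: G_def split: if_splits)
  qed
  have "pencil_partition A l G B y ?m ?k pt"
  proof
    show "finite A" "?m \<le> ?k" "A = (\<Union>i<?k. G i)" using finA A_eq by simp_all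
    show "0 < ?k"
    proof (rule ccontr)
      assume "\<not> 0 < ?k"
      then have "A = {}" using A_eq by simp
      then show False using arr by (simp add: hyperplane_arrangement_def)
    qed
    show "G i \<inter> G j = {}" if ij: "i < ?k" "j < ?k" "i \<noteq> j" for i j
    proof (rule ccontr)
      assume "G i \<inter> G j \<noteq> {}"
      then obtain H where H: "H \<in> G i" "H \<in> G j" by blast
      consider "i < ?m" "j < ?m" | "i < ?m" "?m \<le> j" | "?m \<le> i" "j < ?m" | "?m \<le> i" "?m \<le> j" by linarith
      then show False
      proof cases
        case 1
        then have "Ps ! i = Ps ! j" using H disj[of H "Ps ! i" "Ps ! j"] PsM by (simp add: G_def)
        then show False using ij 1 Ps(1) by (simp add: nth_eq_iff_index_eq)
      next
        case 2
        then show False using H Ss_A(2)[OF 2(2) ij(2) PsM[OF 2(1)]] by (simp add: G_def)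
      next
        case 3
        then show False using H Ss_A(2)[OF 3(1) ij(1) PsM[OF 3(2)]] by (simp add: G_def)
      next
        case 4
        then have "Ss ! (i - ?m) = Ss ! (j - ?m)" using H by (simp add: G_def)
        then have "i - ?m = j - ?m" using ij 4 Ss(1) by (simp add: nth_eq_iff_index_eq)
        then show False using ij 4 by simp
      qed
    qed
    show "B i \<in> G i" if "i < ?k" for i using BK[of i] by (auto simp: B_def G_def)
    show "dot (l H) pt = 1" if "H \<in> A" for H using l_pt that .
    show "\<not> hyperplane (l H) \<subseteq> hyperplane (l H')" if "H \<in> A" "H' \<in> A" "H \<noteq> H'" for H H'
      using arrangement_antichain[OF arr] that by (auto simp only: l_hyp)
    show "3 \<le> card (G i)" if "i < ?m" for i using G_card that .
    show "G i = {B i}" "y i = (\<lambda>_. 0)" if "?m \<le> i" "i < ?k" for i using that by (simp_all add: G_def B_def y_def)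
    show "y i \<noteq> (\<lambda>_. 0)" if i: "i < ?m" for i
    proof
      assume "y i = (\<lambda>_. 0)"
      then have "dot (l (K i)) x = dot (l (B i)) x" for x using y[OF i, of x] by simp
      then have "x \<in> K i \<longleftrightarrow> x \<in> B i" for x
        using mem_iff[OF BKA(1)[OF i]] mem_iff[OF BKA(2)[OF i]] by simp
      then have "K i = B i" by blast
      then show False using BKA(3)[OF i] by simp
    qed
    show "dot (y i) pt = 0" if "i < ?m" for i using y[OF that] BKA[OF that] l_pt by simp
    show "\<exists>c. \<forall>v. l H v = l (B i) v + c * y i v" if i: "i < ?m" and H: "H \<in> G i" for i H
    proof -
      have HA: "H \<in> A" "Ps ! i \<subseteq> H" using H i by (auto simp: G_def)
      have "Ps ! i = B i \<inter> K i"
        by (rule flat_eq_Int) (use PsM[OF i] BKA[OF i] in \<open>auto simp: multiple_flats_def\<close>)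
      then obtain s t where st: "s + t = 1" "\<And>x. dot (l H) x = s * dot (l (B i)) x + t * dot (l (K i)) x"
        using span_of_pair[OF BKA(1-3)[OF i] HA(1)] HA(2) by auto
      have s: "s = 1 - t" using st(1) by (simp add: algebra_simps)
      have yv: "y i v = l (K i) v - l (B i) v" for v using y[OF i, of "vec_unit v"] by simp
      have lv: "l H v = (1 - t) * l (B i) v + t * l (K i) v" for v
        using st(2)[of "vec_unit v"] by (simp add: s)
      have "l H v = l (B i) v + t * y i v" for v
        unfolding lv yv by (simp add: algebra_simps)
      then show ?thesis by blast
    qed
    show "\<exists>i<?m. H \<in> G i \<and> H' \<in> G i \<and> H'' \<in> G i"
      if H: "H \<in> A" "H' \<in> A" "H'' \<in> A" "H \<noteq> H'" "H \<noteq> H''" "H' \<noteq> H''"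
        and sub: "hyperplane (l H) \<inter> hyperplane (l H') \<subseteq> hyperplane (l H'')" for H H' H''
    proof -
      have sub': "H \<inter> H' \<subseteq> H''" using sub H by (simp only: l_hyp)
      have "{H, H', H''} \<subseteq> {K \<in> A. H \<inter> H' \<subseteq> K}" using H sub' by blast
      then have "card {H, H', H''} \<le> card {K \<in> A. H \<inter> H' \<subseteq> K}" using finA by (intro card_mono) auto
      then have "H \<inter> H' \<in> multiple_flats A"
        using H by (auto simp: multiple_flats_def hyperplanes_through_def codim2_flats_def)
      then obtain i where "i < ?m" "Ps ! i = H \<inter> H'" using Ps by (metis in_set_conv_nth)
      then show ?thesis using H sub' by (intro exI[of _ i]) (auto simp: G_def)
    qed
  qed
  then show ?thesis by blast
qed

end

definition residual_degs :: "('v::finite \<Rightarrow> 'k::field) set set \<Rightarrow> nat \<Rightarrow> nat \<Rightarrow> int multiset" where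
  "residual_degs A s = (\<lambda>i. if i = 0 then
      replicate_mset (card (multiple_flats A) + s) (int (card A) - 1) +
      image_mset (\<lambda>P. int (card A) - int (hyperplanes_through A P) + 1) (mset_set (multiple_flats A))
    else if i = 1 then replicate_mset (2 * card (multiple_flats A) + s - 1) (int (card A))
    else {#})"

text \<open>As \<open>f\<close> is nonzero at \<open>a\<close>, all forms can be scaled to value 1
  there, and \<open>f\<close> is the product of the scaled forms up to the nonzero constant
  \<open>C\<close>. The groups come from lists of the multiple flats and of the remaining
  hyperplanes.\<close>

lemma residual_resolution:
  fixes A :: "('v::finite \<Rightarrow> 'k::field_char_0) set set"
  assumes arr: "hyperplane_arrangement A" and f: "defining_polynomial A f"
    and disj: "\<And>H P Q. H \<in> A \<Longrightarrow> P \<in> multiple_flats A \<Longrightarrow> Q \<in> multiple_flats A \<Longrightarrow> P \<subseteq> H \<Longrightarrow> Q \<subseteq> H \<Longrightarrow> P = Q"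
    and s: "s = card {H \<in> A. \<not> (\<exists>P\<in>multiple_flats A. P \<subseteq> H)}"
    and a: "poly_eval f a \<noteq> 0"
  shows "has_minimal_resolution (residual f a) {0} (residual_degs A s)"
    and "cohen_macaulay_quot (residual f a)"
    and "graded_betti UNIV (residual f a) i j =
      (if card A = 1 then 0 else count (case_nat {#0#} (residual_degs A s) i) j)"
proof -
  have finA: "finite A" using arr by (simp add: hyperplane_arrangement_def)
  obtain c where c: "\<And>H. H \<in> A \<Longrightarrow> c H \<noteq> (\<lambda>_. 0) \<and> H = hyperplane (c H)" and fc: "f = (\<Prod>H\<in>A. linear_form (c H))"
    using f by (auto simp: defining_polynomial_def)
  have ca: "dot (c H) a \<noteq> 0" if "H \<in> A" for H
    using a finA that by (auto simp: fc)
  define l where "l H = (\<lambda>v. inverse (dot (c H) a) * c H v + 0 * c H v)" for H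
  have l: "dot (l H) x = inverse (dot (c H) a) * dot (c H) x" for H x
    unfolding l_def dot_linear_left by simp
  define C where "C = (\<Prod>H\<in>A. dot (c H) a)"
  have C: "C \<noteq> 0" using ca finA by (simp add: C_def)
  interpret N: normalized_arrangement A l a
  proof
    show "hyperplane (l H) = H" if "H \<in> A" for H
    proof -
      have "hyperplane (l H) = hyperplane (c H)" using ca[OF that] by (auto simp: hyperplane_iff l)
      then show ?thesis using c[OF that] by simp
    qed
    show "dot (l H) a = 1" if "H \<in> A" for H using ca[OF that] by (simp add: l)
  qed (rule arr)
  have finM: "finite (multiple_flats A)" by (rule finite_multiple_flats[OF arr])
  obtain Ps where Ps: "distinct Ps" "set Ps = multiple_flats A" using finite_distinct_list[OF finM] by blast
  obtain Ss where Ss: "distinct Ss" "set Ss = {H \<in> A. \<not> (\<exists>P\<in>multiple_flats A. P \<subseteq> H)}"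
    using finite_distinct_list[of "{H \<in> A. \<not> (\<exists>P\<in>multiple_flats A. P \<subseteq> H)}"] finA by auto
  have m: "length Ps = card (multiple_flats A)" using distinct_card[OF Ps(1)] Ps(2) by simp
  have lS: "length Ss = s" using distinct_card[OF Ss(1)] Ss(2) s by simp
  define G where "G = (\<lambda>i. if i < length Ps then {H \<in> A. Ps ! i \<subseteq> H} else {Ss ! (i - length Ps)})"
  have "\<exists>B y. pencil_partition A l G B y (length Ps) (length Ps + length Ss) a"
    unfolding G_def
  proof (rule N.pencil_partition[OF _ Ps Ss])
    show "P = Q" if "H \<in> A" "P \<in> multiple_flats A" "Q \<in> multiple_flats A" "P \<subseteq> H" "Q \<subseteq> H" for H P Q
      using disj that .
  qed
  then obtain B y where "pencil_partition A l G B y (length Ps) (length Ps + length Ss) a" by blast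
  then interpret Q: pencil_partition A l G B y "length Ps" "length Ps + length Ss" a .
  have "f = Const C * Q.f"
  proof (rule eval_eqI)
    fix x
    have "(\<Prod>H\<in>A. dot (c H) x) = (\<Prod>H\<in>A. dot (c H) a * dot (l H) x)"
      by (intro prod.cong refl) (use ca in \<open>simp add: l\<close>)
    then show "poly_eval f x = poly_eval (Const C * Q.f) x"
      by (simp add: fc Q.f_def Q.L_eval C_def prod.distrib)
  qed
  then have res: "residual f a = Q.R" using Q.residual_eq_R[OF C] by simp
  have degs: "mset (Q.res_degs i) = residual_degs A s i" for i
  proof -
    have "map (\<lambda>i. int (card A) - int (card (G i)) + 1) [0..<length Ps]
        = map (\<lambda>P. int (card A) - int (hyperplanes_through A P) + 1) Ps"
      by (intro nth_equalityI) (simp_all add: G_def hyperplanes_through_def)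
    then have "mset (map (\<lambda>i. int (card A) - int (card (G i)) + 1) [0..<length Ps])
        = image_mset (\<lambda>P. int (card A) - int (hyperplanes_through A P) + 1) (mset_set (multiple_flats A))"
      using mset_set_set[OF Ps(1)] Ps(2) by simp
    \<comment> \<open>With \<open>m\<close> multiple flats there are \<open>k = m + s\<close> groups
      and \<open>m + (k - 1)\<close> relations; positivity of \<open>k\<close> makes the truncated
      subtraction harmless.\<close>
    moreover have "length Ps + (length Ps + length Ss - 1) = 2 * card (multiple_flats A) + s - 1"
      using Q.k_pos m lS by simp
    ultimately show ?thesis
      unfolding Q.res_degs_def residual_degs_def by (simp add: m lS)
  qed
  have min: "minimal_graded_free_resolution (residual f a) {0} Q.res_degs Q.res_gens Q.res_maps"
    unfolding res by (rule Q.resolution_R)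
  then show "has_minimal_resolution (residual f a) {0} (residual_degs A s)"
    unfolding has_minimal_resolution_def using degs by blast
  have I: "is_ideal (residual f a)" and I_hcomp: "\<And>e p. p \<in> residual f a \<Longrightarrow> hcomp e p \<in> residual f a"
    unfolding res by (rule Q.R_ideal Q.R_hcomp; assumption)+
  have "card A \<noteq> 0" using finA arr by (auto simp: hyperplane_arrangement_def)
  \<comment> \<open>One hyperplane leaves only empty products, so the generator
    \<open>F 0 * z 0\<close> is 1.\<close>
  have one: "residual f a = UNIV" if A1: "card A = 1"
  proof -
    have "A = {B 0}" using A1 Q.B_A[OF Q.k_pos] by (metis card_1_singletonE singletonD)
    moreover have "G 0 \<subseteq> A" "B 0 \<in> G 0" using Q.G_sub Q.B_in Q.k_pos by auto
    ultimately have "A - G 0 = {}" "G 0 - {B 0} = {}" by blast+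
    then have "Q.F 0 * Q.z 0 = 1" by (simp only: Q.F_def Q.z_def prod.empty mult_1)
    then have "1 \<in> Q.R" using Q.z_gen_in_R[OF Q.k_pos] by simp
    then have "p * 1 \<in> Q.R" for p by (rule ideal_subspace_scale[OF Q.R_ideal])
    then show ?thesis unfolding res by auto
  qed
  show "cohen_macaulay_quot (residual f a)"
  proof (cases "card A = 1")
    case True
    then show ?thesis using one by (simp add: cohen_macaulay_quot_def)
  next
    case False
    then have "2 \<le> card A" using \<open>card A \<noteq> 0\<close> by simp
    then show ?thesis unfolding res by (rule Q.cohen_macaulay_R)
  qed
  show "graded_betti UNIV (residual f a) i j =
      (if card A = 1 then 0 else count (case_nat {#0#} (residual_degs A s) i) j)"
  proof (cases "card A = 1")
    case True
    have "has_minimal_resolution UNIV (residual f a) (\<lambda>_. {#})"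
      unfolding has_minimal_resolution_def one[OF True] using minimal_resolution_zero_module by force
    from graded_betti_eq[OF this I I_hcomp] show ?thesis using True by simp
  next
    case False
    then have A2: "2 \<le> card A" using \<open>card A \<noteq> 0\<close> by simp
    have "c0 (Q.res_gens $ p) = 0" if "p < length (Q.res_degs 0)" for p
      using Q.R_constant_term[OF A2] minimal_resolutionD(2)[OF Q.resolution_R that] by blast
    from minimal_resolution_quotient[OF min I this]
    have "has_minimal_resolution UNIV (residual f a) (case_nat {#0#} (residual_degs A s))"
      unfolding has_minimal_resolution_def using degs
      by (intro exI conjI allI) (assumption, simp split: nat.split)
    from graded_betti_eq[OF this I I_hcomp] show ?thesis using False by simp
  qed
qed

section \<open>Combinatorial invariance\<close>

lemma intersection_lattice_Int:
  assumes "X \<in> intersection_lattice A" "Y \<in> intersection_lattice A"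
  shows "X \<inter> Y \<in> intersection_lattice A"
proof -
  obtain S T where "X = \<Inter>S" "S \<subseteq> A" "Y = \<Inter>T" "T \<subseteq> A"
    using assms unfolding intersection_lattice_def by blast
  then have "X \<inter> Y = \<Inter>(S \<union> T)" "S \<union> T \<subseteq> A" by auto
  then show ?thesis unfolding intersection_lattice_def by blast
qed

lemma UNIV_in_lattice: "UNIV \<in> intersection_lattice A"
  unfolding intersection_lattice_def by (auto intro: exI[of _ "{}"])

lemma hyperplane_in_lattice: "H \<in> A \<Longrightarrow> H \<in> intersection_lattice A"
  unfolding intersection_lattice_def by (auto intro: exI[of _ "{H}"])

lemma lattice_sub_hyperplane:
  "X \<in> intersection_lattice A \<Longrightarrow> X \<noteq> UNIV \<Longrightarrow> \<exists>H\<in>A. X \<subseteq> H"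
  unfolding intersection_lattice_def by auto

text \<open>The isomorphism sends the top element to the top element, so it matches the hyperplanes,
  which are the maximal elements below it; it also preserves intersections, which are the meets.
  Codimension two flats and the numbers of hyperplanes through them are determined by these
  data.\<close>

lemma same_combinatorics_transfer:
  fixes A B :: "('v::finite \<Rightarrow> 'k::field) set set"
  assumes A: "hyperplane_arrangement A" and B: "hyperplane_arrangement B" and AB: "same_combinatorics A B"
  shows "\<exists>\<psi>. inj_on \<psi> (intersection_lattice A) \<and> B = \<psi> ` A \<and> multiple_flats B = \<psi> ` multiple_flats A \<and>
    (\<forall>X\<in>intersection_lattice A. \<forall>Y\<in>intersection_lattice A. X \<subseteq> Y \<longleftrightarrow> \<psi> X \<subseteq> \<psi> Y) \<and>
    multiple_flats A \<subseteq> intersection_lattice A \<and>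
    (\<forall>P\<in>multiple_flats A. hyperplanes_through B (\<psi> P) = hyperplanes_through A P)"
proof -
  let ?LA = "intersection_lattice A" and ?LB = "intersection_lattice B"
  obtain \<psi> where bij: "bij_betw \<psi> ?LA ?LB" and ord: "\<And>X Y. X \<in> ?LA \<Longrightarrow> Y \<in> ?LA \<Longrightarrow> X \<subseteq> Y \<longleftrightarrow> \<psi> X \<subseteq> \<psi> Y"
    using AB by (auto simp: same_combinatorics_def)
  have inj: "inj_on \<psi> ?LA" using bij by (simp add: bij_betw_def)
  have im: "\<psi> X \<in> ?LB" if "X \<in> ?LA" for X using bij that by (auto simp: bij_betw_def)
  have pre: "\<exists>X\<in>?LA. \<psi> X = Z" if "Z \<in> ?LB" for Z
  proof -
    have "Z \<in> \<psi> ` ?LA" using bij_betw_imp_surj_on[OF bij] that by simp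
    then obtain X where "Z = \<psi> X" "X \<in> ?LA" by (rule imageE)
    then show ?thesis by (intro bexI[of _ X]) simp_all
  qed
  have nA: "H \<noteq> UNIV" if "H \<in> A" for H using A that hyperplane_ne_UNIV unfolding hyperplane_arrangement_def by metis
  have nB: "H \<noteq> UNIV" if "H \<in> B" for H using B that hyperplane_ne_UNIV unfolding hyperplane_arrangement_def by metis
  have top: "\<psi> UNIV = UNIV"
  proof -
    obtain X where "X \<in> ?LA" "\<psi> X = UNIV" using pre[OF UNIV_in_lattice] by blast
    then show ?thesis using ord[of X UNIV] UNIV_in_lattice[of A] by auto
  qed
  have to_top: "X = UNIV" if "X \<in> ?LA" "\<psi> X = UNIV" for X
    using inj_onD[OF inj, of X UNIV] that top UNIV_in_lattice by auto
  have in_B: "\<psi> H \<in> B" if H: "H \<in> A" for H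
  proof -
    note HL = hyperplane_in_lattice[OF H]
    have "\<psi> H \<noteq> UNIV" using to_top[OF HL] nA[OF H] by blast
    then obtain K where K: "K \<in> B" "\<psi> H \<subseteq> K" using lattice_sub_hyperplane[OF im[OF HL]] by blast
    obtain X where X: "X \<in> ?LA" "\<psi> X = K" using pre[OF hyperplane_in_lattice[OF K(1)]] by blast
    have HX: "H \<subseteq> X" using ord[OF HL X(1)] K X by simp
    have "X \<noteq> UNIV" using X(2) top nB[OF K(1)] by auto
    then obtain H' where H': "H' \<in> A" "X \<subseteq> H'" using lattice_sub_hyperplane[OF X(1)] by blast
    have "H = H'" by (rule arrangement_antichain[OF A H H'(1)]) (use HX H' in blast)
    then have "X = H" using HX H' by blast
    then show ?thesis using X K by simp
  qed
  have onto_B: "\<exists>H\<in>A. \<psi> H = K" if K: "K \<in> B" for K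
  proof -
    obtain X where X: "X \<in> ?LA" "\<psi> X = K" using pre[OF hyperplane_in_lattice[OF K]] by blast
    have "X \<noteq> UNIV" using X(2) top nB[OF K] by auto
    then obtain H where H: "H \<in> A" "X \<subseteq> H" using lattice_sub_hyperplane[OF X(1)] by blast
    have "K \<subseteq> \<psi> H" using ord[OF X(1) hyperplane_in_lattice[OF H(1)]] H X by simp
    then have "K = \<psi> H" using arrangement_antichain[OF B K in_B[OF H(1)]] by blast
    then show ?thesis using H by blast
  qed
  have B_eq: "B = \<psi> ` A" using in_B onto_B by blast
  have meet: "\<psi> (X \<inter> Y) = \<psi> X \<inter> \<psi> Y" if X: "X \<in> ?LA" and Y: "Y \<in> ?LA" for X Y
  proof
    note XY = intersection_lattice_Int[OF X Y]
    show "\<psi> (X \<inter> Y) \<subseteq> \<psi> X \<inter> \<psi> Y" using ord[OF XY X] ord[OF XY Y] by blast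
    obtain Z where Z: "Z \<in> ?LA" "\<psi> Z = \<psi> X \<inter> \<psi> Y"
      using pre[OF intersection_lattice_Int[OF im[OF X] im[OF Y]]] by blast
    have "Z \<subseteq> X" "Z \<subseteq> Y" using ord[OF Z(1) X] ord[OF Z(1) Y] Z(2) by auto
    then show "\<psi> X \<inter> \<psi> Y \<subseteq> \<psi> (X \<inter> Y)" using ord[OF Z(1) XY] Z(2) by auto
  qed
  have inj_A: "\<psi> H = \<psi> H' \<longleftrightarrow> H = H'" if "H \<in> A" "H' \<in> A" for H H'
    using inj_onD[OF inj _ hyperplane_in_lattice[OF that(1)] hyperplane_in_lattice[OF that(2)]] by blast
  have flats_sub: "codim2_flats A \<subseteq> ?LA"
  proof
    fix P assume "P \<in> codim2_flats A"
    then obtain H H' where H: "H \<in> A" "H' \<in> A" "P = H \<inter> H'" by (auto simp: codim2_flats_def)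
    show "P \<in> ?LA" unfolding H(3)
      by (rule intersection_lattice_Int[OF hyperplane_in_lattice[OF H(1)] hyperplane_in_lattice[OF H(2)]])
  qed
  have flats: "codim2_flats B = \<psi> ` codim2_flats A"
  proof (intro subset_antisym subsetI)
    fix P assume "P \<in> codim2_flats B"
    then obtain H H' where H: "H \<in> A" "H' \<in> A" "\<psi> H \<noteq> \<psi> H'" "P = \<psi> H \<inter> \<psi> H'"
      by (auto simp: codim2_flats_def B_eq)
    then have "P = \<psi> (H \<inter> H')"
      using meet[OF hyperplane_in_lattice[OF H(1)] hyperplane_in_lattice[OF H(2)]] by simp
    moreover have "H \<inter> H' \<in> codim2_flats A" using H by (auto simp: codim2_flats_def)
    ultimately show "P \<in> \<psi> ` codim2_flats A" by blast
  next
    fix P assume "P \<in> \<psi> ` codim2_flats A"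
    then obtain H H' where H: "H \<in> A" "H' \<in> A" "H \<noteq> H'" "P = \<psi> (H \<inter> H')"
      by (auto simp: codim2_flats_def)
    then have "P = \<psi> H \<inter> \<psi> H'"
      using meet[OF hyperplane_in_lattice[OF H(1)] hyperplane_in_lattice[OF H(2)]] by simp
    moreover have "\<psi> H \<noteq> \<psi> H'" using H inj_A by blast
    ultimately show "P \<in> codim2_flats B"
      unfolding codim2_flats_def using in_B[OF H(1)] in_B[OF H(2)] by blast
  qed
  have through: "hyperplanes_through B (\<psi> P) = hyperplanes_through A P" if P: "P \<in> ?LA" for P
  proof -
    have PH: "P \<subseteq> H \<longleftrightarrow> \<psi> P \<subseteq> \<psi> H" if "H \<in> A" for H
      by (rule ord[OF P hyperplane_in_lattice[OF that]])
    have "{K \<in> B. \<psi> P \<subseteq> K} = \<psi> ` {H \<in> A. \<psi> P \<subseteq> \<psi> H}" unfolding B_eq by blast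
    also have "{H \<in> A. \<psi> P \<subseteq> \<psi> H} = {H \<in> A. P \<subseteq> H}" using PH by metis
    finally have "{K \<in> B. \<psi> P \<subseteq> K} = \<psi> ` {H \<in> A. P \<subseteq> H}" .
    moreover have "inj_on \<psi> {H \<in> A. P \<subseteq> H}"
      by (rule inj_onI) (use inj_A in simp)
    ultimately show ?thesis by (simp add: hyperplanes_through_def card_image)
  qed
  have mult: "multiple_flats B = \<psi> ` multiple_flats A"
  proof -
    have thr: "hyperplanes_through B (\<psi> P) = hyperplanes_through A P" if "P \<in> codim2_flats A" for P
      by (rule through[OF subsetD[OF flats_sub that]])
    show ?thesis unfolding multiple_flats_def flats by (auto simp: thr)
  qed
  have M: "multiple_flats A \<subseteq> ?LA" using flats_sub by (simp add: multiple_flats_def subset_iff)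
  show ?thesis
  proof (intro exI[of _ \<psi>] conjI ballI)
    show "inj_on \<psi> ?LA" "B = \<psi> ` A" "multiple_flats B = \<psi> ` multiple_flats A"
      "multiple_flats A \<subseteq> ?LA" by (fact inj B_eq mult M)+
    show "X \<subseteq> Y \<longleftrightarrow> \<psi> X \<subseteq> \<psi> Y" if "X \<in> ?LA" "Y \<in> ?LA" for X Y by (rule ord[OF that])
    show "hyperplanes_through B (\<psi> P) = hyperplanes_through A P" if "P \<in> multiple_flats A" for P
      by (rule through[OF subsetD[OF M that]])
  qed
qed

text \<open>The condition on multiple flats and every number in the resolution depend only on
  inclusions of multiple flats in hyperplanes and on counts, all of which the isomorphism carries
  over.\<close>

lemma residual_degs_transfer:
  fixes A B :: "('v::finite \<Rightarrow> 'k::field) set set"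
  assumes A: "hyperplane_arrangement A" and B: "hyperplane_arrangement B" and AB: "same_combinatorics A B"
    and disj: "\<And>H P Q. H \<in> A \<Longrightarrow> P \<in> multiple_flats A \<Longrightarrow> Q \<in> multiple_flats A \<Longrightarrow> P \<subseteq> H \<Longrightarrow> Q \<subseteq> H \<Longrightarrow> P = Q"
  shows "\<And>H P Q. H \<in> B \<Longrightarrow> P \<in> multiple_flats B \<Longrightarrow> Q \<in> multiple_flats B \<Longrightarrow> P \<subseteq> H \<Longrightarrow> Q \<subseteq> H \<Longrightarrow> P = Q"
    and "card B = card A"
    and "residual_degs B (card {H \<in> B. \<not> (\<exists>P\<in>multiple_flats B. P \<subseteq> H)})
      = residual_degs A (card {H \<in> A. \<not> (\<exists>P\<in>multiple_flats A. P \<subseteq> H)})"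
proof -
  from same_combinatorics_transfer[OF A B AB] obtain \<psi> where
    T: "inj_on \<psi> (intersection_lattice A) \<and> B = \<psi> ` A \<and> multiple_flats B = \<psi> ` multiple_flats A \<and>
    (\<forall>X\<in>intersection_lattice A. \<forall>Y\<in>intersection_lattice A. X \<subseteq> Y \<longleftrightarrow> \<psi> X \<subseteq> \<psi> Y) \<and>
    multiple_flats A \<subseteq> intersection_lattice A \<and>
    (\<forall>P\<in>multiple_flats A. hyperplanes_through B (\<psi> P) = hyperplanes_through A P)" by (rule exE)
  have inj: "inj_on \<psi> (intersection_lattice A)" using T by (elim conjE)
  have BA: "B = \<psi> ` A" using T by (elim conjE)
  have mult: "multiple_flats B = \<psi> ` multiple_flats A" using T by (elim conjE)
  have "\<forall>X\<in>intersection_lattice A. \<forall>Y\<in>intersection_lattice A. X \<subseteq> Y \<longleftrightarrow> \<psi> X \<subseteq> \<psi> Y"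
    using T by (elim conjE)
  note ord = bspec[OF bspec[OF this]]
  have M: "multiple_flats A \<subseteq> intersection_lattice A" using T by (elim conjE)
  have "\<forall>P\<in>multiple_flats A. hyperplanes_through B (\<psi> P) = hyperplanes_through A P" using T by (elim conjE)
  note thr = bspec[OF this]
  have AL: "A \<subseteq> intersection_lattice A" by (rule subsetI) (rule hyperplane_in_lattice)
  have injA: "inj_on \<psi> A" and injM: "inj_on \<psi> (multiple_flats A)"
    by (rule inj_on_subset[OF inj AL] inj_on_subset[OF inj M])+
  have PH: "P \<subseteq> H \<longleftrightarrow> \<psi> P \<subseteq> \<psi> H" if "P \<in> multiple_flats A" "H \<in> A" for P H
    by (rule ord[OF subsetD[OF M that(1)] subsetD[OF AL that(2)]])
  show "P = Q" if q: "H \<in> B" "P \<in> multiple_flats B" "Q \<in> multiple_flats B" "P \<subseteq> H" "Q \<subseteq> H" for H P Q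
  proof -
    obtain H' P' Q' where e: "H = \<psi> H'" "P = \<psi> P'" "Q = \<psi> Q'" "H' \<in> A" "P' \<in> multiple_flats A" "Q' \<in> multiple_flats A"
      using q(1-3) unfolding mult unfolding BA by blast
    have "P' \<subseteq> H'" "Q' \<subseteq> H'" using PH[OF e(5,4)] PH[OF e(6,4)] q(4,5) e by simp_all
    then have "P' = Q'" by (rule disj[OF e(4-6)])
    then show ?thesis using e by simp
  qed
  show cB: "card B = card A" unfolding BA by (rule card_image[OF injA])
  have "{H \<in> B. \<not> (\<exists>P\<in>multiple_flats B. P \<subseteq> H)} = \<psi> ` {H \<in> A. \<not> (\<exists>P\<in>multiple_flats A. P \<subseteq> H)}"
  proof -
    have "(\<exists>P\<in>multiple_flats A. P \<subseteq> H) \<longleftrightarrow> (\<exists>P\<in>multiple_flats A. \<psi> P \<subseteq> \<psi> H)" if "H \<in> A" for H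
      using PH[OF _ that] by (intro bex_cong) auto
    then have "{H \<in> A. \<not> (\<exists>P\<in>multiple_flats A. P \<subseteq> H)} = {H \<in> A. \<not> (\<exists>P\<in>multiple_flats A. \<psi> P \<subseteq> \<psi> H)}"
      by metis
    moreover have "{x \<in> \<psi> ` S. Q x} = \<psi> ` {x \<in> S. Q (\<psi> x)}" for Q S by blast
    then have "{H \<in> B. \<not> (\<exists>P\<in>multiple_flats B. P \<subseteq> H)} = \<psi> ` {H \<in> A. \<not> (\<exists>P\<in>multiple_flats A. \<psi> P \<subseteq> \<psi> H)}"
      unfolding mult unfolding BA by simp
    ultimately show ?thesis by simp
  qed
  moreover have "inj_on \<psi> {H \<in> A. \<not> (\<exists>P\<in>multiple_flats A. P \<subseteq> H)}"
    using injA by (rule inj_on_subset) blast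
  ultimately have sB: "card {H \<in> B. \<not> (\<exists>P\<in>multiple_flats B. P \<subseteq> H)} = card {H \<in> A. \<not> (\<exists>P\<in>multiple_flats A. P \<subseteq> H)}"
    by (simp add: card_image)
  have mB: "card (multiple_flats B) = card (multiple_flats A)" unfolding mult by (rule card_image[OF injM])
  have "image_mset (\<lambda>P. int (card A) - int (hyperplanes_through B P) + 1) (mset_set (multiple_flats B))
      = image_mset (\<lambda>P. int (card A) - int (hyperplanes_through B (\<psi> P)) + 1) (mset_set (multiple_flats A))"
    unfolding mult image_mset_mset_set[OF injM, symmetric] by (simp add: multiset.map_comp comp_def)
  also have "\<dots> = image_mset (\<lambda>P. int (card A) - int (hyperplanes_through A P) + 1) (mset_set (multiple_flats A))"
    by (rule image_mset_cong) (use thr finite_multiple_flats[OF A] in simp)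
  finally have imB: "image_mset (\<lambda>P. int (card A) - int (hyperplanes_through B P) + 1) (mset_set (multiple_flats B))
      = image_mset (\<lambda>P. int (card A) - int (hyperplanes_through A P) + 1) (mset_set (multiple_flats A))" .
  show "residual_degs B (card {H \<in> B. \<not> (\<exists>P\<in>multiple_flats B. P \<subseteq> H)})
      = residual_degs A (card {H \<in> A. \<not> (\<exists>P\<in>multiple_flats A. P \<subseteq> H)})"
    unfolding residual_degs_def cB mB sB imB by (rule refl)
qed

lemma zariski_open_nonvanishing: "zariski_open {a. poly_eval f a \<noteq> 0}"
  unfolding zariski_open_def by (intro exI[of _ "{f}"]) simp

lemma defining_polynomial_nonvanishing:
  fixes A :: "('v::finite \<Rightarrow> 'k::field_char_0) set set"
  assumes "hyperplane_arrangement A" "defining_polynomial A f"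
  shows "{a. poly_eval f a \<noteq> 0} \<noteq> {}"
proof -
  obtain c where c: "\<And>H. H \<in> A \<Longrightarrow> c H \<noteq> (\<lambda>_. 0)" and fc: "f = (\<Prod>H\<in>A. linear_form (c H))"
    using assms(2) by (auto simp: defining_polynomial_def)
  have finA: "finite A" using assms(1) by (simp add: hyperplane_arrangement_def)
  have "\<exists>x. \<forall>b\<in>c ` A. dot b x \<noteq> 0" by (rule exists_nonvanishing) (use c finA in auto)
  then obtain x where "\<And>H. H \<in> A \<Longrightarrow> dot (c H) x \<noteq> 0" by blast
  then have "poly_eval f x \<noteq> 0" using finA by (simp add: fc)
  then show ?thesis by blast
qed

theorem theorem8p11:
  fixes A :: "('v::finite \<Rightarrow> 'k::field_char_0) set set"
    and f :: "('v, 'k) mpoly"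
    and n d s :: nat
  assumes "n \<ge> 2" and "CARD('v) = n + 1"
    and "hyperplane_arrangement A"
    and "defining_polynomial A f"
    and "d = card A"
    and "\<And>H P Q. H \<in> A \<Longrightarrow> P \<in> multiple_flats A \<Longrightarrow> Q \<in> multiple_flats A \<Longrightarrow>
           P \<subseteq> H \<Longrightarrow> Q \<subseteq> H \<Longrightarrow> P = Q"
    and "s = card {H \<in> A. \<not> (\<exists>P\<in>multiple_flats A. P \<subseteq> H)}"
  shows "\<exists>U. zariski_open U \<and> U \<noteq> {} \<and>
    (\<forall>a\<in>U.
       has_minimal_resolution (residual f a) {0}
         (\<lambda>i. if i = 0 then
                replicate_mset (card (multiple_flats A) + s) (int d - 1) +
                image_mset (\<lambda>P. int d - int (hyperplanes_through A P) + 1)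
                  (mset_set (multiple_flats A))
              else if i = 1 then
                replicate_mset (2 * card (multiple_flats A) + s - 1) (int d)
              else {#}) \<and>
       cohen_macaulay_quot (residual f a)) \<and>
    (\<forall>B g. hyperplane_arrangement B \<longrightarrow> defining_polynomial B g \<longrightarrow> same_combinatorics A B \<longrightarrow>
       (\<exists>V. zariski_open V \<and> V \<noteq> {} \<and>
          (\<forall>a\<in>U. \<forall>b\<in>V. \<forall>i j.
             graded_betti UNIV (residual f a) i j = graded_betti UNIV (residual g b) i j)))"
proof -
  have resA: "has_minimal_resolution (residual f a) {0} (residual_degs A s)" "cohen_macaulay_quot (residual f a)"
    "graded_betti UNIV (residual f a) i j = (if card A = 1 then 0 else count (case_nat {#0#} (residual_degs A s) i) j)"
    if "poly_eval f a \<noteq> 0" for a i j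
    by (rule residual_resolution[OF assms(3,4) _ assms(7) that]; rule assms(6); assumption)+
  let ?U = "\<lambda>f :: ('v, 'k) mpoly. {a. poly_eval f a \<noteq> 0}"
  have betti: "\<exists>V. zariski_open V \<and> V \<noteq> {} \<and> (\<forall>a\<in>?U f. \<forall>b\<in>V. \<forall>i j.
      graded_betti UNIV (residual f a) i j = graded_betti UNIV (residual g b) i j)"
    if B: "hyperplane_arrangement B" "defining_polynomial B g" "same_combinatorics A B" for B g
  proof (intro exI[of _ "?U g"] conjI ballI allI)
    show "zariski_open (?U g)" "?U g \<noteq> {}"
      by (rule zariski_open_nonvanishing defining_polynomial_nonvanishing[OF B(1,2)])+
    fix a b i j assume a: "a \<in> ?U f" and b: "b \<in> ?U g"
    have "card B = card A" and degs: "residual_degs B (card {H \<in> B. \<not> (\<exists>P\<in>multiple_flats B. P \<subseteq> H)})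
        = residual_degs A s"
      unfolding assms(7) by (rule residual_degs_transfer[OF assms(3) B(1,3)]; rule assms(6); assumption)+
    have disj: "P = Q" if "H \<in> B" "P \<in> multiple_flats B" "Q \<in> multiple_flats B" "P \<subseteq> H" "Q \<subseteq> H" for H P Q
      by (rule residual_degs_transfer(1)[OF assms(3) B(1,3) _ that]; rule assms(6); assumption)
    have nz: "poly_eval f a \<noteq> 0" "poly_eval g b \<noteq> 0" using a b by auto
    have "graded_betti UNIV (residual g b) i j = (if card B = 1 then 0 else count (case_nat {#0#}
        (residual_degs B (card {H \<in> B. \<not> (\<exists>P\<in>multiple_flats B. P \<subseteq> H)})) i) j)"
      by (rule residual_resolution(3)[OF B(1,2) _ refl nz(2)]; rule disj; assumption)
    then show "graded_betti UNIV (residual f a) i j = graded_betti UNIV (residual g b) i j"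
      unfolding resA(3)[OF nz(1)] degs \<open>card B = card A\<close> by (rule sym)
  qed
  have res: "has_minimal_resolution (residual f a) {0}
         (\<lambda>i. if i = 0 then
                replicate_mset (card (multiple_flats A) + s) (int d - 1) +
                image_mset (\<lambda>P. int d - int (hyperplanes_through A P) + 1)
                  (mset_set (multiple_flats A))
              else if i = 1 then
                replicate_mset (2 * card (multiple_flats A) + s - 1) (int d)
              else {#}) \<and> cohen_macaulay_quot (residual f a)" if "a \<in> ?U f" for a
    using resA(1,2)[of a] that unfolding residual_degs_def assms(5) by simp
  have U: "zariski_open (?U f)" "?U f \<noteq> {}"
    by (rule zariski_open_nonvanishing defining_polynomial_nonvanishing[OF assms(3,4)])+
  show ?thesis
    by (rule exI[of _ "?U f"], intro conjI[OF U(1) conjI[OF U(2) conjI]] ballI allI impI)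
      (rule res betti; assumption)+
qed

end
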